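(* Let $(M,g,J_{+},J_{-})$ be a bihermitian manifold such that $\dim_{\mathbb{C}}M=3$ and $\dim_{\mathbb{C}}M_{0}\leq1$. Then $M^{(2,1)}$ and $M^{(1,2)}$ are empty.
   Context: A bihermitian manifold $(M,g,J_+,J_-)$ is a Riemannian manifold $(M,g)$ equipped with two (integrable) complex structures $J_+,J_-$, both $g$-orthogonal, such that $\nabla^{+}J_{+}=0$ and $\nabla^{-}J_{-}=0$, where $\nabla^{\pm}=\nabla^{Levi}\pm\frac12g^{-1}H$ for a closed three-form $H$; here $\nabla^{Levi}$ is the Levi-Civita connection and $(g^{-1}H)_vw=g^{-1}(H(v,w,\cdot))$. $M_0=\{x\in M\mid[J_+,J_-]|_x=0\}$, which is a holomorphic subvariety of both $(M,J_+)$ and $(M,J_-)$. $M^{(m_1,m_{-1})}=\{x\in M\mid\dim_{\mathbb{R}}\operatorname{Ker}(J_++J_-)|_x=2m_1,\ \dim_{\mathbb{R}}\operatorname{Ker}(J_+-J_-)|_x=2m_{-1}\}$. *)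

theory Defs
  imports "HOL-Analysis.Analysis"
begin

section \<open>Smooth maps between open subsets of Euclidean spaces\<close>

primrec Ck_on :: "nat \<Rightarrow> 'e::euclidean_space set \<Rightarrow> ('e \<Rightarrow> 'f::euclidean_space) \<Rightarrow> bool" where
  "Ck_on 0 S f \<longleftrightarrow> continuous_on S f"
| "Ck_on (Suc k) S f \<longleftrightarrow>
     (\<forall>x\<in>S. f differentiable (at x)) \<and>
     (\<forall>v. Ck_on k S (\<lambda>x. frechet_derivative f (at x) v))"

definition smooth_on :: "'e::euclidean_space set \<Rightarrow> ('e \<Rightarrow> 'f::euclidean_space) \<Rightarrow> bool" where
  "smooth_on S f \<longleftrightarrow> (\<forall>k. Ck_on k S f)"

text \<open>Directional derivative \<open>D\<^sub>v f (y)\<close>.\<close>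

abbreviation ddir :: "('e::euclidean_space \<Rightarrow> 'f::euclidean_space) \<Rightarrow> 'e \<Rightarrow> 'e \<Rightarrow> 'f" where
  "ddir f y v \<equiv> frechet_derivative f (at y) v"

section \<open>Smooth manifolds\<close>

text \<open>
  A chart is a pair of its domain and its coordinate map; the values of the coordinate map outside
  the domain are irrelevant.
\<close>

type_synonym ('a, 'e) chart = "'a set \<times> ('a \<Rightarrow> 'e)"

abbreviation cdom :: "('a, 'e) chart \<Rightarrow> 'a set" where
  "cdom c \<equiv> fst c"

abbreviation coord :: "('a, 'e) chart \<Rightarrow> 'a \<Rightarrow> 'e" where
  "coord c \<equiv> snd c"

definition crange :: "('a, 'e) chart \<Rightarrow> 'e set" where
  "crange c = coord c ` cdom c"

definition is_chart :: "'a topology \<Rightarrow> ('a, 'e::euclidean_space) chart \<Rightarrow> bool" where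
  "is_chart X c \<longleftrightarrow>
     openin X (cdom c) \<and> open (crange c) \<and>
     homeomorphic_map (subtopology X (cdom c)) (top_of_set (crange c)) (coord c)"

text \<open>The coordinate change from \<open>c\<close> to \<open>d\<close> is meaningful on \<open>overlap c d\<close>.\<close>

definition overlap :: "('a, 'e) chart \<Rightarrow> ('a, 'e) chart \<Rightarrow> 'e set" where
  "overlap c d = coord c ` (cdom c \<inter> cdom d)"

definition transition :: "('a, 'e) chart \<Rightarrow> ('a, 'e) chart \<Rightarrow> 'e \<Rightarrow> 'e" where
  "transition c d = (\<lambda>y. coord d (inv_into (cdom c) (coord c) y))"

definition transition_deriv ::
  "('a, 'e::euclidean_space) chart \<Rightarrow> ('a, 'e) chart \<Rightarrow> 'e \<Rightarrow> 'e \<Rightarrow> 'e" where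
  "transition_deriv c d y = frechet_derivative (transition c d) (at y)"

definition smooth_compatible ::
  "('a, 'e::euclidean_space) chart \<Rightarrow> ('a, 'e) chart \<Rightarrow> bool" where
  "smooth_compatible c d \<longleftrightarrow>
     smooth_on (overlap c d) (transition c d) \<and> smooth_on (overlap d c) (transition d c)"

definition smooth_manifold :: "'a topology \<Rightarrow> ('a, 'e::euclidean_space) chart set \<Rightarrow> bool" where
  "smooth_manifold X A \<longleftrightarrow>
     Hausdorff_space X \<and> second_countable X \<and>
     (\<Union>c\<in>A. cdom c) = topspace X \<and>
     (\<forall>c\<in>A. is_chart X c) \<and>
     (\<forall>c\<in>A. \<forall>d\<in>A. smooth_compatible c d)"

section \<open>Tensor fields and connections\<close>

text \<open>
  A tensor field is given by its coordinate expressions, one for each chart of the atlas, as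
  functions on the range of the chart, and these are related by the usual transformation law.
  A tangent vector at the point with \<open>c\<close>-coordinate \<open>y\<close> and \<open>c\<close>-components \<open>v\<close> has
  \<open>d\<close>-components \<open>transition_deriv c d y v\<close>.
\<close>

type_synonym ('a, 'e) bilinear_form_field = "('a, 'e) chart \<Rightarrow> 'e \<Rightarrow> 'e \<Rightarrow> 'e \<Rightarrow> real"
type_synonym ('a, 'e) three_form_field = "('a, 'e) chart \<Rightarrow> 'e \<Rightarrow> 'e \<Rightarrow> 'e \<Rightarrow> 'e \<Rightarrow> real"
type_synonym ('a, 'e) endomorphism_field = "('a, 'e) chart \<Rightarrow> 'e \<Rightarrow> 'e \<Rightarrow> 'e"
type_synonym ('a, 'e) christoffel = "('a, 'e) chart \<Rightarrow> 'e \<Rightarrow> 'e \<Rightarrow> 'e \<Rightarrow> 'e"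

definition riemannian_metric ::
  "('a, 'e::euclidean_space) chart set \<Rightarrow> ('a, 'e) bilinear_form_field \<Rightarrow> bool" where
  "riemannian_metric A g \<longleftrightarrow>
     (\<forall>c\<in>A. \<forall>y\<in>crange c. bilinear (g c y) \<and>
        (\<forall>v w. g c y v w = g c y w v) \<and> (\<forall>v. v \<noteq> 0 \<longrightarrow> g c y v v > 0)) \<and>
     (\<forall>c\<in>A. \<forall>v w. smooth_on (crange c) (\<lambda>y. g c y v w)) \<and>
     (\<forall>c\<in>A. \<forall>d\<in>A. \<forall>y\<in>overlap c d. \<forall>v w.
        g d (transition c d y) (transition_deriv c d y v) (transition_deriv c d y w) = g c y v w)"

definition endomorphism_field ::
  "('a, 'e::euclidean_space) chart set \<Rightarrow> ('a, 'e) endomorphism_field \<Rightarrow> bool" where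
  "endomorphism_field A J \<longleftrightarrow>
     (\<forall>c\<in>A. \<forall>y\<in>crange c. linear (J c y)) \<and>
     (\<forall>c\<in>A. \<forall>v. smooth_on (crange c) (\<lambda>y. J c y v)) \<and>
     (\<forall>c\<in>A. \<forall>d\<in>A. \<forall>y\<in>overlap c d. \<forall>v.
        J d (transition c d y) (transition_deriv c d y v) = transition_deriv c d y (J c y v))"

definition three_form ::
  "('a, 'e::euclidean_space) chart set \<Rightarrow> ('a, 'e) three_form_field \<Rightarrow> bool" where
  "three_form A H \<longleftrightarrow>
     (\<forall>c\<in>A. \<forall>y\<in>crange c.
        (\<forall>v w. linear (H c y v w)) \<and>
        (\<forall>u v w. H c y v u w = - H c y u v w \<and> H c y u w v = - H c y u v w)) \<and>
     (\<forall>c\<in>A. \<forall>u v w. smooth_on (crange c) (\<lambda>y. H c y u v w)) \<and>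
     (\<forall>c\<in>A. \<forall>d\<in>A. \<forall>y\<in>overlap c d. \<forall>u v w.
        H d (transition c d y) (transition_deriv c d y u) (transition_deriv c d y v) (transition_deriv c d y w)
          = H c y u v w)"

text \<open>
  The exterior derivative evaluated on constant coordinate vector fields, for which all the
  bracket terms vanish.
\<close>

definition closed_three_form ::
  "('a, 'e::euclidean_space) chart set \<Rightarrow> ('a, 'e) three_form_field \<Rightarrow> bool" where
  "closed_three_form A H \<longleftrightarrow> three_form A H \<and>
     (\<forall>c\<in>A. \<forall>y\<in>crange c. \<forall>t u v w.
        ddir (\<lambda>z. H c z u v w) y t - ddir (\<lambda>z. H c z t v w) y u
        + ddir (\<lambda>z. H c z t u w) y v - ddir (\<lambda>z. H c z t u v) y w = 0)"

text \<open>
  An affine connection is given by its Christoffel symbols: in the chart \<open>c\<close>, the covariant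
  derivative of a vector field \<open>W\<close> in direction \<open>v\<close> is \<open>D\<^sub>v W + \<Gamma> c y v W\<close>.
\<close>

definition affine_connection ::
  "('a, 'e::euclidean_space) chart set \<Rightarrow> ('a, 'e) christoffel \<Rightarrow> bool" where
  "affine_connection A \<Gamma> \<longleftrightarrow>
     (\<forall>c\<in>A. \<forall>y\<in>crange c. bilinear (\<Gamma> c y)) \<and>
     (\<forall>c\<in>A. \<forall>v w. smooth_on (crange c) (\<lambda>y. \<Gamma> c y v w)) \<and>
     (\<forall>c\<in>A. \<forall>d\<in>A. \<forall>y\<in>overlap c d. \<forall>v w.
        ddir (\<lambda>z. transition_deriv c d z w) y v
          + \<Gamma> d (transition c d y) (transition_deriv c d y v) (transition_deriv c d y w)
        = transition_deriv c d y (\<Gamma> c y v w))"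

definition levi_civita ::
  "('a, 'e::euclidean_space) chart set \<Rightarrow> ('a, 'e) bilinear_form_field \<Rightarrow>
   ('a, 'e) christoffel \<Rightarrow> bool" where
  "levi_civita A g \<Gamma> \<longleftrightarrow> affine_connection A \<Gamma> \<and>
     (\<forall>c\<in>A. \<forall>y\<in>crange c.
        (\<forall>v w. \<Gamma> c y v w = \<Gamma> c y w v) \<and>
        (\<forall>u v w. ddir (\<lambda>z. g c z v w) y u = g c y (\<Gamma> c y u v) w + g c y v (\<Gamma> c y u w)))"

definition raise_index :: "('e \<Rightarrow> 'e \<Rightarrow> real) \<Rightarrow> ('e \<Rightarrow> real) \<Rightarrow> 'e" where
  "raise_index b \<alpha> = (THE u. \<forall>z. b u z = \<alpha> z)"

definition add_torsion ::
  "('a, 'e::euclidean_space) bilinear_form_field \<Rightarrow> ('a, 'e) christoffel \<Rightarrow> real \<Rightarrow>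
   ('a, 'e) three_form_field \<Rightarrow> ('a, 'e) christoffel" where
  "add_torsion g \<Gamma> s H = (\<lambda>c y v w. \<Gamma> c y v w + s *\<^sub>R raise_index (g c y) (H c y v w))"

text \<open>\<open>(\<nabla>\<^sub>v J) w = \<nabla>\<^sub>v (J w) - J (\<nabla>\<^sub>v w)\<close> for constant coordinate fields \<open>w\<close>.\<close>

definition parallel ::
  "('a, 'e::euclidean_space) chart set \<Rightarrow> ('a, 'e) christoffel \<Rightarrow>
   ('a, 'e) endomorphism_field \<Rightarrow> bool" where
  "parallel A \<Gamma> J \<longleftrightarrow>
     (\<forall>c\<in>A. \<forall>y\<in>crange c. \<forall>v w.
        ddir (\<lambda>z. J c z w) y v + \<Gamma> c y v (J c y w) - J c y (\<Gamma> c y v w) = 0)"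

section \<open>Complex structures\<close>

text \<open>
  From here on the manifold is modelled on the real vector space underlying \<open>\<complex>\<^sup>n\<close>. Charts of the
  atlas are merely smooth in the real sense, so this only says that the real dimension is
  \<open>2 * CARD('n)\<close>. A chart is holomorphic for \<open>J\<close> if it belongs to the smooth structure and its
  differential intertwines \<open>J\<close> with multiplication by \<open>\<i>\<close>.
\<close>

definition holomorphic_chart ::
  "'a topology \<Rightarrow> ('a, complex^'n) chart set \<Rightarrow> ('a, complex^'n) endomorphism_field \<Rightarrow>
   ('a, complex^'n) chart \<Rightarrow> bool" where
  "holomorphic_chart X A J h \<longleftrightarrow>
     is_chart X h \<and> (\<forall>c\<in>A. smooth_compatible c h) \<and>
     (\<forall>c\<in>A. \<forall>y\<in>overlap c h. \<forall>v. transition_deriv c h y (J c y v) = \<i> *s transition_deriv c h y v)"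

definition complex_structure ::
  "'a topology \<Rightarrow> ('a, complex^'n) chart set \<Rightarrow> ('a, complex^'n) endomorphism_field \<Rightarrow> bool" where
  "complex_structure X A J \<longleftrightarrow>
     endomorphism_field A J \<and>
     (\<forall>c\<in>A. \<forall>y\<in>crange c. \<forall>v. J c y (J c y v) = - v) \<and>
     (\<forall>p\<in>topspace X. \<exists>h. holomorphic_chart X A J h \<and> p \<in> cdom h)"

definition orthogonal_field ::
  "('a, 'e::euclidean_space) chart set \<Rightarrow> ('a, 'e) bilinear_form_field \<Rightarrow>
   ('a, 'e) endomorphism_field \<Rightarrow> bool" where
  "orthogonal_field A g J \<longleftrightarrow>
     (\<forall>c\<in>A. \<forall>y\<in>crange c. \<forall>v w. g c y (J c y v) (J c y w) = g c y v w)"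

text \<open>
  The complex dimension of an analytic subset \<open>S\<close> of \<open>(M, J)\<close> is the supremum of its dimensions at
  regular points, that is, points near which \<open>S\<close> is a complex submanifold. It is \<open>-\<infinity>\<close> if \<open>S\<close> is
  empty. Note that \<open>vec.subspace\<close> and \<open>vec.dim\<close> refer to the complex vector space structure.
\<close>

definition complex_regular_point ::
  "'a topology \<Rightarrow> ('a, complex^'n) chart set \<Rightarrow> ('a, complex^'n) endomorphism_field \<Rightarrow>
   'a set \<Rightarrow> nat \<Rightarrow> 'a \<Rightarrow> bool" where
  "complex_regular_point X A J S k p \<longleftrightarrow> p \<in> S \<and>
     (\<exists>h L. holomorphic_chart X A J h \<and> p \<in> cdom h \<and>
        vec.subspace L \<and> vec.dim L = k \<and> coord h ` (S \<inter> cdom h) = crange h \<inter> L)"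

definition complex_dim ::
  "'a topology \<Rightarrow> ('a, complex^'n) chart set \<Rightarrow> ('a, complex^'n) endomorphism_field \<Rightarrow>
   'a set \<Rightarrow> ereal" where
  "complex_dim X A J S = Sup {ereal (real k) | k. \<exists>p. complex_regular_point X A J S k p}"

section \<open>Bihermitian manifolds\<close>

definition bihermitian_manifold ::
  "'a topology \<Rightarrow> ('a, complex^'n) chart set \<Rightarrow> ('a, complex^'n) bilinear_form_field \<Rightarrow>
   ('a, complex^'n) endomorphism_field \<Rightarrow> ('a, complex^'n) endomorphism_field \<Rightarrow> bool" where
  "bihermitian_manifold X A g Jp Jm \<longleftrightarrow>
     smooth_manifold X A \<and> riemannian_metric A g \<and>
     complex_structure X A Jp \<and> complex_structure X A Jm \<and>
     orthogonal_field A g Jp \<and> orthogonal_field A g Jm \<and>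
     (\<exists>\<Gamma> H. levi_civita A g \<Gamma> \<and> closed_three_form A H \<and>
        parallel A (add_torsion g \<Gamma> (1/2) H) Jp \<and>
        parallel A (add_torsion g \<Gamma> (-1/2) H) Jm)"

definition commuting_locus ::
  "'a topology \<Rightarrow> ('a, 'e) chart set \<Rightarrow> ('a, 'e) endomorphism_field \<Rightarrow>
   ('a, 'e) endomorphism_field \<Rightarrow> 'a set" where
  "commuting_locus X A Jp Jm =
     {p \<in> topspace X. \<forall>c\<in>A. p \<in> cdom c \<longrightarrow>
        (\<forall>v. Jp c (coord c p) (Jm c (coord c p) v) = Jm c (coord c p) (Jp c (coord c p) v))}"

text \<open>The set \<open>M\<^sup>(\<^sup>m\<^sup>1\<^sup>,\<^sup>m\<^sup>2\<^sup>)\<close>, where \<open>m2\<close> is the index written \<open>m\<^sub>-\<^sub>1\<close>; \<open>dim\<close> is the real dimension.\<close>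

definition type_stratum ::
  "'a topology \<Rightarrow> ('a, 'e::euclidean_space) chart set \<Rightarrow> ('a, 'e) endomorphism_field \<Rightarrow>
   ('a, 'e) endomorphism_field \<Rightarrow> nat \<Rightarrow> nat \<Rightarrow> 'a set" where
  "type_stratum X A Jp Jm m1 m2 =
     {p \<in> topspace X. \<forall>c\<in>A. p \<in> cdom c \<longrightarrow>
        dim {v. Jp c (coord c p) v + Jm c (coord c p) v = 0} = 2 * m1 \<and>
        dim {v. Jp c (coord c p) v - Jm c (coord c p) v = 0} = 2 * m2}"

end

theory Submission
  imports Defs "HOL-Complex_Analysis.Conformal_Mappings"
begin

text \<open>
  Write \<open>I = J\<^sub>+\<close> and \<open>J = J\<^sub>-\<close>. The bivector \<open>[I, J] g\<^sup>-\<^sup>1\<close>, whose zero set is the commuting locus \<open>M\<^sub>0\<close>, is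
  the real part of a bivector that is holomorphic for \<open>I\<close>. In terms of functions: if \<open>\<xi>\<close> and \<open>\<eta>\<close> are local
  \<open>I\<close>-holomorphic functions, then so is their bracket \<open>d\<xi>(J B)\<close>, where \<open>B\<close> is the complex gradient of \<open>\<eta>\<close>
  (\<open>bracket_holomorphic\<close>). Computed with \<open>\<nabla>\<^sup>+\<close>, for which \<open>I\<close> is parallel, its antiholomorphic derivative consists
  of torsion terms, which cancel.

  In complex dimension three a nonzero alternating bivector has rank two. At a point of type (2,1) the
  anticommutator of \<open>I\<close> and \<open>J\<close> is \<open>-2\<close> on a complex line and \<open>2\<close> on the complementary complex plane, and
  the signs persist nearby. As the anticommutator commutes with \<open>[I, J]\<close>, this controls the position
  of the kernel of the bivector: if the component of the bivector along the plane is zero at a nearby point, then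
  the whole bivector is zero (\<open>commute_if_commutator_pairing_zero\<close>). So near a point of type (2,1) the set \<open>M\<^sub>0\<close>
  is the zero set of a single holomorphic function (\<open>commuting_locus_locally_zero_set\<close>).

  This function vanishes at the given point, where \<open>I\<close> and \<open>J\<close> commute. The zero set of a holomorphic function of
  three variables, if it is not empty, has regular points of dimension at least two arbitrarily close to each
  of its points (\<open>zero_set_has_hypersurface_point\<close>), which contradicts the bound on the dimension of \<open>M\<^sub>0\<close>.
  The case of type (1,2) follows by replacing \<open>J\<^sub>-\<close> with \<open>- J\<^sub>-\<close>.

  The bracket is computed in a smooth chart, where tensor fields and connections are functions of a point of
  Euclidean space, and is then transported to a chart that is holomorphic for \<open>I\<close>.
\<close>

section \<open>Calculus of functions of class \<open>C\<^sup>k\<close>\<close>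

lemma ddir_eqI: "(f has_derivative f') (at x) \<Longrightarrow> ddir f x v = f' v"
  using frechet_derivative_at by metis

lemma ddir_has_derivative: "f differentiable (at x) \<Longrightarrow> (f has_derivative ddir f x) (at x)"
  by (simp add: frechet_derivative_works)

lemma linear_ddir: "f differentiable (at x) \<Longrightarrow> linear (ddir f x)"
  by (rule linear_frechet_derivative)

lemma ddir_cong_open:
  assumes "open S" "x \<in> S" "\<And>y. y \<in> S \<Longrightarrow> f y = g y"
  shows "ddir f x v = ddir g x v"
proof -
  have "(f has_derivative f') (at x) \<longleftrightarrow> (g has_derivative f') (at x)" for f'
    using assms has_derivative_transform_within_open by metis
  then show ?thesis by (simp add: frechet_derivative_def)
qed

lemma differentiable_cong_open:
  assumes "open S" "x \<in> S" "\<And>y. y \<in> S \<Longrightarrow> f y = g y" "f differentiable (at x)"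
  shows "g differentiable (at x)"
  using assms has_derivative_transform_within_open unfolding differentiable_def by metis

lemma Ck_on_cong:
  assumes "open S" "\<And>y. y \<in> S \<Longrightarrow> f y = g y" "Ck_on k S f"
  shows "Ck_on k S g"
  using assms(2,3)
proof (induction k arbitrary: f g)
  case 0
  then show ?case by (auto cong: continuous_on_cong)
next
  case (Suc k)
  have "Ck_on k S (\<lambda>x. ddir g x v)" for v
    by (rule Suc.IH[of "\<lambda>x. ddir f x v"])
      (use Suc.prems ddir_cong_open[OF assms(1) _ Suc.prems(1)] in auto)
  then show ?case
    using Suc.prems differentiable_cong_open[OF assms(1) _ Suc.prems(1)] by auto
qed

lemma Ck_on_subset: "Ck_on k S f \<Longrightarrow> T \<subseteq> S \<Longrightarrow> Ck_on k T f"
  by (induction k arbitrary: f) (auto intro: continuous_on_subset)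

lemma Ck_on_SucD: "Ck_on (Suc k) S f \<Longrightarrow> Ck_on k S f"
proof (induction k arbitrary: f)
  case 0
  then show ?case
    by (auto intro!: continuous_at_imp_continuous_on differentiable_imp_continuous_within)
next
  case (Suc k)
  then show ?case by (metis Ck_on.simps(2))
qed

lemma Ck_on_const: "Ck_on k S (\<lambda>x. c)"
  by (induction k arbitrary: c) auto

lemma Ck_on_bounded_linear:
  assumes "bounded_linear f" shows "Ck_on k S f"
proof (cases k)
  case 0
  then show ?thesis using assms by (simp add: linear_continuous_on)
next
  case (Suc j)
  have D: "(f has_derivative f) (at x)" for x
    using assms by (rule bounded_linear_imp_has_derivative)
  then have "ddir f x v = f v" for x v by (rule ddir_eqI)
  with D show ?thesis unfolding Suc by (auto simp: differentiable_def Ck_on_const)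
qed

lemma Ck_on_add:
  assumes "Ck_on k S f" "Ck_on k S g" "open S"
  shows "Ck_on k S (\<lambda>x. f x + g x)"
  using assms(1,2)
proof (induction k arbitrary: f g)
  case 0
  then show ?case by (auto intro: continuous_intros)
next
  case (Suc k)
  have D: "((\<lambda>x. f x + g x) has_derivative (\<lambda>v. ddir f x v + ddir g x v)) (at x)" if "x \<in> S" for x
    using Suc.prems that by (auto intro!: has_derivative_add ddir_has_derivative)
  have "Ck_on k S (\<lambda>x. ddir (\<lambda>x. f x + g x) x v)" for v
    by (rule Ck_on_cong[OF assms(3) _ Suc.IH]) (use Suc.prems ddir_eqI[OF D] in auto)
  then show ?case using D by (auto simp: differentiable_def)
qed

lemma Ck_on_sum:
  assumes "\<And>i. i \<in> I \<Longrightarrow> Ck_on k S (f i)" "open S"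
  shows "Ck_on k S (\<lambda>x. \<Sum>i\<in>I. f i x)"
  using assms(1)
  by (induction I rule: infinite_finite_induct)
    (auto intro: Ck_on_const Ck_on_add assms(2))

lemma Ck_on_bilinear:
  fixes prd :: "'f::euclidean_space \<Rightarrow> 'g::euclidean_space \<Rightarrow> 'h::euclidean_space"
  assumes "bounded_bilinear prd" "Ck_on k S f" "Ck_on k S g" "open S"
  shows "Ck_on k S (\<lambda>x. prd (f x) (g x))"
  using assms(2,3)
proof (induction k arbitrary: f g)
  case 0
  then show ?case using bounded_bilinear.continuous_on[OF assms(1)] by auto
next
  case (Suc k)
  have D: "((\<lambda>x. prd (f x) (g x)) has_derivative (\<lambda>v. prd (f x) (ddir g x v) + prd (ddir f x v) (g x))) (at x)"
    if "x \<in> S" for x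
    using Suc.prems that
    by (auto intro!: bounded_bilinear.FDERIV[OF assms(1)] ddir_has_derivative)
  have "Ck_on k S (\<lambda>x. ddir (\<lambda>x. prd (f x) (g x)) x v)" for v
  proof (rule Ck_on_cong[OF assms(4)])
    show "Ck_on k S (\<lambda>x. prd (f x) (ddir g x v) + prd (ddir f x v) (g x))"
      using Suc.prems Ck_on_SucD[OF Suc.prems(1)] Ck_on_SucD[OF Suc.prems(2)]
      by (intro Ck_on_add Suc.IH assms(4)) auto
  qed (use ddir_eqI[OF D] in auto)
  then show ?case using D by (auto simp: differentiable_def)
qed

lemma Ck_on_linear_compose:
  assumes "bounded_linear L" "Ck_on k S f" "open S"
  shows "Ck_on k S (\<lambda>x. L (f x))"
  using assms(2)
proof (induction k arbitrary: f)
  case 0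
  then show ?case using bounded_linear.continuous_on[OF assms(1)] by auto
next
  case (Suc k)
  have D: "((\<lambda>x. L (f x)) has_derivative (\<lambda>v. L (ddir f x v))) (at x)" if "x \<in> S" for x
    using Suc.prems that by (auto intro!: bounded_linear.has_derivative[OF assms(1)] ddir_has_derivative)
  have "Ck_on k S (\<lambda>x. ddir (\<lambda>x. L (f x)) x v)" for v
    by (rule Ck_on_cong[OF assms(3) _ Suc.IH[of "\<lambda>x. ddir f x v"]]) (use Suc.prems ddir_eqI[OF D] in auto)
  then show ?case using D by (auto simp: differentiable_def)
qed

lemma Ck_on_diff:
  assumes "Ck_on k S f" "Ck_on k S g" "open S"
  shows "Ck_on k S (\<lambda>x. f x - g x)"
  using Ck_on_add[OF assms(1) Ck_on_linear_compose[OF bounded_linear_minus[OF bounded_linear_ident] assms(2,3)] assms(3)]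
  by simp

lemma linear_eq_sum_Basis:
  assumes "linear f" shows "f v = (\<Sum>b\<in>Basis. (v \<bullet> b) *\<^sub>R f b)"
  using linear_sum[OF assms, of "\<lambda>b. (v \<bullet> b) *\<^sub>R b" Basis] linear_scale[OF assms]
  by (simp add: euclidean_representation)

lemma Ck_on_compose:
  assumes "Ck_on k T f" "Ck_on k S g" "g ` S \<subseteq> T" "open S" "open T"
  shows "Ck_on k S (\<lambda>x. f (g x))"
  using assms(1,2)
proof (induction k arbitrary: f)
  case 0
  then show ?case using assms(3) by (auto intro: continuous_on_compose2)
next
  case (Suc k)
  have D: "((\<lambda>x. f (g x)) has_derivative (\<lambda>v. ddir f (g x) (ddir g x v))) (at x)"
    if "x \<in> S" for x
    using Suc.prems that assms(3)
    by (intro has_derivative_compose[where g = f and f = g] ddir_has_derivative) auto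
  have "Ck_on k S (\<lambda>x. ddir (\<lambda>x. f (g x)) x v)" for v
  proof (rule Ck_on_cong[OF assms(4)])
    show "Ck_on k S (\<lambda>x. \<Sum>b\<in>Basis. (ddir g x v \<bullet> b) *\<^sub>R ddir f (g x) b)"
      using Suc.prems Ck_on_SucD[OF Suc.prems(2)]
      by (intro Ck_on_sum assms(4) Ck_on_bilinear[OF bounded_bilinear_scaleR] Suc.IH
          Ck_on_linear_compose[OF bounded_linear_inner_left]) auto
    show "(\<Sum>b\<in>Basis. (ddir g x v \<bullet> b) *\<^sub>R ddir f (g x) b) = ddir (\<lambda>x. f (g x)) x v" if "x \<in> S" for x
      using Suc.prems that assms(3)
      by (subst ddir_eqI[OF D]) (auto intro!: linear_eq_sum_Basis[symmetric] linear_ddir)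
  qed
  then show ?case using D by (auto simp: differentiable_def)
qed

lemma Ck_on_inverse:
  fixes f :: "'e::euclidean_space \<Rightarrow> complex"
  assumes "Ck_on k S f" "open S" "\<And>x. x \<in> S \<Longrightarrow> f x \<noteq> 0"
  shows "Ck_on k S (\<lambda>x. inverse (f x))"
  using assms(1)
proof (induction k)
  case 0
  then show ?case using assms(3) by (auto intro!: continuous_intros)
next
  case (Suc k)
  have D: "((\<lambda>x. inverse (f x)) has_derivative (\<lambda>v. - (inverse (f x) * ddir f x v * inverse (f x)))) (at x)"
    if "x \<in> S" for x
    using Suc.prems that assms(3) by (auto intro!: Deriv.has_derivative_inverse ddir_has_derivative)
  have I: "Ck_on k S (\<lambda>x. inverse (f x))" using Suc Ck_on_SucD by blast
  have "Ck_on k S (\<lambda>x. ddir (\<lambda>x. inverse (f x)) x v)" for v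
  proof (rule Ck_on_cong[OF assms(2)])
    show "Ck_on k S (\<lambda>x. - (inverse (f x) * ddir f x v * inverse (f x)))"
      using Suc.prems I
      by (intro Ck_on_linear_compose[OF bounded_linear_minus[OF bounded_linear_ident]]
          Ck_on_bilinear[OF bounded_bilinear_mult] assms(2)) auto
  qed (use ddir_eqI[OF D] in auto)
  then show ?case using D by (auto simp: differentiable_def)
qed

lemma smooth_onI: "(\<And>k. Ck_on k S f) \<Longrightarrow> smooth_on S f"
  by (simp add: smooth_on_def)

lemma smooth_onD: "smooth_on S f \<Longrightarrow> Ck_on k S f"
  by (simp add: smooth_on_def)

lemma smooth_on_cong: "open S \<Longrightarrow> (\<And>y. y \<in> S \<Longrightarrow> f y = g y) \<Longrightarrow> smooth_on S f \<Longrightarrow> smooth_on S g"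
  by (rule smooth_onI, rule Ck_on_cong[where f = f]) (simp_all add: smooth_onD)

lemma smooth_on_subset: "smooth_on S f \<Longrightarrow> T \<subseteq> S \<Longrightarrow> smooth_on T f"
  by (rule smooth_onI, rule Ck_on_subset) (simp_all add: smooth_onD)

lemma smooth_on_compose:
  "smooth_on T f \<Longrightarrow> smooth_on S g \<Longrightarrow> g ` S \<subseteq> T \<Longrightarrow> open S \<Longrightarrow> open T \<Longrightarrow> smooth_on S (\<lambda>x. f (g x))"
  by (rule smooth_onI, rule Ck_on_compose[where T = T]) (simp_all add: smooth_onD)

lemma smooth_on_ddir: "smooth_on S f \<Longrightarrow> smooth_on S (\<lambda>x. ddir f x v)"
  using smooth_onD[of S f "Suc _"] by (intro smooth_onI) simp

lemma smooth_on_differentiable: "smooth_on S f \<Longrightarrow> x \<in> S \<Longrightarrow> f differentiable (at x)"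
  using smooth_onD[of S f "Suc 0"] by simp

lemma smooth_on_continuous: "smooth_on S f \<Longrightarrow> continuous_on S f"
  using smooth_onD[of S f 0] by simp

lemma smooth_on_bounded_linear: "bounded_linear f \<Longrightarrow> smooth_on S f"
  by (intro smooth_onI Ck_on_bounded_linear)

lemma smooth_on_add: "smooth_on S f \<Longrightarrow> smooth_on S g \<Longrightarrow> open S \<Longrightarrow> smooth_on S (\<lambda>x. f x + g x)"
  by (rule smooth_onI, rule Ck_on_add) (simp_all add: smooth_onD)

lemma smooth_on_diff: "smooth_on S f \<Longrightarrow> smooth_on S g \<Longrightarrow> open S \<Longrightarrow> smooth_on S (\<lambda>x. f x - g x)"
  by (rule smooth_onI, rule Ck_on_diff) (simp_all add: smooth_onD)

lemma smooth_on_bilinear: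
  "bounded_bilinear prd \<Longrightarrow> smooth_on S f \<Longrightarrow> smooth_on S g \<Longrightarrow> open S \<Longrightarrow>
    smooth_on S (\<lambda>x. prd (f x :: 'f::euclidean_space) (g x :: 'g::euclidean_space) :: 'h::euclidean_space)"
  by (rule smooth_onI, rule Ck_on_bilinear) (simp_all add: smooth_onD)

lemma smooth_on_linear_compose:
  "bounded_linear L \<Longrightarrow> smooth_on S f \<Longrightarrow> open S \<Longrightarrow> smooth_on S (\<lambda>x. L (f x))"
  by (rule smooth_onI, rule Ck_on_linear_compose) (simp_all add: smooth_onD)

lemma smooth_on_sum:
  "(\<And>i. i \<in> I \<Longrightarrow> smooth_on S (f i)) \<Longrightarrow> open S \<Longrightarrow> smooth_on S (\<lambda>x. \<Sum>i\<in>I. f i x)"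
  by (rule smooth_onI, rule Ck_on_sum) (simp_all add: smooth_onD)

text \<open>Expansion in an orthonormal basis turns a field of linear maps into finitely many vector fields.\<close>

lemma smooth_on_apply_field:
  assumes "open S" "\<And>y. y \<in> S \<Longrightarrow> linear (T y)" "\<And>v. smooth_on S (\<lambda>y. T y v)" "smooth_on S w"
  shows "smooth_on S (\<lambda>y. T y (w y))"
proof (rule smooth_on_cong[OF assms(1)])
  show "smooth_on S (\<lambda>y. \<Sum>b\<in>Basis. (w y \<bullet> b) *\<^sub>R T y b)"
    by (intro smooth_on_sum smooth_on_bilinear[OF bounded_bilinear_scaleR]
        smooth_on_linear_compose[OF bounded_linear_inner_left] assms)
qed (rule linear_eq_sum_Basis[OF assms(2), symmetric])

lemma has_derivative_apply_field:
  fixes T :: "'e::euclidean_space \<Rightarrow> 'f::euclidean_space \<Rightarrow> 'g::euclidean_space"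
  assumes "open S" "y \<in> S" "\<And>y. y \<in> S \<Longrightarrow> linear (T y)"
    "\<And>v. (\<lambda>y. T y v) differentiable (at y)" "(w has_derivative w') (at y)"
  shows "((\<lambda>z. T z (w z)) has_derivative (\<lambda>v. ddir (\<lambda>z. T z (w y)) y v + T y (w' v))) (at y)"
proof -
  have sum_rule: "((\<lambda>z. T z (u z)) has_derivative
      (\<lambda>v. \<Sum>b\<in>Basis. (u y \<bullet> b) *\<^sub>R ddir (\<lambda>z. T z b) y v + (u' v \<bullet> b) *\<^sub>R T y b)) (at y)"
    if "(u has_derivative u') (at y)" for u u'
  proof (rule has_derivative_transform_within_open[OF _ assms(1,2)])
    show "((\<lambda>z. \<Sum>b\<in>Basis. (u z \<bullet> b) *\<^sub>R T z b) has_derivative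
      (\<lambda>v. \<Sum>b\<in>Basis. (u y \<bullet> b) *\<^sub>R ddir (\<lambda>z. T z b) y v + (u' v \<bullet> b) *\<^sub>R T y b)) (at y)"
      by (intro has_derivative_sum has_derivative_scaleR has_derivative_inner_left
          ddir_has_derivative that assms(4))
  qed (rule linear_eq_sum_Basis[OF assms(3), symmetric])
  have fixed: "ddir (\<lambda>z. T z (w y)) y v = (\<Sum>b\<in>Basis. (w y \<bullet> b) *\<^sub>R ddir (\<lambda>z. T z b) y v)" for v
    by (subst ddir_eqI[OF sum_rule[OF has_derivative_const]]) simp
  have "(\<Sum>b\<in>Basis. (w' v \<bullet> b) *\<^sub>R T y b) = T y (w' v)" for v
    by (rule linear_eq_sum_Basis[OF assms(3)[OF assms(2)], symmetric])
  then show ?thesis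
    using sum_rule[OF assms(5)] by (simp add: fixed sum.distrib)
qed

section \<open>Symmetry of second derivatives\<close>

text \<open>
The left-hand side is symmetric in \<open>u\<close> and \<open>v\<close>, so that it equals \<open>s\<^sup>2\<close> times either mixed second
derivative at some nearby point. Each of them comes from applying the mean value theorem first
in the direction \<open>u\<close>, then in the direction \<open>v\<close>.
\<close>

lemma second_difference_mean_value:
  fixes f :: "'e::euclidean_space \<Rightarrow> real"
  assumes f: "smooth_on S f" and "ball y r \<subseteq> S" "s > 0" "s * (norm u + norm v) < r"
  shows "\<exists>x\<in>ball y r. f (y + s *\<^sub>R u + s *\<^sub>R v) - f (y + s *\<^sub>R u) - f (y + s *\<^sub>R v) + f y
           = s * s * ddir (\<lambda>x. ddir f x u) x v"
proof -
  have near: "y + a *\<^sub>R u + b *\<^sub>R v \<in> ball y r" if "0 \<le> a" "a \<le> s" "0 \<le> b" "b \<le> s" for a b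
  proof -
    have "norm (a *\<^sub>R u + b *\<^sub>R v) \<le> a * norm u + b * norm v"
      using norm_triangle_ineq[of "a *\<^sub>R u" "b *\<^sub>R v"] that by simp
    also have "\<dots> \<le> s * norm u + s * norm v"
      using that by (intro add_mono mult_right_mono) auto
    also have "\<dots> < r" using assms(4) by (simp add: distrib_left)
    finally have "norm (a *\<^sub>R u + b *\<^sub>R v) < r" .
    moreover have "dist y (y + a *\<^sub>R u + b *\<^sub>R v) = norm (a *\<^sub>R u + b *\<^sub>R v)"
      unfolding dist_norm add.assoc by (metis add_diff_cancel_left' norm_minus_commute)
    ultimately show ?thesis by simp
  qed
  then have inS: "y + a *\<^sub>R u + b *\<^sub>R v \<in> S" if "0 \<le> a" "a \<le> s" "0 \<le> b" "b \<le> s" for a b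
    using that assms(2) by blast
  have df: "(f has_derivative ddir f x) (at x)" if "x \<in> S" for x
    using that by (intro ddir_has_derivative smooth_on_differentiable[OF f])
  have line: "((\<lambda>a. f (y + a *\<^sub>R u + b *\<^sub>R v)) has_real_derivative ddir f (y + a *\<^sub>R u + b *\<^sub>R v) u) (at a)"
    if "0 \<le> a" "a \<le> s" "0 \<le> b" "b \<le> s" for a b
  proof -
    have "((\<lambda>a. y + a *\<^sub>R u + b *\<^sub>R v) has_derivative (\<lambda>h. h *\<^sub>R u)) (at a)"
      by (auto intro!: derivative_eq_intros)
    from has_derivative_compose[OF this df[OF inS[OF that]]]
    have "((\<lambda>a. f (y + a *\<^sub>R u + b *\<^sub>R v)) has_derivative
       (\<lambda>h. ddir f (y + a *\<^sub>R u + b *\<^sub>R v) (h *\<^sub>R u))) (at a)" .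
    moreover have "ddir f (y + a *\<^sub>R u + b *\<^sub>R v) (h *\<^sub>R u) = ddir f (y + a *\<^sub>R u + b *\<^sub>R v) u * h" for h
      using linear_scale[OF linear_ddir[OF smooth_on_differentiable[OF f inS[OF that]]]] by simp
    ultimately show ?thesis by (simp add: has_field_derivative_def)
  qed
  have "\<exists>a. a > 0 \<and> a < s \<and>
      (f (y + s *\<^sub>R u + s *\<^sub>R v) - f (y + s *\<^sub>R u + 0 *\<^sub>R v)) - (f (y + 0 *\<^sub>R u + s *\<^sub>R v) - f (y + 0 *\<^sub>R u + 0 *\<^sub>R v))
      = (s - 0) * (ddir f (y + a *\<^sub>R u + s *\<^sub>R v) u - ddir f (y + a *\<^sub>R u + 0 *\<^sub>R v) u)"
    using assms(3) by (intro MVT2 DERIV_diff line) auto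
  then obtain a where a: "a > 0" "a < s"
    "f (y + s *\<^sub>R u + s *\<^sub>R v) - f (y + s *\<^sub>R u) - f (y + s *\<^sub>R v) + f y
      = s * (ddir f (y + a *\<^sub>R u + s *\<^sub>R v) u - ddir f (y + a *\<^sub>R u + 0 *\<^sub>R v) u)"
    by (auto simp: algebra_simps)
  have du: "smooth_on S (\<lambda>x. ddir f x u)" by (rule smooth_on_ddir[OF f])
  have line2: "((\<lambda>b. ddir f (y + a *\<^sub>R u + b *\<^sub>R v) u) has_real_derivative
      ddir (\<lambda>x. ddir f x u) (y + a *\<^sub>R u + b *\<^sub>R v) v) (at b)"
    if "0 \<le> b" "b \<le> s" for b
  proof -
    have inSb: "y + a *\<^sub>R u + b *\<^sub>R v \<in> S" using that a by (intro inS) auto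
    have "((\<lambda>b. y + a *\<^sub>R u + b *\<^sub>R v) has_derivative (\<lambda>h. h *\<^sub>R v)) (at b)"
      by (auto intro!: derivative_eq_intros)
    from has_derivative_compose[OF this ddir_has_derivative[OF smooth_on_differentiable[OF du inSb]]]
    have "((\<lambda>b. ddir f (y + a *\<^sub>R u + b *\<^sub>R v) u) has_derivative
       (\<lambda>h. ddir (\<lambda>x. ddir f x u) (y + a *\<^sub>R u + b *\<^sub>R v) (h *\<^sub>R v))) (at b)" .
    moreover have "ddir (\<lambda>x. ddir f x u) (y + a *\<^sub>R u + b *\<^sub>R v) (h *\<^sub>R v)
        = ddir (\<lambda>x. ddir f x u) (y + a *\<^sub>R u + b *\<^sub>R v) v * h" for h
      using linear_scale[OF linear_ddir[OF smooth_on_differentiable[OF du inSb]]] by simp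
    ultimately show ?thesis by (simp add: has_field_derivative_def)
  qed
  have "\<exists>b. b > 0 \<and> b < s \<and> ddir f (y + a *\<^sub>R u + s *\<^sub>R v) u - ddir f (y + a *\<^sub>R u + 0 *\<^sub>R v) u
      = (s - 0) * ddir (\<lambda>x. ddir f x u) (y + a *\<^sub>R u + b *\<^sub>R v) v"
    using assms(3) by (intro MVT2 line2) auto
  then obtain b where b: "b > 0" "b < s" "ddir f (y + a *\<^sub>R u + s *\<^sub>R v) u - ddir f (y + a *\<^sub>R u + 0 *\<^sub>R v) u
      = s * ddir (\<lambda>x. ddir f x u) (y + a *\<^sub>R u + b *\<^sub>R v) v" by auto
  with a show ?thesis
    by (intro bexI[of _ "y + a *\<^sub>R u + b *\<^sub>R v"] near) auto
qed

lemma second_derivative_symmetric_real: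
  fixes f :: "'e::euclidean_space \<Rightarrow> real"
  assumes f: "smooth_on S f" and S: "open S" "y \<in> S"
  shows "ddir (\<lambda>x. ddir f x u) y v = ddir (\<lambda>x. ddir f x v) y u"
proof -
  define P where "P = (\<lambda>x. ddir (\<lambda>x. ddir f x u) x v)"
  define Q where "Q = (\<lambda>x. ddir (\<lambda>x. ddir f x v) x u)"
  have "continuous_on S P" "continuous_on S Q"
    unfolding P_def Q_def by (intro smooth_on_continuous smooth_on_ddir f)+
  then have cont: "isCont P y" "isCont Q y"
    using S by (auto simp: continuous_on_eq_continuous_at)
  have "\<bar>P y - Q y\<bar> \<le> 0 + e" if e: "e > 0" for e
  proof -
    obtain r1 where r1: "r1 > 0" "ball y r1 \<subseteq> S" using S openE by blast
    obtain r2 where r2: "r2 > 0" "\<And>x. dist x y < r2 \<Longrightarrow> dist (P x) (P y) < e/2"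
      using cont(1) half_gt_zero[OF e] unfolding continuous_at_eps_delta by blast
    obtain r3 where r3: "r3 > 0" "\<And>x. dist x y < r3 \<Longrightarrow> dist (Q x) (Q y) < e/2"
      using cont(2) half_gt_zero[OF e] unfolding continuous_at_eps_delta by blast
    define r where "r = min r1 (min r2 r3)"
    have r: "r > 0" "ball y r \<subseteq> S" using r1 r2 r3 by (auto simp: r_def)
    define s where "s = r / (norm u + norm v + 1)"
    have pos: "norm u + norm v + 1 > 0" by (smt (verit) norm_ge_zero)
    have s: "s > 0" using r pos by (simp add: s_def)
    have "s * (norm u + norm v) < s * (norm u + norm v + 1)" using s by simp
    also have "\<dots> = r" using pos by (simp add: s_def)
    finally have sr: "s * (norm u + norm v) < r" .
    obtain x1 where x1: "x1 \<in> ball y r"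
      "f (y + s *\<^sub>R u + s *\<^sub>R v) - f (y + s *\<^sub>R u) - f (y + s *\<^sub>R v) + f y = s * s * P x1"
      using second_difference_mean_value[OF f r(2) s sr] unfolding P_def by blast
    have sr': "s * (norm v + norm u) < r" using sr by (simp add: add.commute)
    obtain x2 where x2: "x2 \<in> ball y r"
      "f (y + s *\<^sub>R v + s *\<^sub>R u) - f (y + s *\<^sub>R v) - f (y + s *\<^sub>R u) + f y = s * s * Q x2"
      using second_difference_mean_value[OF f r(2) s sr'] unfolding Q_def by blast
    have swap: "y + s *\<^sub>R v + s *\<^sub>R u = y + s *\<^sub>R u + s *\<^sub>R v" by simp
    have "s * s * P x1 = s * s * Q x2"
      using x1(2) x2(2)[unfolded swap] by linarith
    then have "P x1 = Q x2" using s by simp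
    moreover have "dist (P x1) (P y) < e/2" using x1 by (intro r2) (auto simp: r_def dist_commute)
    moreover have "dist (Q x2) (Q y) < e/2" using x2 by (intro r3) (auto simp: r_def dist_commute)
    ultimately show ?thesis unfolding dist_real_def by linarith
  qed
  then have "\<bar>P y - Q y\<bar> \<le> 0" by (rule field_le_epsilon)
  then show ?thesis by (simp add: P_def Q_def)
qed

lemma second_derivative_symmetric:
  fixes f :: "'e::euclidean_space \<Rightarrow> 'f::euclidean_space"
  assumes f: "smooth_on S f" and S: "open S" "y \<in> S"
  shows "ddir (\<lambda>x. ddir f x u) y v = ddir (\<lambda>x. ddir f x v) y u"
proof (rule euclidean_eqI)
  fix b :: 'f assume "b \<in> Basis"
  have inner: "ddir (\<lambda>x. g x \<bullet> b) x w = ddir g x w \<bullet> b" if "g differentiable (at x)"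
    for g :: "'e \<Rightarrow> 'f" and x w
    using that by (intro ddir_eqI has_derivative_inner_left ddir_has_derivative)
  have twice: "ddir (\<lambda>x. ddir (\<lambda>x. f x \<bullet> b) x u) y v = ddir (\<lambda>x. ddir f x u) y v \<bullet> b" for u v
    using ddir_cong_open[OF S, of "\<lambda>x. ddir (\<lambda>x. f x \<bullet> b) x u" "\<lambda>x. ddir f x u \<bullet> b" v]
      inner smooth_on_differentiable[OF f] smooth_on_differentiable[OF smooth_on_ddir[OF f]] S(2)
    by simp
  have "smooth_on S (\<lambda>x. f x \<bullet> b)"
    by (rule smooth_on_linear_compose[OF bounded_linear_inner_left f S(1)])
  from second_derivative_symmetric_real[OF this S, of u v]
  show "ddir (\<lambda>x. ddir f x u) y v \<bullet> b = ddir (\<lambda>x. ddir f x v) y u \<bullet> b"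
    by (simp add: twice)
qed

section \<open>Inner products depending on a point\<close>

definition inner_product_form :: "('e::euclidean_space \<Rightarrow> 'e \<Rightarrow> real) \<Rightarrow> bool" where
  "inner_product_form b \<longleftrightarrow> bilinear b \<and> (\<forall>v w. b v w = b w v) \<and> (\<forall>v. v \<noteq> 0 \<longrightarrow> b v v > 0)"

lemma inner_product_form_linear:
  assumes "inner_product_form b"
  shows "linear (b v)" "linear (\<lambda>w. b w v)"
  using assms by (auto simp: inner_product_form_def bilinear_def)

lemma inner_product_form_sym: "inner_product_form b \<Longrightarrow> b v w = b w v"
  by (auto simp: inner_product_form_def)

lemma inner_product_form_eqI:
  assumes b: "inner_product_form b" and "\<And>z. b u z = b u' z"
  shows "u = u'"
proof (rule ccontr)
  assume "u \<noteq> u'"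
  then have "b (u - u') (u - u') > 0" using b by (simp add: inner_product_form_def)
  moreover have "b (u - u') z = 0" for z
    using linear_diff[OF inner_product_form_linear(2)[OF b]] assms(2) by simp
  ultimately show False by simp
qed

text \<open>
A definite form is nondegenerate, hence by finite dimension every linear functional is represented
by a unique vector, and the description operator in \<^const>\<open>raise_index\<close> is well defined.
\<close>

lemma raise_index_eq:
  assumes b: "inner_product_form b" and \<alpha>: "linear \<alpha>"
  shows "b (raise_index b \<alpha>) z = \<alpha> z"
proof -
  define G where "G u = (\<Sum>e\<in>Basis. b u e *\<^sub>R e)" for u
  note lin = inner_product_form_linear[OF b]
  have G: "G u \<bullet> e = b u e" if "e \<in> Basis" for u e
    using that by (simp add: G_def inner_sum_left_Basis)
  have b_G: "b u z = G u \<bullet> z" for u z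
    using linear_eq_sum_Basis[OF lin(1), of u z]
    by (simp add: euclidean_inner[of "G u" z] G mult.commute)
  have "linear G"
    unfolding G_def
    by (intro linear_compose_sum ballI linearI)
      (simp_all add: linear_add[OF lin(2)] linear_scale[OF lin(2)] scaleR_add_left)
  moreover have "inj G"
    using inner_product_form_eqI[OF b] by (intro injI) (metis b_G)
  ultimately have "surj G" by (rule linear_injective_imp_surjective) simp
  then obtain u where u: "G u = (\<Sum>e\<in>Basis. \<alpha> e *\<^sub>R e)"
    using surjD[of G "\<Sum>e\<in>Basis. \<alpha> e *\<^sub>R e"] by auto
  have "b u z = \<alpha> z" for z
  proof -
    have "(\<Sum>e\<in>Basis. \<alpha> e *\<^sub>R e) \<bullet> z = (\<Sum>e\<in>Basis. (z \<bullet> e) *\<^sub>R \<alpha> e)"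
      unfolding inner_sum_left by (intro sum.cong) (simp_all add: inner_commute)
    then show ?thesis using linear_eq_sum_Basis[OF \<alpha>, of z] by (simp add: b_G u)
  qed
  then have "\<exists>!u. \<forall>z. b u z = \<alpha> z"
    using inner_product_form_eqI[OF b] by (intro ex1I[of _ u]) auto
  from theI'[OF this] show ?thesis unfolding raise_index_def by blast
qed

lemma raise_index_unique:
  assumes "inner_product_form b" "\<And>z. b u z = \<alpha> z"
  shows "raise_index b \<alpha> = u"
  unfolding raise_index_def
  using inner_product_form_eqI[OF assms(1)] assms(2) by (intro the_equality) auto

lemma continuous_on_apply_field:
  fixes T :: "'p \<Rightarrow> 'f::euclidean_space \<Rightarrow> 'g::euclidean_space"
  assumes "\<And>y. y \<in> S \<Longrightarrow> linear (T (p y))" "\<And>v. continuous_on S (\<lambda>y. T (p y) v)" "continuous_on S w"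
  shows "continuous_on S (\<lambda>y. T (p y) (w y))"
proof -
  have "continuous_on S (\<lambda>y. \<Sum>b\<in>Basis. (w y \<bullet> b) *\<^sub>R T (p y) b)"
    using assms(2,3) by (intro continuous_intros)
  then show ?thesis
    by (rule continuous_on_eq) (rule linear_eq_sum_Basis[OF assms(1), symmetric])
qed

lemma continuous_on_apply_form:
  fixes g :: "'p \<Rightarrow> 'f::euclidean_space \<Rightarrow> 'f \<Rightarrow> real"
  assumes "\<And>y. y \<in> S \<Longrightarrow> inner_product_form (g (p y))" "\<And>v w. continuous_on S (\<lambda>y. g (p y) v w)"
    "continuous_on S u" "continuous_on S w"
  shows "continuous_on S (\<lambda>y. g (p y) (u y) (w y))"
proof -
  have "continuous_on S (\<lambda>y. g (p y) (u y) v)" for v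
    using continuous_on_apply_field[where T = "\<lambda>y w. g y w v" and p = p, OF _ assms(2,3)]
      inner_product_form_linear(2)[OF assms(1)] by simp
  from continuous_on_apply_field[where T = "\<lambda>y. g (p y) (u y)" and p = "\<lambda>y. y", OF _ this assms(4)]
  show ?thesis using inner_product_form_linear(1)[OF assms(1)] by simp
qed

text \<open>
Positivity on the compact unit sphere at one point persists nearby, by the tube lemma. The bound makes
the inverse matrix of \<open>g\<close> locally bounded.
\<close>

lemma locally_coercive:
  fixes g :: "'e::euclidean_space \<Rightarrow> 'e \<Rightarrow> 'e \<Rightarrow> real"
  assumes S: "open S" "y0 \<in> S" and g: "\<And>y. y \<in> S \<Longrightarrow> inner_product_form (g y)"
    and cont: "\<And>v w. continuous_on S (\<lambda>y. g y v w)"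
  shows "\<exists>c>0. \<exists>U. open U \<and> y0 \<in> U \<and> U \<subseteq> S \<and> (\<forall>y\<in>U. \<forall>v. g y v v \<ge> c * (norm v)\<^sup>2)"
proof -
  have ne: "sphere (0::'e) 1 \<noteq> {}" by simp
  have "continuous_on (sphere 0 1) (\<lambda>v. g y0 v v)"
    by (rule continuous_on_apply_form[where g = "\<lambda>_::'e. g y0" and p = "\<lambda>v. v"])
      (auto intro: g[OF S(2)] continuous_on_id)
  from continuous_attains_inf[OF compact_sphere ne this]
  obtain v0 where v0: "v0 \<in> sphere 0 1" "\<And>v. v \<in> sphere 0 1 \<Longrightarrow> g y0 v0 v0 \<le> g y0 v v"
    by auto
  define c where "c = g y0 v0 v0 / 2"
  have "v0 \<noteq> 0" using v0(1) by auto
  then have c: "c > 0" using g[OF S(2)] by (simp add: c_def inner_product_form_def)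
  have joint: "continuous_on (S \<times> UNIV) (\<lambda>z. g (fst z) (snd z) (snd z))"
  proof (rule continuous_on_apply_form[where g = g and p = fst])
    show "continuous_on (S \<times> UNIV) (\<lambda>z. g (fst z) v w)" for v w
      by (rule continuous_on_compose2[where g = "\<lambda>y. g y v w" and t = S])
        (auto intro: cont continuous_on_fst continuous_on_id)
  qed (auto intro: g continuous_on_snd continuous_on_id)
  define W where "W = (S \<times> UNIV) \<inter> (\<lambda>z. g (fst z) (snd z) (snd z)) -` {c<..}"
  have W: "open W" unfolding W_def
    by (rule continuous_open_preimage[OF joint]) (simp_all add: S(1) open_Times)
  have "c < g y0 v v" if "v \<in> sphere 0 1" for v
    using v0(2)[OF that] c unfolding c_def by linarith
  then have "{y0} \<times> sphere 0 1 \<subseteq> W"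
    using S(2) by (auto simp: W_def)
  from Elementary_Topology.tube_lemma[OF compact_sphere W this]
  obtain U where U: "y0 \<in> U" "open U" "U \<times> sphere 0 1 \<subseteq> W"
    by blast
  have "g y v v \<ge> c * (norm v)\<^sup>2" if y: "y \<in> U \<inter> S" for y v
  proof (cases "v = 0")
    case True
    then show ?thesis using linear_0[OF inner_product_form_linear(1)[OF g], of y] y by simp
  next
    case False
    let ?n = "(1 / norm v) *\<^sub>R v"
    have "?n \<in> sphere 0 1" using False by simp
    then have "(y, ?n) \<in> W" using U(3) y by blast
    then have "c \<le> g y ?n ?n" by (simp add: W_def)
    moreover have "g y ?n ?n = g y v v / (norm v)\<^sup>2"
    proof -
      have form: "inner_product_form (g y)" using g y by blast
      have "g y ?n ?n = (1 / norm v) *\<^sub>R g y ?n v"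
        by (rule linear_scale[OF inner_product_form_linear(1)[OF form]])
      also have "g y ?n v = (1 / norm v) *\<^sub>R g y v v"
        by (rule linear_scale[OF inner_product_form_linear(2)[OF form]])
      finally show ?thesis by (simp add: power2_eq_square)
    qed
    ultimately have "c \<le> g y v v / (norm v)\<^sup>2" by simp
    then show ?thesis using False by (simp add: pos_le_divide_eq)
  qed
  with c U S show ?thesis by (intro exI[of _ c] conjI exI[of _ "U \<inter> S"]) auto
qed

text \<open>
At a zero of the scalar factor the product rule asks only for continuity of the other factor.
\<close>

lemma has_derivative_scaleR_vanishing:
  fixes \<psi> :: "'e::euclidean_space \<Rightarrow> real" and q :: "'e \<Rightarrow> 'f::euclidean_space"
  assumes \<psi>: "(\<psi> has_derivative \<psi>') (at y)" and "\<psi> y = 0" and q: "isCont q y"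
  shows "((\<lambda>z. \<psi> z *\<^sub>R q z) has_derivative (\<lambda>v. \<psi>' v *\<^sub>R q y)) (at y)"
  unfolding has_derivative_iff_norm
proof
  have lin: "bounded_linear \<psi>'" using \<psi> by (rule has_derivative_bounded_linear)
  then show "bounded_linear (\<lambda>v. \<psi>' v *\<^sub>R q y)" by (rule bounded_linear_scaleR_const)
  have \<psi>0: "((\<lambda>z. norm (\<psi> z - \<psi>' (z - y)) / norm (z - y)) \<longlongrightarrow> 0) (at y)"
    using \<psi> \<open>\<psi> y = 0\<close> by (simp add: has_derivative_iff_norm)
  have qlim: "(q \<longlongrightarrow> q y) (at y)" using q by (simp add: isCont_def)
  have "((\<lambda>z. norm (\<psi> z - \<psi>' (z - y)) / norm (z - y) * norm (q z) + onorm \<psi>' * norm (q z - q y)) \<longlongrightarrow>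
      0 * norm (q y) + onorm \<psi>' * norm (q y - q y)) (at y)"
    by (intro tendsto_intros \<psi>0 qlim)
  then have lim: "((\<lambda>z. norm (\<psi> z - \<psi>' (z - y)) / norm (z - y) * norm (q z) + onorm \<psi>' * norm (q z - q y)) \<longlongrightarrow> 0) (at y)"
    by simp
  show "((\<lambda>z. norm (\<psi> z *\<^sub>R q z - \<psi> y *\<^sub>R q y - \<psi>' (z - y) *\<^sub>R q y) / norm (z - y)) \<longlongrightarrow> 0) (at y)"
  proof (rule Lim_null_comparison[OF _ lim])
    have "norm (\<psi> z *\<^sub>R q z - \<psi>' (z - y) *\<^sub>R q y) / norm (z - y)
        \<le> norm (\<psi> z - \<psi>' (z - y)) / norm (z - y) * norm (q z) + onorm \<psi>' * norm (q z - q y)"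
      if "z \<noteq> y" for z
    proof -
      have n: "norm (z - y) > 0" using that by simp
      have "\<psi> z *\<^sub>R q z - \<psi>' (z - y) *\<^sub>R q y = (\<psi> z - \<psi>' (z - y)) *\<^sub>R q z + \<psi>' (z - y) *\<^sub>R (q z - q y)"
        by (simp add: algebra_simps)
      then have "norm (\<psi> z *\<^sub>R q z - \<psi>' (z - y) *\<^sub>R q y)
          \<le> norm (\<psi> z - \<psi>' (z - y)) * norm (q z) + norm (\<psi>' (z - y)) * norm (q z - q y)"
        using norm_triangle_ineq[of "(\<psi> z - \<psi>' (z - y)) *\<^sub>R q z" "\<psi>' (z - y) *\<^sub>R (q z - q y)"] by simp
      also have "\<dots> \<le> norm (\<psi> z - \<psi>' (z - y)) * norm (q z) + (onorm \<psi>' * norm (z - y)) * norm (q z - q y)"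
        by (intro add_left_mono mult_right_mono onorm[OF lin]) auto
      finally show ?thesis using n by (simp add: field_simps)
    qed
    then show "\<forall>\<^sub>F z in at y. norm (norm (\<psi> z *\<^sub>R q z - \<psi> y *\<^sub>R q y - \<psi>' (z - y) *\<^sub>R q y) / norm (z - y))
      \<le> norm (\<psi> z - \<psi>' (z - y)) / norm (z - y) * norm (q z) + onorm \<psi>' * norm (q z - q y)"
      unfolding eventually_at by (intro exI[of _ 1]) (auto simp: \<open>\<psi> y = 0\<close>)
  qed
qed

text \<open>
This is smoothness of the inverse matrix of \<open>g\<close>, whose columns are the vector fields \<open>Q b\<close>. The resolvent
identity \<open>Q_diff\<close> gives first continuity, then differentiability. The resulting derivative is a
polynomial in the fields \<open>Q e\<close> and the derivatives of \<open>g\<close>, so that class \<open>C\<^sup>k\<close> for all of them implies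
class \<open>C\<^sup>k\<^sup>+\<^sup>1\<close>.
\<close>

lemma smooth_on_raise_index_const:
  fixes g :: "'e::euclidean_space \<Rightarrow> 'e \<Rightarrow> 'e \<Rightarrow> real"
  assumes S: "open S" and g: "\<And>y. y \<in> S \<Longrightarrow> inner_product_form (g y)"
    and sg: "\<And>v w. smooth_on S (\<lambda>y. g y v w)"
  shows "smooth_on S (\<lambda>y. raise_index (g y) (\<lambda>v. b \<bullet> v))"
proof -
  define Q where "Q b y = raise_index (g y) (\<lambda>v. b \<bullet> v)" for b y
  have gQ: "g y (Q b y) v = b \<bullet> v" if "y \<in> S" for y b v
    unfolding Q_def by (rule raise_index_eq[OF g[OF that]]) (simp add: bounded_linear.linear bounded_linear_inner_right)
  note lin = inner_product_form_linear[OF g]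
  have Q_diff: "Q b y = Q b y0 - (\<Sum>e\<in>Basis. (g y (Q b y0) e - g y0 (Q b y0) e) *\<^sub>R Q e y)"
    if y: "y \<in> S" "y0 \<in> S" for b y y0
  proof (rule inner_product_form_eqI[OF g[OF y(1)]])
    fix v
    let ?u = "Q b y0"
    have "g y (?u - (\<Sum>e\<in>Basis. (g y ?u e - g y0 ?u e) *\<^sub>R Q e y)) v
        = g y ?u v - (\<Sum>e\<in>Basis. (g y ?u e - g y0 ?u e) * (e \<bullet> v))"
      using y(1) by (simp add: linear_diff[OF lin(2)] linear_sum[OF lin(2)] linear_scale[OF lin(2)] gQ)
    also have "\<dots> = g y ?u v - ((\<Sum>e\<in>Basis. (v \<bullet> e) *\<^sub>R g y ?u e) - (\<Sum>e\<in>Basis. (v \<bullet> e) *\<^sub>R g y0 ?u e))"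
      by (simp add: sum_subtractf[symmetric] algebra_simps inner_commute)
    also have "\<dots> = g y0 ?u v"
      using linear_eq_sum_Basis[OF lin(1)[OF y(1)], of ?u v] linear_eq_sum_Basis[OF lin(1)[OF y(2)], of ?u v] by simp
    finally show "g y (Q b y) v = g y (?u - (\<Sum>e\<in>Basis. (g y ?u e - g y0 ?u e) *\<^sub>R Q e y)) v"
      using y by (simp add: gQ)
  qed
  have cont: "isCont (Q b) y0" if y0: "y0 \<in> S" for b y0
  proof -
    obtain c U where c: "c > 0" and U: "open U" "y0 \<in> U" "U \<subseteq> S"
      and co: "\<And>y v. y \<in> U \<Longrightarrow> g y v v \<ge> c * (norm v)\<^sup>2"
      using locally_coercive[OF S y0 g smooth_on_continuous[OF sg]] by blast
    have bound: "norm (Q e y) \<le> norm e / c" if "y \<in> U" for e y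
    proof -
      have "c * (norm (Q e y))\<^sup>2 \<le> e \<bullet> Q e y"
        using co[OF that, of "Q e y"] gQ[of y e "Q e y"] that U by auto
      also have "\<dots> \<le> norm e * norm (Q e y)" by (rule norm_cauchy_schwarz)
      finally have "norm (Q e y) * (c * norm (Q e y)) \<le> norm (Q e y) * norm e"
        by (simp add: power2_eq_square algebra_simps)
      then have "c * norm (Q e y) \<le> norm e"
        by (cases "Q e y = 0") auto
      then show ?thesis using c by (simp add: field_simps)
    qed
    have "((\<lambda>y. g y (Q b y0) e) \<longlongrightarrow> g y0 (Q b y0) e) (at y0)" for e
      using smooth_on_continuous[OF sg[of "Q b y0" e]] S y0
      by (auto simp: continuous_on_eq_continuous_at isCont_def)
    then have lim: "((\<lambda>y. \<Sum>e\<in>Basis. \<bar>g y (Q b y0) e - g y0 (Q b y0) e\<bar> * (norm e / c)) \<longlongrightarrow>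
        (\<Sum>e\<in>Basis. \<bar>g y0 (Q b y0) e - g y0 (Q b y0) e\<bar> * (norm e / c))) (at y0)"
      by (intro tendsto_intros)
    have "((\<lambda>y. Q b y - Q b y0) \<longlongrightarrow> 0) (at y0)"
    proof (rule Lim_null_comparison)
      show "((\<lambda>y. \<Sum>e\<in>Basis. \<bar>g y (Q b y0) e - g y0 (Q b y0) e\<bar> * (norm e / c)) \<longlongrightarrow> 0) (at y0)"
        using lim by simp
      have "norm (Q b y - Q b y0) \<le> (\<Sum>e\<in>Basis. \<bar>g y (Q b y0) e - g y0 (Q b y0) e\<bar> * (norm e / c))"
        if "y \<in> U" for y
      proof -
        define R where "R = (\<Sum>e\<in>Basis. (g y (Q b y0) e - g y0 (Q b y0) e) *\<^sub>R Q e y)"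
        have "y \<in> S" using that U by auto
        then have "Q b y = Q b y0 - R" unfolding R_def by (rule Q_diff[OF _ y0])
        then have "norm (Q b y - Q b y0) = norm R" by simp
        also have "\<dots> \<le> (\<Sum>e\<in>Basis. \<bar>g y (Q b y0) e - g y0 (Q b y0) e\<bar> * (norm e / c))"
          unfolding R_def
        proof (rule order_trans[OF norm_sum sum_mono])
          fix e :: 'e
          show "norm ((g y (Q b y0) e - g y0 (Q b y0) e) *\<^sub>R Q e y) \<le> \<bar>g y (Q b y0) e - g y0 (Q b y0) e\<bar> * (norm e / c)"
            unfolding norm_scaleR by (rule mult_left_mono[OF bound[OF that] abs_ge_zero])
        qed
        finally show ?thesis .
      qed
      then show "\<forall>\<^sub>F y in at y0. norm (Q b y - Q b y0) \<le> (\<Sum>e\<in>Basis. \<bar>g y (Q b y0) e - g y0 (Q b y0) e\<bar> * (norm e / c))"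
        using eventually_at_in_open'[OF U(1,2)] by (rule eventually_mono[rotated])
    qed
    then show ?thesis by (simp add: isCont_def LIM_zero_iff)
  qed
  have deriv: "(Q b has_derivative (\<lambda>v. - (\<Sum>e\<in>Basis. ddir (\<lambda>y. g y (Q b y0) e) y0 v *\<^sub>R Q e y0))) (at y0)"
    if y0: "y0 \<in> S" for b y0
  proof (rule has_derivative_transform_within_open[OF _ S y0])
    have "((\<lambda>y. (g y (Q b y0) e - g y0 (Q b y0) e) *\<^sub>R Q e y) has_derivative
        (\<lambda>v. ddir (\<lambda>y. g y (Q b y0) e) y0 v *\<^sub>R Q e y0)) (at y0)" for e
    proof (rule has_derivative_scaleR_vanishing)
      show "((\<lambda>y. g y (Q b y0) e - g y0 (Q b y0) e) has_derivative ddir (\<lambda>y. g y (Q b y0) e) y0) (at y0)"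
        using has_derivative_diff[OF ddir_has_derivative[OF smooth_on_differentiable[OF sg y0]] has_derivative_const,
            of "Q b y0" e "g y0 (Q b y0) e"]
        by simp
    qed (simp_all add: cont y0)
    then have "((\<lambda>y. Q b y0 - (\<Sum>e\<in>Basis. (g y (Q b y0) e - g y0 (Q b y0) e) *\<^sub>R Q e y)) has_derivative
        (\<lambda>v. 0 - (\<Sum>e\<in>Basis. ddir (\<lambda>y. g y (Q b y0) e) y0 v *\<^sub>R Q e y0))) (at y0)"
      by (intro has_derivative_diff has_derivative_const has_derivative_sum)
    then show "((\<lambda>y. Q b y0 - (\<Sum>e\<in>Basis. (g y (Q b y0) e - g y0 (Q b y0) e) *\<^sub>R Q e y)) has_derivative
        (\<lambda>v. - (\<Sum>e\<in>Basis. ddir (\<lambda>y. g y (Q b y0) e) y0 v *\<^sub>R Q e y0))) (at y0)" by simp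
  qed (rule Q_diff[symmetric, OF _ y0])
  have "Ck_on k S (Q b)" for k b
  proof (induction k arbitrary: b)
    case 0
    show ?case using cont by (simp add: continuous_at_imp_continuous_on)
  next
    case (Suc k)
    have "Ck_on k S (\<lambda>y. ddir (Q b) y v)" for v
    proof (rule Ck_on_cong[OF S])
      have lin_d: "linear (\<lambda>u. ddir (\<lambda>z. g z u e) y v)" if "y \<in> S" for y e
      proof (rule linearI)
        note D = ddir_has_derivative[OF smooth_on_differentiable[OF sg that]]
        show "ddir (\<lambda>z. g z (u + u') e) y v = ddir (\<lambda>z. g z u e) y v + ddir (\<lambda>z. g z u' e) y v" for u u'
          using ddir_cong_open[OF S that, of "\<lambda>z. g z (u + u') e" "\<lambda>z. g z u e + g z u' e"]
            ddir_eqI[OF has_derivative_add[OF D D]] linear_add[OF lin(2)] by simp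
        show "ddir (\<lambda>z. g z (r *\<^sub>R u) e) y v = r *\<^sub>R ddir (\<lambda>z. g z u e) y v" for r u
          using ddir_cong_open[OF S that, of "\<lambda>z. g z (r *\<^sub>R u) e" "\<lambda>z. r *\<^sub>R g z u e"]
            ddir_eqI[OF has_derivative_scaleR_right[OF D]] linear_scale[OF lin(2)] by simp
      qed
      show "Ck_on k S (\<lambda>y. - (\<Sum>e\<in>Basis. (\<Sum>i\<in>Basis. (Q b y \<bullet> i) *\<^sub>R ddir (\<lambda>z. g z i e) y v) *\<^sub>R Q e y))"
        by (intro Ck_on_linear_compose[OF bounded_linear_minus[OF bounded_linear_ident]]
            Ck_on_sum Ck_on_bilinear[OF bounded_bilinear_scaleR]
            Ck_on_linear_compose[OF bounded_linear_inner_left] Suc.IH S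
            smooth_onD[OF smooth_on_ddir[OF sg]])
      show "- (\<Sum>e\<in>Basis. (\<Sum>i\<in>Basis. (Q b y \<bullet> i) *\<^sub>R ddir (\<lambda>z. g z i e) y v) *\<^sub>R Q e y) = ddir (Q b) y v"
        if "y \<in> S" for y
      proof -
        have "(\<Sum>i\<in>Basis. (Q b y \<bullet> i) *\<^sub>R ddir (\<lambda>z. g z i e) y v) = ddir (\<lambda>z. g z (Q b y) e) y v" for e
          by (rule linear_eq_sum_Basis[OF lin_d[OF that], symmetric])
        moreover have "ddir (Q b) y v = - (\<Sum>e\<in>Basis. ddir (\<lambda>z. g z (Q b y) e) y v *\<^sub>R Q e y)"
          by (rule ddir_eqI[OF deriv[OF that]])
        ultimately show ?thesis by (simp only:)
      qed
    qed
    then show ?case using deriv by (auto simp: differentiable_def)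
  qed
  then show ?thesis unfolding smooth_on_def Q_def by blast
qed

lemma smooth_on_raise_index:
  fixes g :: "'e::euclidean_space \<Rightarrow> 'e \<Rightarrow> 'e \<Rightarrow> real"
  assumes S: "open S" and g: "\<And>y. y \<in> S \<Longrightarrow> inner_product_form (g y)"
    and sg: "\<And>v w. smooth_on S (\<lambda>y. g y v w)"
    and \<phi>: "\<And>y. y \<in> S \<Longrightarrow> linear (\<phi> y)" "\<And>v. smooth_on S (\<lambda>y. \<phi> y v)"
  shows "smooth_on S (\<lambda>y. raise_index (g y) (\<phi> y))"
proof (rule smooth_on_cong[OF S])
  let ?Q = "\<lambda>b y. raise_index (g y) (\<lambda>v. b \<bullet> v)"
  show "smooth_on S (\<lambda>y. \<Sum>b\<in>Basis. \<phi> y b *\<^sub>R ?Q b y)"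
    by (intro smooth_on_sum smooth_on_bilinear[OF bounded_bilinear_scaleR] \<phi>(2)
        smooth_on_raise_index_const[OF S g sg] S)
  show "(\<Sum>b\<in>Basis. \<phi> y b *\<^sub>R ?Q b y) = raise_index (g y) (\<phi> y)" if y: "y \<in> S" for y
  proof (rule raise_index_unique[OF g[OF y], symmetric])
    fix z
    note lin = inner_product_form_linear[OF g[OF y]]
    have "g y (?Q b y) z = b \<bullet> z" for b
      by (rule raise_index_eq[OF g[OF y]]) (simp add: bounded_linear.linear bounded_linear_inner_right)
    then have "g y (\<Sum>b\<in>Basis. \<phi> y b *\<^sub>R ?Q b y) z = (\<Sum>b\<in>Basis. (z \<bullet> b) *\<^sub>R \<phi> y b)"
      by (simp add: linear_sum[OF lin(2)] linear_scale[OF lin(2)] inner_commute mult.commute)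
    then show "g y (\<Sum>b\<in>Basis. \<phi> y b *\<^sub>R ?Q b y) z = \<phi> y z"
      using linear_eq_sum_Basis[OF \<phi>(1)[OF y], of z] by simp
  qed
qed

section \<open>A pair of orthogonal complex structures on a vector space\<close>

locale complex_structure_pair =
  fixes g :: "'e::euclidean_space \<Rightarrow> 'e \<Rightarrow> real" and I J :: "'e \<Rightarrow> 'e"
  assumes form: "inner_product_form g"
    and linI: "linear I" and linJ: "linear J"
    and II [simp]: "I (I v) = - v" and JJ [simp]: "J (J v) = - v"
    and gII [simp]: "g (I v) (I w) = g v w" and gJJ [simp]: "g (J v) (J w) = g v w"
begin

lemmas lin_simps =
  linear_add[OF linI] linear_diff[OF linI] linear_neg[OF linI] linear_scale[OF linI] linear_0[OF linI]
  linear_add[OF linJ] linear_diff[OF linJ] linear_neg[OF linJ] linear_scale[OF linJ] linear_0[OF linJ]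
  linear_add[OF inner_product_form_linear(1)[OF form]] linear_diff[OF inner_product_form_linear(1)[OF form]]
  linear_neg[OF inner_product_form_linear(1)[OF form]] linear_scale[OF inner_product_form_linear(1)[OF form]]
  linear_0[OF inner_product_form_linear(1)[OF form]]
  linear_add[OF inner_product_form_linear(2)[OF form]] linear_diff[OF inner_product_form_linear(2)[OF form]]
  linear_neg[OF inner_product_form_linear(2)[OF form]] linear_scale[OF inner_product_form_linear(2)[OF form]]
  linear_0[OF inner_product_form_linear(2)[OF form]]

lemma sym: "g v w = g w v" by (rule inner_product_form_sym[OF form])

lemma eq_zeroI: "g v v = 0 \<Longrightarrow> v = 0"
  using form unfolding inner_product_form_def by fastforce

lemma pos: "v \<noteq> 0 \<Longrightarrow> g v v > 0"
  using form unfolding inner_product_form_def by blast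

lemma I_skew: "g (I v) w = - g v (I w)"
  using gII[of "I v" w] by (simp add: lin_simps)

lemma J_skew: "g (J v) w = - g v (J w)"
  using gJJ[of "J v" w] by (simp add: lin_simps)

lemma I_self [simp]: "g v (I v) = 0"
  using I_skew[of v v] sym[of "I v" v] by simp

definition commutator :: "'e \<Rightarrow> 'e" where "commutator v = I (J v) - J (I v)"
definition anticommutator :: "'e \<Rightarrow> 'e" where "anticommutator v = I (J v) + J (I v)"

lemmas comm_defs = commutator_def anticommutator_def

lemma lin_commutator: "linear commutator"
  by (rule linearI) (simp_all add: comm_defs lin_simps algebra_simps)

lemma lin_anticommutator: "linear anticommutator"
  by (rule linearI) (simp_all add: comm_defs lin_simps algebra_simps)

lemmas comm_simps =
  linear_add[OF lin_commutator] linear_diff[OF lin_commutator] linear_neg[OF lin_commutator]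
  linear_scale[OF lin_commutator] linear_0[OF lin_commutator]
  linear_add[OF lin_anticommutator] linear_diff[OF lin_anticommutator] linear_neg[OF lin_anticommutator]
  linear_scale[OF lin_anticommutator] linear_0[OF lin_anticommutator]

lemma commutator_skew: "g (commutator v) w = - g v (commutator w)"
  by (simp add: comm_defs lin_simps I_skew[of "J v"] J_skew[of "I v"] J_skew[of v] I_skew[of v])

lemma anticommutator_sym: "g (anticommutator v) w = g v (anticommutator w)"
  by (simp add: comm_defs lin_simps I_skew[of "J v"] J_skew[of "I v"] J_skew[of v] I_skew[of v])

lemma commutator_I: "commutator (I v) = - I (commutator v)"
  by (simp add: comm_defs lin_simps)

lemma anticommutator_I: "anticommutator (I v) = I (anticommutator v)"
  by (simp add: comm_defs lin_simps)

lemma anticommutator_commutator: "anticommutator (commutator v) = commutator (anticommutator v)"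
  by (simp add: comm_defs lin_simps)

lemma commutator_self: "g (commutator v) v = 0" "g (commutator v) (I v) = 0"
proof -
  show "g (commutator v) v = 0"
    using commutator_skew[of v v] sym[of "commutator v" v] by simp
  have "g (commutator v) (I v) = - g v (commutator (I v))" by (rule commutator_skew)
  also have "\<dots> = - g (I v) (commutator v)" by (simp add: commutator_I lin_simps I_skew)
  finally show "g (commutator v) (I v) = 0" using sym[of "commutator v" "I v"] by simp
qed

lemma anticommutator_I_self: "g (anticommutator v) (I v) = 0"
proof -
  have "g (anticommutator v) (I v) = - g (I (anticommutator v)) v" by (simp add: I_skew)
  also have "\<dots> = - g (I v) (anticommutator v)"
    by (simp add: anticommutator_I[symmetric] anticommutator_sym)
  finally show ?thesis using sym[of "anticommutator v" "I v"] by simp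
qed

lemma commutator_anticommutator_orthogonal:
  "g (commutator u) (anticommutator u) = 0" "g (I (commutator u)) (anticommutator u) = 0"
proof -
  have "g (commutator u) (anticommutator u) = g (commutator (anticommutator u)) u"
    by (simp add: anticommutator_sym[symmetric] anticommutator_commutator)
  also have "\<dots> = - g (commutator u) (anticommutator u)"
    by (simp add: commutator_skew[of "anticommutator u"] sym[of "commutator u"])
  finally show "g (commutator u) (anticommutator u) = 0" by simp
  have "g (I (commutator u)) (anticommutator u) = g (I (commutator (anticommutator u))) u"
    by (simp add: anticommutator_sym[symmetric] anticommutator_I anticommutator_commutator)
  also have "\<dots> = - g (commutator (anticommutator u)) (I u)" by (rule I_skew)
  also have "\<dots> = g (anticommutator u) (commutator (I u))" by (simp add: commutator_skew[of "anticommutator u"])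
  also have "\<dots> = - g (I (commutator u)) (anticommutator u)"
    by (simp add: commutator_I lin_simps sym[of "anticommutator u"])
  finally show "g (I (commutator u)) (anticommutator u) = 0" by simp
qed

text \<open>
Write \<open>P\<close> for the commutator, \<open>C\<close> for the anticommutator and \<open>D\<close> for the span of \<open>x\<close> and \<open>I x\<close>. The skew
map \<open>P\<close> sends the complement of \<open>D\<close> into \<open>D\<close>. Suppose that \<open>w = P u\<close> is not zero for some \<open>u\<close> in that
complement. Because \<open>P\<close> commutes with the symmetric map \<open>C\<close>, the vector \<open>w\<close> is an eigenvector of \<open>C\<close>, with
negative eigenvalue as \<open>C\<close> is negative on \<open>D\<close>. Then \<open>P w\<close>, which lies in the complement of \<open>D\<close>, has the same
eigenvalue, so \<open>P w = 0\<close> because \<open>C\<close> is positive there. But \<open>g (P w) u = - g w w\<close>.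
Hence \<open>P\<close> vanishes on the complement of \<open>D\<close>. As \<open>P x\<close> lies there, \<open>P (P x) = 0\<close>, and \<open>P x = 0\<close> by skewness.
\<close>

lemma commute_if_commutator_pairing_zero:
  assumes neg: "g (anticommutator x) x < 0"
    and posv: "\<And>v. g x v = 0 \<Longrightarrow> g (I x) v = 0 \<Longrightarrow> v \<noteq> 0 \<Longrightarrow> g (anticommutator v) v > 0"
    and zero: "\<And>u w. g x u = 0 \<Longrightarrow> g (I x) u = 0 \<Longrightarrow> g x w = 0 \<Longrightarrow> g (I x) w = 0 \<Longrightarrow> g (commutator u) w = 0"
  shows "commutator v = 0"
proof -
  have x0: "x \<noteq> 0" using neg by (auto simp: lin_simps)
  have gx: "g x x > 0" using x0 by (rule pos)
  define s where "s w = g w x / g x x" for w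
  define t where "t w = g w (I x) / g x x" for w
  define rest where "rest w = w - (s w *\<^sub>R x + t w *\<^sub>R I x)" for w
  have rest: "g x (rest w) = 0" "g (I x) (rest w) = 0" for w
    using gx by (simp_all add: rest_def s_def t_def lin_simps sym[of w] sym[of "I x" x])
  have span: "w = s w *\<^sub>R x + t w *\<^sub>R I x" if "\<And>y. g x y = 0 \<Longrightarrow> g (I x) y = 0 \<Longrightarrow> g w y = 0" for w
  proof -
    have "g (rest w) y = g w y - (s w * g x y + t w * g (I x) y)" for y
      by (simp add: rest_def lin_simps)
    from this[of "rest w"] have "g (rest w) (rest w) = 0"
      using that[OF rest] by (simp add: rest)
    then have "rest w = 0" by (rule eq_zeroI)
    then show ?thesis by (simp add: rest_def)
  qed
  have comm0: "commutator u = 0" if u: "g x u = 0" "g (I x) u = 0" for u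
  proof (rule ccontr)
    assume "commutator u \<noteq> 0"
    define w where "w = commutator u"
    have w0: "w \<noteq> 0" using \<open>commutator u \<noteq> 0\<close> by (simp add: w_def)
    define a b where "a = s w" and "b = t w"
    have w: "w = a *\<^sub>R x + b *\<^sub>R I x"
      unfolding a_def b_def by (rule span) (simp add: w_def zero u)
    then have "a \<noteq> 0 \<or> b \<noteq> 0" using w0 by auto
    then have ab: "a * a + b * b > 0" by (simp add: sum_squares_gt_zero_iff)
    have perp: "g x y = 0" "g (I x) y = 0" if "g w y = 0" "g (I w) y = 0" for y
    proof -
      have 1: "a * g x y + b * g (I x) y = 0" using that(1) by (simp add: w lin_simps)
      have 2: "a * g (I x) y - b * g x y = 0" using that(2) by (simp add: w lin_simps)
      have "(a * a + b * b) * g x y = a * (a * g x y + b * g (I x) y) - b * (a * g (I x) y - b * g x y)"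
        by (simp add: algebra_simps)
      then have "(a * a + b * b) * g x y = 0" unfolding 1 2 by simp
      then show "g x y = 0" using ab by (simp only: mult_eq_0_iff) auto
      have "(a * a + b * b) * g (I x) y = b * (a * g x y + b * g (I x) y) + a * (a * g (I x) y - b * g x y)"
        by (simp add: algebra_simps)
      then have "(a * a + b * b) * g (I x) y = 0" unfolding 1 2 by simp
      then show "g (I x) y = 0" using ab by (simp only: mult_eq_0_iff) auto
    qed
    have Cu: "g x (anticommutator u) = 0" "g (I x) (anticommutator u) = 0"
      using perp[of "anticommutator u"] commutator_anticommutator_orthogonal[of u] by (simp_all add: w_def)
    have Cw: "anticommutator w = commutator (anticommutator u)"
      by (simp add: w_def anticommutator_commutator)
    define l where "l = g (anticommutator w) w / g w w"
    define r where "r = anticommutator w - l *\<^sub>R w"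
    have gw: "g w w > 0" using w0 by (rule pos)
    have "g w r = 0" "g (I w) r = 0"
      using gw anticommutator_I_self[of w]
      by (simp_all add: r_def l_def lin_simps sym[of w "anticommutator w"] sym[of "I w"])
    note rperp = perp[OF this]
    have "g r y = g (commutator (anticommutator u)) y - l * g (commutator u) y" for y
      unfolding r_def Cw by (simp add: lin_simps w_def)
    then have "g r r = g (commutator (anticommutator u)) r - l * g (commutator u) r" .
    also have "\<dots> = 0" by (simp add: zero u Cu rperp)
    finally have "r = 0" by (rule eq_zeroI)
    then have eig: "anticommutator w = l *\<^sub>R w" by (simp add: r_def)
    have "g (anticommutator w) w = (a * a + b * b) * g (anticommutator x) x"
      using anticommutator_I_self[of x] I_skew[of "anticommutator x" x]
      by (simp add: w comm_simps lin_simps anticommutator_I) (simp add: algebra_simps)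
    then have "g (anticommutator w) w < 0" using neg ab by (simp add: mult_pos_neg)
    then have l: "l < 0" using gw by (simp add: l_def divide_neg_pos)
    define v where "v = commutator w"
    have "g w v = 0" "g (I w) v = 0"
      using commutator_self[of w] by (simp_all add: v_def sym[of w] sym[of "I w"])
    note vperp = perp[OF this]
    have "anticommutator v = l *\<^sub>R v"
      by (simp add: v_def anticommutator_commutator eig comm_simps)
    then have "g (anticommutator v) v = l * g v v" by (simp add: lin_simps)
    moreover have "\<not> l * g v v > 0" if "v \<noteq> 0"
      using mult_neg_pos[OF l pos[OF that]] by simp
    ultimately have "v = 0" using posv[OF vperp] by fastforce
    then have "g w w = 0"
      using commutator_skew[of w u] by (simp add: v_def lin_simps w_def)
    then show False using gw by simp
  qed
  have "g x (commutator x) = 0" "g (I x) (commutator x) = 0"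
    using commutator_self[of x] by (simp_all add: sym[of x] sym[of "I x"])
  then have "commutator (commutator x) = 0" by (rule comm0)
  then have "g (commutator x) (commutator x) = 0"
    using commutator_skew[of x "commutator x"] by (simp add: lin_simps)
  then have Px: "commutator x = 0" by (rule eq_zeroI)
  have "commutator (rest v) = 0" by (rule comm0) (rule rest)+
  then show ?thesis by (simp add: rest_def comm_simps Px commutator_I lin_simps)
qed

end

section \<open>Zero sets of holomorphic functions of several variables\<close>

text \<open>
The Cauchy-Riemann equation with respect to a field \<open>I\<close> of complex structures; constant multiplication
by \<open>\<i>\<close> gives the holomorphic functions of several complex variables.
\<close>

definition holomorphic_wrt ::
  "('e::euclidean_space \<Rightarrow> 'e \<Rightarrow> 'e) \<Rightarrow> 'e set \<Rightarrow> ('e \<Rightarrow> complex) \<Rightarrow> bool" where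
  "holomorphic_wrt I S f \<longleftrightarrow> smooth_on S f \<and> (\<forall>y\<in>S. \<forall>v. ddir f y (I y v) = \<i> * ddir f y v)"

abbreviation holomorphic_std :: "(complex^'n) set \<Rightarrow> (complex^'n \<Rightarrow> complex) \<Rightarrow> bool" where
  "holomorphic_std \<equiv> holomorphic_wrt (\<lambda>_ v. \<i> *s v)"

lemma holomorphic_wrt_smooth: "holomorphic_wrt I S f \<Longrightarrow> smooth_on S f"
  by (simp add: holomorphic_wrt_def)

lemma holomorphic_wrt_ddir: "holomorphic_wrt I S f \<Longrightarrow> y \<in> S \<Longrightarrow> ddir f y (I y v) = \<i> * ddir f y v"
  by (simp add: holomorphic_wrt_def)

lemma holomorphic_wrt_subset: "holomorphic_wrt I S f \<Longrightarrow> T \<subseteq> S \<Longrightarrow> holomorphic_wrt I T f"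
  unfolding holomorphic_wrt_def using smooth_on_subset[of S f T] by blast

lemma linear_smult_left: "linear (\<lambda>c::complex. c *s (e::complex^'n))"
  by (rule linearI) (simp_all add: vec_eq_iff algebra_simps)

lemma bounded_linear_smult_left: "bounded_linear (\<lambda>c::complex. c *s (e::complex^'n))"
  using linear_smult_left linear_conv_bounded_linear by blast

lemma smult_eq_scaleR: "c *s v = Re c *\<^sub>R v + Im c *\<^sub>R (\<i> *s (v::complex^'n))"
  by (simp add: vec_eq_iff complex_eq_iff)

lemma ddir_smult:
  assumes "holomorphic_std S f" "z \<in> S"
  shows "ddir f z (c *s v) = c * ddir f z v"
proof -
  have lin: "linear (ddir f z)"
    by (rule linear_ddir[OF smooth_on_differentiable[OF holomorphic_wrt_smooth[OF assms(1)] assms(2)]])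
  have "ddir f z (c *s v) = ddir f z (Re c *\<^sub>R v) + ddir f z (Im c *\<^sub>R (\<i> *s v))"
    by (subst smult_eq_scaleR) (rule linear_add[OF lin])
  also have "\<dots> = Re c *\<^sub>R ddir f z v + Im c *\<^sub>R (\<i> * ddir f z v)"
    using holomorphic_wrt_ddir[OF assms, of v]
    by (simp add: linear_scale[OF lin, of "Re c" v] linear_scale[OF lin, of "Im c" "\<i> *s v"])
  also have "\<dots> = c * ddir f z v" by (simp add: complex_eq_iff)
  finally show ?thesis .
qed

text \<open>
The Cauchy-Riemann equation may be differentiated once more, since second derivatives are symmetric.
\<close>

lemma holomorphic_std_ddir:
  assumes "holomorphic_std S f" "open S"
  shows "holomorphic_std S (\<lambda>z. ddir f z e)"
  unfolding holomorphic_wrt_def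
proof (intro conjI ballI allI)
  note sm = holomorphic_wrt_smooth[OF assms(1)]
  show "smooth_on S (\<lambda>z. ddir f z e)" by (rule smooth_on_ddir[OF sm])
  fix z v assume z: "z \<in> S"
  have "ddir (\<lambda>z. ddir f z e) z (\<i> *s v) = ddir (\<lambda>z. ddir f z (\<i> *s v)) z e"
    by (rule second_derivative_symmetric[OF sm assms(2) z])
  also have "\<dots> = ddir (\<lambda>z. \<i> * ddir f z v) z e"
    by (rule ddir_cong_open[OF assms(2) z]) (rule holomorphic_wrt_ddir[OF assms(1)])
  also have "\<dots> = \<i> * ddir (\<lambda>z. ddir f z v) z e"
    by (rule ddir_eqI[OF has_derivative_mult_right[OF
          ddir_has_derivative[OF smooth_on_differentiable[OF smooth_on_ddir[OF sm] z]]]])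
  also have "ddir (\<lambda>z. ddir f z v) z e = ddir (\<lambda>z. ddir f z e) z v"
    by (rule second_derivative_symmetric[OF sm assms(2) z])
  finally show "ddir (\<lambda>z. ddir f z e) z (\<i> *s v) = \<i> * ddir (\<lambda>z. ddir f z e) z v" .
qed

lemma line_has_field_derivative:
  assumes "holomorphic_std S f" "z + t *s e \<in> S"
  shows "((\<lambda>t. f (z + t *s e)) has_field_derivative ddir f (z + t *s e) e) (at t)"
proof -
  have "((\<lambda>t. z + t *s e) has_derivative (\<lambda>h. 0 + h *s e)) (at t)"
    by (rule has_derivative_add[OF has_derivative_const
          bounded_linear_imp_has_derivative[OF bounded_linear_smult_left]])
  from has_derivative_compose[OF this ddir_has_derivative[OF
        smooth_on_differentiable[OF holomorphic_wrt_smooth[OF assms(1)] assms(2)]]]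
  have "((\<lambda>t. f (z + t *s e)) has_derivative (\<lambda>h. ddir f (z + t *s e) (h *s e))) (at t)" by simp
  then show ?thesis
    unfolding has_field_derivative_def ddir_smult[OF assms] by (simp add: mult.commute[of _ "ddir _ _ _"])
qed

lemma open_line_preimage:
  "open S \<Longrightarrow> open {t. z + t *s (e::complex^'n) \<in> S}"
  using open_vimage[of S "\<lambda>t. z + t *s e"]
    continuous_on_add[OF continuous_on_const linear_continuous_on[OF bounded_linear_smult_left], of UNIV z e]
  by (simp add: vimage_def)

lemma line_holomorphic_on:
  assumes "holomorphic_std S f" "\<And>t. t \<in> T \<Longrightarrow> z + t *s e \<in> S"
  shows "(\<lambda>t. f (z + t *s e)) holomorphic_on T"
  unfolding holomorphic_on_def field_differentiable_def
  using line_has_field_derivative[OF assms(1)] assms(2) has_field_derivative_at_within by blast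

primrec iterated_ddir :: "('e::euclidean_space \<Rightarrow> 'f::euclidean_space) \<Rightarrow> 'e \<Rightarrow> nat \<Rightarrow> 'e \<Rightarrow> 'f" where
  "iterated_ddir f e 0 = f"
| "iterated_ddir f e (Suc k) = (\<lambda>z. ddir (iterated_ddir f e k) z e)"

lemma holomorphic_iterated_ddir:
  "holomorphic_std S f \<Longrightarrow> open S \<Longrightarrow> holomorphic_std S (iterated_ddir f e k)"
  by (induction k) (simp_all add: holomorphic_std_ddir)

lemma higher_deriv_line:
  assumes f: "holomorphic_std S f" and S: "open S"
  shows "z + t *s e \<in> S \<Longrightarrow> (deriv ^^ k) (\<lambda>t. f (z + t *s e)) t = iterated_ddir f e k (z + t *s e)"
proof (induction k arbitrary: t)
  case 0
  then show ?case by simp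
next
  case (Suc k)
  have "((\<lambda>t. iterated_ddir f e k (z + t *s e)) has_field_derivative
      ddir (iterated_ddir f e k) (z + t *s e) e) (at t)"
    by (rule line_has_field_derivative[OF holomorphic_iterated_ddir[OF f S] Suc.prems])
  then have "((deriv ^^ k) (\<lambda>t. f (z + t *s e)) has_field_derivative
      ddir (iterated_ddir f e k) (z + t *s e) e) (at t)"
    by (rule has_field_derivative_transform_within_open[OF _ open_line_preimage[OF S, of z e]])
      (simp_all add: Suc)
  then show ?case by (simp add: DERIV_imp_deriv)
qed

text \<open>
The map \<open>\<Phi>\<close> moves points along \<open>e\<close> only, in such a way that the \<open>i\<close>-th coordinate of \<open>\<Phi> z\<close> becomes a constant
multiple of \<open>\<gamma> z\<close>. The inverse of its differential is the explicit map \<open>R\<close> in the proof, a rational expression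
in the derivatives of \<open>\<gamma>\<close>; so the derivative of the local inverse \<open>\<Psi>\<close> is of class \<open>C\<^sup>k\<close> whenever \<open>\<Psi>\<close> is.
\<close>

lemma straightening:
  fixes \<gamma> :: "complex^'n \<Rightarrow> complex"
  assumes \<gamma>: "holomorphic_std U \<gamma>" and U: "open U" "q \<in> U" and q: "ddir \<gamma> q e \<noteq> 0" and i: "e $ i \<noteq> 0"
  defines "\<Phi> \<equiv> \<lambda>z. z + (\<gamma> z - z $ i / e $ i) *s e"
  obtains V W \<Psi> where "open V" "V \<subseteq> U" "q \<in> V" "open W" "homeomorphism V W \<Phi> \<Psi>"
    "smooth_on V \<Phi>" "smooth_on W \<Psi>" "\<And>z v. z \<in> V \<Longrightarrow> ddir \<Phi> z (\<i> *s v) = \<i> *s ddir \<Phi> z v"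
proof -
  note sm = holomorphic_wrt_smooth[OF \<gamma>]
  define U0 where "U0 = U \<inter> (\<lambda>z. ddir \<gamma> z e) -` (- {0})"
  have U0: "open U0" "q \<in> U0" "U0 \<subseteq> U"
    unfolding U0_def using q U
    by (auto intro: continuous_open_preimage[OF smooth_on_continuous[OF smooth_on_ddir[OF sm]]])
  have linD: "linear (ddir \<gamma> z)" if "z \<in> U0" for z
    using U0(3) that by (intro linear_ddir smooth_on_differentiable[OF sm]) auto
  have coord: "bounded_linear (\<lambda>z::complex^'n. z $ i / e $ i)"
    by (rule bounded_linear_compose[OF bounded_linear_divide bounded_linear_vec_nth])
  have "smooth_on U \<Phi>" unfolding \<Phi>_def
    by (rule smooth_on_add[OF smooth_on_bounded_linear[OF bounded_linear_ident]
          smooth_on_linear_compose[OF bounded_linear_smult_left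
            smooth_on_diff[OF sm smooth_on_bounded_linear[OF coord] U(1)] U(1)] U(1)])
  then have sm\<Phi>: "smooth_on U0 \<Phi>" by (rule smooth_on_subset[OF _ U0(3)])
  have D\<Phi>: "ddir \<Phi> z v = v + (ddir \<gamma> z v - v $ i / e $ i) *s e" if z: "z \<in> U0" for z v
    unfolding \<Phi>_def
  proof (rule ddir_eqI)
    show "((\<lambda>z. z + (\<gamma> z - z $ i / e $ i) *s e) has_derivative
      (\<lambda>v. v + (ddir \<gamma> z v - v $ i / e $ i) *s e)) (at z)"
      using z U0(3)
      by (intro has_derivative_add has_derivative_ident bounded_linear.has_derivative[OF bounded_linear_smult_left]
          has_derivative_diff ddir_has_derivative smooth_on_differentiable[OF sm]
          bounded_linear_imp_has_derivative[OF coord]) auto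
  qed
  have add_smult: "ddir \<gamma> z (v + c *s e) = ddir \<gamma> z v + c * ddir \<gamma> z e" if "z \<in> U0" for z v c
    using linear_add[OF linD[OF that]] ddir_smult[OF \<gamma>, of z c e] U0(3) that by auto
  define R where "R z w = w + ((w $ i / e $ i - ddir \<gamma> z w) * inverse (ddir \<gamma> z e)) *s e" for z w
  have nz: "ddir \<gamma> z e \<noteq> 0" if "z \<in> U0" for z using that by (simp add: U0_def)
  have R\<Phi>: "R z (ddir \<Phi> z v) = v" if "z \<in> U0" for z v
    using nz[OF that] i unfolding D\<Phi>[OF that] R_def add_smult[OF that]
    by (simp add: vec_eq_iff field_simps)
  have \<Phi>R: "ddir \<Phi> z (R z w) = w" if "z \<in> U0" for z w
    using nz[OF that] i unfolding D\<Phi>[OF that] R_def add_smult[OF that]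
    by (simp add: vec_eq_iff field_simps)
  have blin: "bounded_linear (ddir \<Phi> z)" if "z \<in> U0" for z
    by (rule has_derivative_bounded_linear[OF ddir_has_derivative[OF smooth_on_differentiable[OF sm\<Phi> that]]])
  have "bounded_linear (ddir \<gamma> q)" using linD[OF U0(2)] by (simp add: linear_conv_bounded_linear)
  then have blinR: "bounded_linear (R q)" unfolding R_def
    by (intro bounded_linear_add[OF bounded_linear_ident] bounded_linear_compose[OF bounded_linear_smult_left]
        bounded_linear_compose[OF bounded_linear_mult_left] bounded_linear_sub[OF coord])
  have 1: "(\<Phi> has_derivative blinfun_apply (Blinfun (ddir \<Phi> z))) (at z)" if "z \<in> U0" for z
    unfolding bounded_linear_Blinfun_apply[OF blin[OF that]]
    by (rule ddir_has_derivative[OF smooth_on_differentiable[OF sm\<Phi> that]])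
  have 2: "continuous_on U0 (\<lambda>z. Blinfun (ddir \<Phi> z))"
  proof (rule continuous_on_blinfun_componentwise)
    fix b :: "complex^'n"
    show "continuous_on U0 (\<lambda>z. blinfun_apply (Blinfun (ddir \<Phi> z)) b)"
      by (rule continuous_on_eq[OF smooth_on_continuous[OF smooth_on_ddir[OF sm\<Phi>, of b]]])
        (simp add: bounded_linear_Blinfun_apply[OF blin])
  qed
  have 3: "Blinfun (R q) o\<^sub>L Blinfun (ddir \<Phi> q) = id_blinfun"
    by (rule blinfun_eqI)
      (simp add: bounded_linear_Blinfun_apply[OF blinR] bounded_linear_Blinfun_apply[OF blin[OF U0(2)]] R\<Phi>[OF U0(2)])
  obtain V W \<Psi> \<Psi>' where V: "open V" "V \<subseteq> U0" "q \<in> V" "open W" "\<Phi> q \<in> W"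
      "homeomorphism V W \<Phi> \<Psi>"
    and D\<Psi>: "\<And>y. y \<in> W \<Longrightarrow> (\<Psi> has_derivative (\<Psi>' y)) (at y)"
    and \<Psi>': "\<And>y. y \<in> W \<Longrightarrow> \<Psi>' y = inv (blinfun_apply (Blinfun (ddir \<Phi> (\<Psi> y))))"
    and bij: "\<And>y. y \<in> W \<Longrightarrow> bij (blinfun_apply (Blinfun (ddir \<Phi> (\<Psi> y))))"
  proof (rule inverse_function_theorem[OF U0(1) 1 2 U0(2) 3], goal_cases)
    case (2 V W \<Psi> \<Psi>')
    show ?case by (rule 2(1)[OF 2(2-10)])
  qed
  have \<Psi>V: "\<Psi> ` W = V" using V(6) by (simp add: homeomorphism_def)
  then have \<Psi>U0: "\<Psi> y \<in> U0" if "y \<in> W" for y using that V(2) by blast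
  have dd\<Psi>: "ddir \<Psi> y w = R (\<Psi> y) w" if y: "y \<in> W" for y w
  proof -
    have "ddir \<Psi> y w = \<Psi>' y w" by (rule ddir_eqI[OF D\<Psi>[OF y]])
    also have "\<dots> = inv (ddir \<Phi> (\<Psi> y)) w"
      unfolding \<Psi>'[OF y] bounded_linear_Blinfun_apply[OF blin[OF \<Psi>U0[OF y]]] ..
    also have "\<dots> = R (\<Psi> y) w"
      using bij[OF y] \<Phi>R[OF \<Psi>U0[OF y]] unfolding bounded_linear_Blinfun_apply[OF blin[OF \<Psi>U0[OF y]]]
      by (intro inv_f_eq) (auto simp: bij_def)
    finally show ?thesis .
  qed
  have "Ck_on k W \<Psi>" for k
  proof (induction k)
    case 0
    then show ?case using V(6) by (simp add: homeomorphism_def)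
  next
    case (Suc k)
    have comp: "Ck_on k W (\<lambda>y. ddir \<gamma> (\<Psi> y) w)" for w
      using \<Psi>V V(2) U0(3)
      by (intro Ck_on_compose[OF smooth_onD[OF smooth_on_ddir[OF sm]] Suc.IH _ V(4) U(1)]) auto
    have "Ck_on k W (\<lambda>y. ddir \<Psi> y w)" for w
    proof (rule Ck_on_cong[OF V(4)])
      have "Ck_on k W (\<lambda>y. inverse (ddir \<gamma> (\<Psi> y) e))"
        by (rule Ck_on_inverse[OF comp V(4)]) (simp add: nz \<Psi>U0)
      from Ck_on_bilinear[OF bounded_bilinear_mult Ck_on_diff[OF Ck_on_const comp V(4)] this V(4)]
      show "Ck_on k W (\<lambda>y. R (\<Psi> y) w)" unfolding R_def
        by (intro Ck_on_add[OF Ck_on_const Ck_on_linear_compose[OF bounded_linear_smult_left _ V(4)] V(4)])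
    qed (simp add: dd\<Psi>)
    then show ?case using D\<Psi> by (auto simp: differentiable_def)
  qed
  then have "smooth_on W \<Psi>" by (rule smooth_onI)
  moreover have "ddir \<Phi> z (\<i> *s v) = \<i> *s ddir \<Phi> z v" if "z \<in> V" for z v
  proof -
    have z: "z \<in> U0" "z \<in> U" using that V(2) U0(3) by auto
    show ?thesis unfolding D\<Phi>[OF z(1)] holomorphic_wrt_ddir[OF \<gamma> z(2)]
      by (simp add: vec_eq_iff algebra_simps)
  qed
  ultimately show ?thesis
    using that[of V W \<Psi>] V U0(3) smooth_on_subset[OF sm\<Phi> V(2)] by (meson order_trans)
qed

text \<open>
Unless \<open>f\<close> vanishes near \<open>p\<close>, some complex line through \<open>p\<close> in a direction \<open>e\<close> carries a nonzero value of \<open>f\<close>,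
so that a derivative of \<open>f\<close> along \<open>e\<close> does not vanish at \<open>p\<close>. Choose a zero \<open>q\<close> at which the order of vanishing
along \<open>e\<close> is the least possible, say \<open>M + 1\<close>. Then the \<open>M\<close>-th derivative \<open>\<gamma>\<close> of \<open>f\<close> along \<open>e\<close> vanishes on all zeros of
\<open>f\<close>, but its derivative along \<open>e\<close> at \<open>q\<close> does not, so the zeros of \<open>f\<close> lie on the smooth hypersurface \<open>\<gamma> = 0\<close>.
Near \<open>q\<close> they fill it: on every nearby line in direction \<open>e\<close> the function \<open>f\<close> has a zero by the minimum modulus
principle, and such a line meets the hypersurface only once.
\<close>

theorem zero_set_has_hypersurface_point:
  fixes f :: "complex^'n \<Rightarrow> complex"
  assumes f: "holomorphic_std U f" and U: "open U" "p \<in> U" and fp: "f p = 0"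
  obtains V W L and \<Phi> \<Psi> :: "complex^'n \<Rightarrow> complex^'n" and q where "open V" "V \<subseteq> U" "q \<in> V" "f q = 0" "open W" "homeomorphism V W \<Phi> \<Psi>"
    "smooth_on V \<Phi>" "smooth_on W \<Psi>" "\<And>z v. z \<in> V \<Longrightarrow> ddir \<Phi> z (\<i> *s v) = \<i> *s ddir \<Phi> z v"
    "vec.subspace L" "CARD('n) \<le> vec.dim L + 1" "\<Phi> ` {z \<in> V. f z = 0} = W \<inter> L"
proof -
  obtain r where r: "r > 0" "ball p r \<subseteq> U" using U openE by blast
  let ?B = "ball p r"
  note fB = holomorphic_wrt_subset[OF f r(2)]
  show ?thesis
  proof (cases "\<forall>z\<in>?B. f z = 0")
    case True
    have "ddir (\<lambda>z. z) z (\<i> *s v) = \<i> *s ddir (\<lambda>z. z) z v" for z v :: "complex^'n" by simp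
    moreover have "vec.dim (UNIV :: (complex^'n) set) = CARD('n)"
      using dim_substandard_cart[of "UNIV :: 'n set", where 'a = complex] by simp
    moreover have "homeomorphism ?B ?B (\<lambda>z. z) (\<lambda>z. z)" by (rule homeomorphism_ident)
    ultimately show ?thesis
      using True r fp smooth_on_bounded_linear[OF bounded_linear_ident, of ?B]
      by (intro that[of ?B p ?B "\<lambda>z. z" "\<lambda>z. z" UNIV]) auto
  next
    case False
    then obtain q0 where q0: "q0 \<in> ?B" "f q0 \<noteq> 0" by blast
    define e where "e = q0 - p"
    define F where "F k = iterated_ddir f e k" for k
    have F0: "F 0 = f" and FS: "F (Suc k) = (\<lambda>z. ddir (F k) z e)" for k by (simp_all add: F_def)
    have holF: "holomorphic_std ?B (F k)" for k
      unfolding F_def by (rule holomorphic_iterated_ddir[OF fB open_ball])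
    have "\<exists>k. F k p \<noteq> 0"
    proof (rule ccontr)
      assume "\<nexists>k. F k p \<noteq> 0"
      then have zero: "F k p = 0" for k by blast
      define T where "T = {t::complex. p + t *s e \<in> ?B}"
      have "T = (\<lambda>t. t *s e) -` ball 0 r" by (auto simp: T_def dist_norm norm_minus_commute)
      then have "convex T" by (simp add: convex_linear_vimage[OF linear_smult_left convex_ball])
      then have T: "connected T" by (rule convex_connected)
      have opT: "open T" unfolding T_def by (rule open_line_preimage[OF open_ball])
      have "(\<lambda>t. f (p + t *s e)) 1 = 0"
      proof (rule holomorphic_fun_eq_0_on_connected[OF line_holomorphic_on[OF fB] opT T])
        show "(deriv ^^ n) (\<lambda>t. f (p + t *s e)) 0 = 0" for n
          using higher_deriv_line[OF fB open_ball, of p 0 e n] r zero[of n] by (simp add: F_def)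
      qed (use q0 r in \<open>simp_all add: T_def e_def\<close>)
      then show False using q0 by (simp add: e_def)
    qed
    then obtain k0 where k0: "F k0 p \<noteq> 0" by blast
    define N where "N = (LEAST k. \<exists>z\<in>?B. f z = 0 \<and> F k z \<noteq> 0)"
    have ex: "\<exists>z\<in>?B. f z = 0 \<and> F k0 z \<noteq> 0" using k0 fp r(1) by (intro bexI[of _ p]) auto
    have "\<exists>z\<in>?B. f z = 0 \<and> F N z \<noteq> 0" unfolding N_def by (rule LeastI[of _ k0]) (rule ex)
    then obtain q where q: "q \<in> ?B" "f q = 0" "F N q \<noteq> 0" by blast
    have "N \<noteq> 0" using q F0 by (metis)
    then obtain M where M: "N = Suc M" using not0_implies_Suc by blast
    define \<gamma> where "\<gamma> = F M"
    have \<gamma>0: "\<gamma> z = 0" if "z \<in> ?B" "f z = 0" for z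
      using not_less_Least[of M "\<lambda>k. \<exists>z\<in>?B. f z = 0 \<and> F k z \<noteq> 0"] that M unfolding N_def[symmetric] \<gamma>_def by auto
    have \<gamma>: "holomorphic_std ?B \<gamma>" unfolding \<gamma>_def by (rule holF)
    have dq: "ddir \<gamma> q e \<noteq> 0" using q(3) by (simp add: M FS \<gamma>_def)
    have "linear (ddir \<gamma> q)"
      by (rule linear_ddir[OF smooth_on_differentiable[OF holomorphic_wrt_smooth[OF \<gamma>] q(1)]])
    then have "e \<noteq> 0" using dq linear_0 by force
    then obtain i where i: "e $ i \<noteq> 0" by (auto simp: vec_eq_iff)
    define \<Phi> where "\<Phi> = (\<lambda>z. z + (\<gamma> z - z $ i / e $ i) *s e)"
    obtain V W \<Psi> where V: "open V" "V \<subseteq> ?B" "q \<in> V" "open W" and hom: "homeomorphism V W \<Phi> \<Psi>"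
      and sm: "smooth_on V \<Phi>" "smooth_on W \<Psi>" and cl: "\<And>z v. z \<in> V \<Longrightarrow> ddir \<Phi> z (\<i> *s v) = \<i> *s ddir \<Phi> z v"
      using straightening[OF \<gamma> open_ball q(1) dq i] unfolding \<Phi>_def by blast
    have \<Phi>i: "\<Phi> z $ i = \<gamma> z * e $ i" for z using i by (simp add: \<Phi>_def field_simps)
    have inj: "inj_on \<Phi> V" using hom by (metis homeomorphism_def inj_on_inverseI)
    \<comment> \<open>a complex line in direction \<open>e\<close> meets the zero set of \<open>\<gamma>\<close> at most once, as \<open>\<Phi>\<close> is injective\<close>
    have once: "t = 0" if "z \<in> V" "z + t *s e \<in> V" "\<gamma> z = 0" "\<gamma> (z + t *s e) = 0" for z t
    proof -
      have "\<Phi> (z + t *s e) = \<Phi> z" using that(3,4) i by (simp add: \<Phi>_def vec_eq_iff field_simps)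
      then have "z + t *s e = z" using inj that by (auto dest: inj_onD)
      then show "t = 0" using \<open>e \<noteq> 0\<close> by simp
    qed
    have contf: "continuous_on V f"
      by (rule continuous_on_subset[OF smooth_on_continuous[OF holomorphic_wrt_smooth[OF fB]] V(2)])
    define ln where "ln = (\<lambda>x :: (complex^'n) \<times> complex. fst x + snd x *s e)"
    have cont_ln: "continuous_on UNIV ln" unfolding ln_def
      by (intro continuous_on_add continuous_on_fst continuous_on_id
          continuous_on_compose2[OF linear_continuous_on[OF bounded_linear_smult_left] continuous_on_snd[OF continuous_on_id]]) auto
    obtain \<rho> where \<rho>: "\<rho> > 0" "\<And>t. t \<in> cball 0 \<rho> \<Longrightarrow> q + t *s e \<in> V"
    proof -
      have "open {t. q + t *s e \<in> V}" "0 \<in> {t. q + t *s e \<in> V}"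
        using open_line_preimage[OF V(1)] V(3) by auto
      then obtain \<rho> where "\<rho> > 0" "cball 0 \<rho> \<subseteq> {t. q + t *s e \<in> V}" using open_contains_cball by blast
      then show ?thesis using that by blast
    qed
    have nz: "f (q + t *s e) \<noteq> 0" if t: "t \<in> sphere 0 \<rho>" for t
    proof
      assume f0: "f (q + t *s e) = 0"
      have "q + t *s e \<in> V" using t \<rho> by simp
      moreover from this have "\<gamma> (q + t *s e) = 0" using f0 V(2) \<gamma>0 by blast
      ultimately have "t = 0" using once[OF V(3)] \<gamma>0[OF q(1,2)] by blast
      then show False using t \<rho>(1) by simp
    qed
    obtain m where m: "m > 0" "\<And>t. t \<in> sphere 0 \<rho> \<Longrightarrow> m < norm (f (q + t *s e))"
    proof -
      have ne: "sphere (0::complex) \<rho> \<noteq> {}" using \<rho>(1) by (simp add: sphere_eq_empty)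
      have "continuous_on (sphere 0 \<rho>) (\<lambda>t. norm (f (q + t *s e)))"
        by (intro continuous_on_norm continuous_on_compose2[OF contf] continuous_on_add continuous_on_const
            linear_continuous_on[OF bounded_linear_smult_left]) (use \<rho>(2) in auto)
      from continuous_attains_inf[OF compact_sphere ne this]
      obtain t0 where t0: "t0 \<in> sphere 0 \<rho>"
        "\<And>t. t \<in> sphere 0 \<rho> \<Longrightarrow> norm (f (q + t0 *s e)) \<le> norm (f (q + t *s e))" by blast
      have pos: "norm (f (q + t0 *s e)) > 0" using nz[OF t0(1)] by simp
      show ?thesis
      proof (rule that[of "norm (f (q + t0 *s e)) / 2"])
        show "norm (f (q + t0 *s e)) / 2 < norm (f (q + t *s e))" if "t \<in> sphere 0 \<rho>" for t
          using t0(2)[OF that] pos by linarith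
      qed (use pos in simp)
    qed
    have W1: "open (ln -` V)" by (rule open_vimage[OF V(1) cont_ln])
    obtain X1 where X1: "q \<in> X1" "open X1" "X1 \<times> cball 0 \<rho> \<subseteq> ln -` V"
    proof -
      have "{q} \<times> cball 0 \<rho> \<subseteq> ln -` V" using \<rho>(2) by (auto simp: ln_def)
      from Elementary_Topology.tube_lemma[OF compact_cball W1 this] show ?thesis using that by blast
    qed
    have contfln: "continuous_on (ln -` V) (\<lambda>x. norm (f (ln x)))"
      by (intro continuous_on_norm continuous_on_compose2[OF contf] continuous_on_subset[OF cont_ln]) auto
    have W2: "open (ln -` V \<inter> (\<lambda>x. norm (f (ln x))) -` {m<..})"
      by (rule continuous_open_preimage[OF contfln W1]) simp
    obtain X2 where X2: "q \<in> X2" "open X2" "X2 \<times> sphere 0 \<rho> \<subseteq> ln -` V \<inter> (\<lambda>x. norm (f (ln x))) -` {m<..}"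
    proof -
      have "{q} \<times> sphere 0 \<rho> \<subseteq> ln -` V \<inter> (\<lambda>x. norm (f (ln x))) -` {m<..}"
        using \<rho>(2) m(2) by (auto simp: ln_def)
      from Elementary_Topology.tube_lemma[OF compact_sphere W2 this] show ?thesis using that by blast
    qed
    \<comment> \<open>in \<open>V'\<close> the modulus of \<open>f\<close> is below \<open>m\<close>; on the circle of radius \<open>\<rho>\<close> in direction \<open>e\<close> it is above \<open>m\<close>\<close>
    define V' where "V' = V \<inter> X1 \<inter> X2 \<inter> (V \<inter> (\<lambda>z. norm (f z)) -` {..<m})"
    have "open V'" unfolding V'_def
      by (intro open_Int V(1) X1(2) X2(2) continuous_open_preimage[OF continuous_on_norm[OF contf] V(1)]) simp
    have V'V: "V' \<subseteq> V" by (auto simp: V'_def)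
    have qV': "q \<in> V'" using V(3) X1(1) X2(1) q(2) m(1) by (simp add: V'_def)
    have zero_iff: "f z = 0 \<longleftrightarrow> \<gamma> z = 0" if z: "z \<in> V'" for z
    proof
      show "\<gamma> z = 0" if "f z = 0" using \<gamma>0 that z V'V V(2) by blast
      assume \<gamma>z: "\<gamma> z = 0"
      show "f z = 0"
      proof (rule ccontr)
        assume fz: "f z \<noteq> 0"
        have inV: "z + t *s e \<in> V" if "t \<in> cball 0 \<rho>" for t
        proof -
          have "(z, t) \<in> X1 \<times> cball 0 \<rho>" using z that by (simp add: V'_def)
          then have "(z, t) \<in> ln -` V" using X1(3) by blast
          then show ?thesis by (simp add: ln_def)
        qed
        have big: "m < norm (f (z + t *s e))" if "t \<in> sphere 0 \<rho>" for t
        proof -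
          have "(z, t) \<in> X2 \<times> sphere 0 \<rho>" using z that by (simp add: V'_def)
          then have "(z, t) \<in> ln -` V \<inter> (\<lambda>x. norm (f (ln x))) -` {m<..}" using X2(3) by blast
          then show ?thesis by (simp add: ln_def)
        qed
        have ne0: "f (z + t *s e) \<noteq> 0" if t: "t \<in> cball 0 \<rho>" for t
        proof
          assume f0: "f (z + t *s e) = 0"
          then have "\<gamma> (z + t *s e) = 0" using \<gamma>0 inV[OF t] V(2) by blast
          then have "t = 0" using once[OF _ inV[OF t] \<gamma>z] z V'V by blast
          then show False using f0 fz by simp
        qed
        define \<phi> where "\<phi> t = f (z + t *s e)" for t
        have hol: "\<phi> holomorphic_on cball 0 \<rho>" unfolding \<phi>_def
          by (rule line_holomorphic_on[OF holomorphic_wrt_subset[OF fB V(2)] inV])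
        have hol_inv: "(\<lambda>t. inverse (\<phi> t)) holomorphic_on cball 0 \<rho>"
          by (rule holomorphic_on_inverse[OF hol]) (simp add: \<phi>_def ne0)
        have "norm (inverse (\<phi> 0)) \<le> inverse m"
        proof (rule maximum_modulus_frontier[where S = "cball 0 \<rho>" and f = "\<lambda>t. inverse (\<phi> t)" and \<xi> = 0])
          show "(\<lambda>t. inverse (\<phi> t)) holomorphic_on interior (cball 0 \<rho>)"
            by (rule holomorphic_on_subset[OF hol_inv]) (rule interior_subset)
          show "continuous_on (closure (cball 0 \<rho>)) (\<lambda>t. inverse (\<phi> t))"
            using holomorphic_on_imp_continuous_on[OF hol_inv] by simp
          show "norm (inverse (\<phi> t)) \<le> inverse m" if "t \<in> frontier (cball 0 \<rho>)" for t
          proof -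
            have "m < norm (\<phi> t)" using big[of t] that by (simp add: \<phi>_def)
            then have "inverse (norm (\<phi> t)) \<le> inverse m"
              using m(1) by (intro le_imp_inverse_le) auto
            then show ?thesis unfolding norm_inverse .
          qed
        qed (use \<rho>(1) in auto)
        moreover have "norm (\<phi> 0) < m" "norm (\<phi> 0) > 0" using z fz by (simp_all add: V'_def \<phi>_def)
        then have "inverse m < inverse (norm (\<phi> 0))" by (rule less_imp_inverse_less)
        ultimately show False unfolding norm_inverse by linarith
      qed
    qed
    define W' where "W' = \<Phi> ` V'"
    have "openin (top_of_set W) W'" unfolding W'_def
      by (rule homeomorphism_imp_open_map[OF hom]) (use \<open>open V'\<close> V'V V(1) in \<open>simp add: openin_open_eq\<close>)
    then have W': "open W'" "W' \<subseteq> W" using V(4) by (simp_all add: openin_open_eq)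
    have hom': "homeomorphism V' W' \<Phi> \<Psi>"
      by (rule homeomorphism_of_subsets[OF hom V'V W'(2)]) (simp add: W'_def)
    define L where "L = {w :: complex^'n. w $ i = 0}"
    have L_alt: "L = {w. \<forall>j. j \<notin> UNIV - {i} \<longrightarrow> w $ j = 0}" by (auto simp: L_def)
    have "vec.dim L = CARD('n) - 1" unfolding L_alt dim_substandard_cart by (simp add: card_Diff_singleton)
    moreover have "vec.subspace L" by (simp add: L_def vec.subspace_def)
    moreover have "\<Phi> ` {z \<in> V'. f z = 0} = W' \<inter> L"
      using zero_iff i by (auto simp: W'_def L_def \<Phi>i)
    ultimately show ?thesis
      using that[of V' q W' \<Phi> \<Psi> L] \<open>open V'\<close> V'V V(2) r(2) qV' q(2) W' hom'
        smooth_on_subset[OF sm(1) V'V] smooth_on_subset[OF sm(2) W'(2)] cl by (simp add: subset_iff)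
  qed
qed

section \<open>The holomorphic bracket of a bihermitian structure\<close>

text \<open>
The connection \<open>\<Gamma>\<close> plays the role of \<open>\<nabla>\<^sup>+\<close>. As the torsion of \<open>\<nabla>\<^sup>+\<close> is \<open>g\<^sup>-\<^sup>1H\<close>, the connection \<open>\<nabla>\<^sup>-\<close> arises from it by
exchanging the two arguments, which explains the form of \<open>parallel_J\<close>.
\<close>

locale bihermitian_patch =
  fixes S :: "'e::euclidean_space set" and g :: "'e \<Rightarrow> 'e \<Rightarrow> 'e \<Rightarrow> real"
    and I J :: "'e \<Rightarrow> 'e \<Rightarrow> 'e" and \<Gamma> :: "'e \<Rightarrow> 'e \<Rightarrow> 'e \<Rightarrow> 'e"
  assumes S: "open S"
    and form: "y \<in> S \<Longrightarrow> inner_product_form (g y)" and sm_g: "smooth_on S (\<lambda>y. g y v w)"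
    and linI: "y \<in> S \<Longrightarrow> linear (I y)" and sm_I: "smooth_on S (\<lambda>y. I y v)"
    and linJ: "y \<in> S \<Longrightarrow> linear (J y)" and sm_J: "smooth_on S (\<lambda>y. J y v)"
    and II: "y \<in> S \<Longrightarrow> I y (I y v) = - v" and JJ: "y \<in> S \<Longrightarrow> J y (J y v) = - v"
    and gII: "y \<in> S \<Longrightarrow> g y (I y v) (I y w) = g y v w"
    and gJJ: "y \<in> S \<Longrightarrow> g y (J y v) (J y w) = g y v w"
    and metric: "y \<in> S \<Longrightarrow> ddir (\<lambda>z. g z v w) y u = g y (\<Gamma> y u v) w + g y v (\<Gamma> y u w)"
    and parallel_I: "y \<in> S \<Longrightarrow> ddir (\<lambda>z. I z w) y v = I y (\<Gamma> y v w) - \<Gamma> y v (I y w)"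
    and parallel_J: "y \<in> S \<Longrightarrow> ddir (\<lambda>z. J z w) y v = J y (\<Gamma> y w v) - \<Gamma> y (J y w) v"
    and torsion_skew: "y \<in> S \<Longrightarrow>
      g y (\<Gamma> y v w - \<Gamma> y w v) u = - g y w (\<Gamma> y v u - \<Gamma> y u v)"
begin

definition torsion :: "'e \<Rightarrow> 'e \<Rightarrow> 'e \<Rightarrow> 'e" where
  "torsion y v w = \<Gamma> y v w - \<Gamma> y w v"

lemma pair: "y \<in> S \<Longrightarrow> complex_structure_pair (g y) (I y) (J y)"
  by (rule complex_structure_pair.intro) (simp_all add: form linI linJ II JJ gII gJJ)

definition grad :: "('e \<Rightarrow> complex) \<Rightarrow> 'e \<Rightarrow> 'e" where
  "grad \<xi> y = raise_index (g y) (\<lambda>v. Re (ddir \<xi> y v))"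

text \<open>
The differentials of \<open>I\<close>-holomorphic functions are paired here by the bivector \<open>J g\<^sup>-\<^sup>1\<close>, extended complex
bilinearly: the complex gradient of \<open>\<eta>\<close> is \<open>grad \<eta> + \<i> I (grad \<eta>)\<close>. Only the (2,0) part of the bivector
contributes, which is a constant multiple of the one of \<open>[I, J] g\<^sup>-\<^sup>1\<close>.
\<close>

definition bracket :: "('e \<Rightarrow> complex) \<Rightarrow> ('e \<Rightarrow> complex) \<Rightarrow> 'e \<Rightarrow> complex" where
  "bracket \<xi> \<eta> y = ddir \<xi> y (J y (grad \<eta> y)) + \<i> * ddir \<xi> y (J y (I y (grad \<eta> y)))"

context
  fixes \<xi> assumes \<xi>: "holomorphic_wrt I S \<xi>"
begin

lemma diff_ddir: "y \<in> S \<Longrightarrow> (\<lambda>z. ddir \<xi> z v) differentiable (at y)"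
  by (rule smooth_on_differentiable[OF smooth_on_ddir[OF holomorphic_wrt_smooth[OF \<xi>]]])

lemma lin_ddir: "y \<in> S \<Longrightarrow> linear (ddir \<xi> y)"
  by (rule linear_ddir[OF smooth_on_differentiable[OF holomorphic_wrt_smooth[OF \<xi>]]])

lemma lin_Re_ddir: "y \<in> S \<Longrightarrow> linear (\<lambda>v. Re (ddir \<xi> y v))"
  using linear_compose[OF lin_ddir bounded_linear.linear[OF bounded_linear_Re]] by (simp add: o_def)

lemma grad: "y \<in> S \<Longrightarrow> g y (grad \<xi> y) v = Re (ddir \<xi> y v)"
  unfolding grad_def by (rule raise_index_eq[OF form lin_Re_ddir])

lemma smooth_grad: "smooth_on S (grad \<xi>)"
  unfolding grad_def
  by (rule smooth_on_raise_index[OF S form sm_g lin_Re_ddir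
        smooth_on_linear_compose[OF bounded_linear_Re smooth_on_ddir[OF holomorphic_wrt_smooth[OF \<xi>]] S]])

text \<open>The covariant derivative of the one-form \<open>d\<xi>\<close> in direction \<open>v\<close>, evaluated at \<open>w\<close>.\<close>

definition hess :: "'e \<Rightarrow> 'e \<Rightarrow> 'e \<Rightarrow> complex" where
  "hess y v w = ddir (\<lambda>z. ddir \<xi> z w) y v - ddir \<xi> y (\<Gamma> y v w)"

lemma hess_I:
  assumes y: "y \<in> S" shows "hess y v (I y w) = \<i> * hess y v w"
proof -
  have "((\<lambda>z. ddir \<xi> z (I z w)) has_derivative
      (\<lambda>v. ddir (\<lambda>z. ddir \<xi> z (I y w)) y v + ddir \<xi> y (ddir (\<lambda>z. I z w) y v))) (at y)"
    by (rule has_derivative_apply_field[OF S y lin_ddir diff_ddir[OF y]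
          ddir_has_derivative[OF smooth_on_differentiable[OF sm_I y]]])
  then have "ddir (\<lambda>z. ddir \<xi> z (I z w)) y v
      = ddir (\<lambda>z. ddir \<xi> z (I y w)) y v + ddir \<xi> y (ddir (\<lambda>z. I z w) y v)"
    by (rule ddir_eqI)
  moreover have "ddir (\<lambda>z. ddir \<xi> z (I z w)) y v = ddir (\<lambda>z. \<i> * ddir \<xi> z w) y v"
    by (rule ddir_cong_open[OF S y]) (rule holomorphic_wrt_ddir[OF \<xi>])
  moreover have "ddir (\<lambda>z. \<i> * ddir \<xi> z w) y v = \<i> * ddir (\<lambda>z. ddir \<xi> z w) y v"
    by (rule ddir_eqI[OF has_derivative_mult_right[OF ddir_has_derivative[OF diff_ddir[OF y]]]])
  moreover have "ddir \<xi> y (ddir (\<lambda>z. I z w) y v) = \<i> * ddir \<xi> y (\<Gamma> y v w) - ddir \<xi> y (\<Gamma> y v (I y w))"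
    unfolding parallel_I[OF y] linear_diff[OF lin_ddir[OF y]] holomorphic_wrt_ddir[OF \<xi> y] ..
  ultimately show ?thesis by (simp add: hess_def algebra_simps)
qed

lemma hess_torsion:
  assumes y: "y \<in> S" shows "hess y v w - hess y w v = - ddir \<xi> y (torsion y v w)"
  unfolding hess_def torsion_def linear_diff[OF lin_ddir[OF y]]
    second_derivative_symmetric[OF holomorphic_wrt_smooth[OF \<xi>] S y, of w v]
  by simp

text \<open>
As \<open>I\<close> is parallel, the Hessian is complex linear in its second argument. Exchanging the arguments costs a
torsion term because \<open>d\<xi>\<close> is closed. So only torsion survives in the antiholomorphic part with respect to
the first argument.
\<close>

lemma hess_dbar:
  assumes y: "y \<in> S"
  shows "hess y v w + \<i> * hess y (I y v) w = - ddir \<xi> y (torsion y v w) - \<i> * ddir \<xi> y (torsion y (I y v) w)"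
proof -
  have 1: "hess y v w = hess y w v - ddir \<xi> y (torsion y v w)"
    using hess_torsion[OF y, of v w] by (simp add: algebra_simps)
  have 2: "hess y (I y v) w = \<i> * hess y w v - ddir \<xi> y (torsion y (I y v) w)"
    using hess_torsion[OF y, of "I y v" w] hess_I[OF y, of w v] by (simp add: algebra_simps)
  show ?thesis unfolding 1 2 by (simp add: algebra_simps)
qed

text \<open>The covariant derivative of the gradient.\<close>

definition dgrad :: "'e \<Rightarrow> 'e \<Rightarrow> 'e" where
  "dgrad y v = ddir (grad \<xi>) y v + \<Gamma> y v (grad \<xi> y)"

lemma dgrad:
  assumes y: "y \<in> S" shows "g y (dgrad y v) w = Re (hess y v w)"
proof -
  note lin = inner_product_form_linear[OF form]
  have "((\<lambda>z. g z (grad \<xi> z) w) has_derivative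
      (\<lambda>v. ddir (\<lambda>z. g z (grad \<xi> y) w) y v + g y (ddir (grad \<xi>) y v) w)) (at y)"
    by (rule has_derivative_apply_field[where T = "\<lambda>z u. g z u w", OF S y lin(2)
          smooth_on_differentiable[OF sm_g y] ddir_has_derivative[OF smooth_on_differentiable[OF smooth_grad y]]])
  then have "ddir (\<lambda>z. g z (grad \<xi> z) w) y v = ddir (\<lambda>z. g z (grad \<xi> y) w) y v + g y (ddir (grad \<xi>) y v) w"
    by (rule ddir_eqI)
  moreover have "ddir (\<lambda>z. g z (grad \<xi> z) w) y v = ddir (\<lambda>z. Re (ddir \<xi> z w)) y v"
    by (rule ddir_cong_open[OF S y]) (rule grad)
  moreover have "ddir (\<lambda>z. Re (ddir \<xi> z w)) y v = Re (ddir (\<lambda>z. ddir \<xi> z w) y v)"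
    by (rule ddir_eqI[OF bounded_linear.has_derivative[OF bounded_linear_Re ddir_has_derivative[OF diff_ddir[OF y]]]])
  ultimately show ?thesis
    using metric[OF y, of "grad \<xi> y" w v] grad[OF y, of "\<Gamma> y v w"]
    by (simp add: hess_def dgrad_def linear_add[OF lin(2)[OF y]])
qed

text \<open>
These are the real and imaginary parts of one identity for the antiholomorphic derivative of the complex
gradient. It is dual to the corresponding identity for the Hessian, by skewness of the torsion.
\<close>

lemma dgrad_dbar:
  assumes y: "y \<in> S"
  shows "dgrad y v - I y (dgrad y (I y v)) = torsion y v (grad \<xi> y) - torsion y (I y v) (I y (grad \<xi> y))"
    and "I y (dgrad y v) + dgrad y (I y v) = torsion y v (I y (grad \<xi> y)) + torsion y (I y v) (grad \<xi> y)"
proof -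
  interpret complex_structure_pair "g y" "I y" "J y" by (rule pair[OF y])
  have tors: "g y (torsion y v a) w = - g y a (torsion y v w)" for v a w
    using torsion_skew[OF y] by (simp add: torsion_def)
  have gI: "g y (I y (grad \<xi> y)) u = - Re (\<i> * ddir \<xi> y u)" for u
    using I_skew[of "grad \<xi> y" u] grad[OF y, of "I y u"] holomorphic_wrt_ddir[OF \<xi> y, of u] by simp
  have db: "Re (hess y v w) + Re (\<i> * hess y (I y v) w)
      = - Re (ddir \<xi> y (torsion y v w)) - Re (\<i> * ddir \<xi> y (torsion y (I y v) w))"
    "Re (\<i> * hess y v w) - Re (hess y (I y v) w)
      = - Re (\<i> * ddir \<xi> y (torsion y v w)) + Re (ddir \<xi> y (torsion y (I y v) w))" for w
    using arg_cong[OF hess_dbar[OF y, of v w], of Re] arg_cong[OF hess_dbar[OF y, of v w], of Im]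
    by simp_all
  show "dgrad y v - I y (dgrad y (I y v)) = torsion y v (grad \<xi> y) - torsion y (I y v) (I y (grad \<xi> y))"
  proof (rule inner_product_form_eqI[OF form])
    fix w
    have "g y (dgrad y v - I y (dgrad y (I y v))) w = Re (hess y v w) + Re (hess y (I y v) (I y w))"
      using I_skew[of "dgrad y (I y v)" w] by (simp add: lin_simps dgrad[OF y])
    also have "\<dots> = - Re (ddir \<xi> y (torsion y v w)) - Re (\<i> * ddir \<xi> y (torsion y (I y v) w))"
      unfolding hess_I[OF y] by (rule db(1))
    also have "\<dots> = g y (torsion y v (grad \<xi> y) - torsion y (I y v) (I y (grad \<xi> y))) w"
      by (simp only: lin_simps tors gI grad[OF y])
    finally show "g y (dgrad y v - I y (dgrad y (I y v))) w
      = g y (torsion y v (grad \<xi> y) - torsion y (I y v) (I y (grad \<xi> y))) w" .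
  qed
  show "I y (dgrad y v) + dgrad y (I y v) = torsion y v (I y (grad \<xi> y)) + torsion y (I y v) (grad \<xi> y)"
  proof (rule inner_product_form_eqI[OF form])
    fix w
    have "g y (I y (dgrad y v) + dgrad y (I y v)) w = - Re (hess y v (I y w)) + Re (hess y (I y v) w)"
      using I_skew[of "dgrad y v" w] by (simp add: lin_simps dgrad[OF y])
    also have "\<dots> = Re (\<i> * ddir \<xi> y (torsion y v w)) - Re (ddir \<xi> y (torsion y (I y v) w))"
      unfolding hess_I[OF y] using db(2)[of w] by linarith
    also have "\<dots> = g y (torsion y v (I y (grad \<xi> y)) + torsion y (I y v) (grad \<xi> y)) w"
      by (simp only: lin_simps tors gI grad[OF y])
    finally show "g y (I y (dgrad y v) + dgrad y (I y v)) w
      = g y (torsion y v (I y (grad \<xi> y)) + torsion y (I y v) (grad \<xi> y)) w" .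
  qed
qed

lemma ddir_J_field:
  assumes y: "y \<in> S" and u: "(u has_derivative u') (at y)"
  shows "((\<lambda>z. ddir \<xi> z (J z (u z))) has_derivative
    (\<lambda>v. hess y v (J y (u y)) + ddir \<xi> y (torsion y v (J y (u y))) - ddir \<xi> y (J y (torsion y v (u y)))
      + ddir \<xi> y (J y (u' v + \<Gamma> y v (u y))))) (at y)"
proof -
  have "((\<lambda>z. J z (u z)) has_derivative (\<lambda>v. ddir (\<lambda>z. J z (u y)) y v + J y (u' v))) (at y)"
    by (rule has_derivative_apply_field[OF S y linJ smooth_on_differentiable[OF sm_J y] u])
  from has_derivative_apply_field[OF S y lin_ddir diff_ddir[OF y] this]
  have "((\<lambda>z. ddir \<xi> z (J z (u z))) has_derivative
    (\<lambda>v. ddir (\<lambda>z. ddir \<xi> z (J y (u y))) y v + ddir \<xi> y (ddir (\<lambda>z. J z (u y)) y v + J y (u' v)))) (at y)" .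
  moreover have "ddir (\<lambda>z. ddir \<xi> z (J y (u y))) y v + ddir \<xi> y (ddir (\<lambda>z. J z (u y)) y v + J y (u' v))
    = hess y v (J y (u y)) + ddir \<xi> y (torsion y v (J y (u y))) - ddir \<xi> y (J y (torsion y v (u y)))
      + ddir \<xi> y (J y (u' v + \<Gamma> y v (u y)))" for v
    unfolding parallel_J[OF y] hess_def torsion_def
    by (simp add: linear_add[OF lin_ddir[OF y]] linear_diff[OF lin_ddir[OF y]]
        linear_add[OF linJ[OF y]] linear_diff[OF linJ[OF y]] algebra_simps)
  ultimately show ?thesis by simp
qed

end

text \<open>
In the antiholomorphic derivative of \<open>d\<xi>(J B)\<close>, where \<open>B\<close> is the complex gradient of \<open>\<eta>\<close>, three terms arise,
one from each factor. All of them are expressed by the torsion \<open>h\<close>: they are \<open>- d\<xi>(h J B)\<close> from \<open>d\<xi>\<close>,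
\<open>d\<xi>((h J - J h) B)\<close> from \<open>J\<close>, which is parallel for \<open>\<nabla>\<^sup>-\<close>, and \<open>d\<xi>(J h B)\<close> from \<open>B\<close>. Their sum is zero.
\<close>

theorem bracket_holomorphic:
  assumes \<xi>: "holomorphic_wrt I S \<xi>" and \<eta>: "holomorphic_wrt I S \<eta>"
  shows "holomorphic_wrt I S (bracket \<xi> \<eta>)"
  unfolding holomorphic_wrt_def
proof (intro conjI ballI allI)
  note sm_grad = smooth_grad[OF \<eta>]
  have sm_Igrad: "smooth_on S (\<lambda>y. I y (grad \<eta> y))"
    by (rule smooth_on_apply_field[OF S linI sm_I sm_grad])
  have part: "smooth_on S (\<lambda>y. ddir \<xi> y (J y (u y)))" if "smooth_on S u" for u
    by (rule smooth_on_apply_field[OF S lin_ddir[OF \<xi>] smooth_on_ddir[OF holomorphic_wrt_smooth[OF \<xi>]]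
          smooth_on_apply_field[OF S linJ sm_J that]])
  show "smooth_on S (bracket \<xi> \<eta>)" unfolding bracket_def
    by (rule smooth_on_add[OF part[OF sm_grad]
          smooth_on_linear_compose[OF bounded_linear_mult_right part[OF sm_Igrad] S] S])
  fix y v assume y: "y \<in> S"
  define a where "a = grad \<eta> y"
  define A where "A = ddir \<xi> y"
  define h where "h = torsion y"
  define n where "n = dgrad \<eta> y"
  define N where "N = hess \<xi> y"
  have linA: "linear A" unfolding A_def by (rule lin_ddir[OF \<xi> y])
  have dgrad': "(grad \<eta> has_derivative ddir (grad \<eta>) y) (at y)"
    by (rule ddir_has_derivative[OF smooth_on_differentiable[OF sm_grad y]])
  have dIgrad: "((\<lambda>z. I z (grad \<eta> z)) has_derivative
      (\<lambda>v. ddir (\<lambda>z. I z (grad \<eta> y)) y v + I y (ddir (grad \<eta>) y v))) (at y)"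
    by (rule has_derivative_apply_field[OF S y linI smooth_on_differentiable[OF sm_I y] dgrad'])
  interpret complex_structure_pair "g y" "I y" "J y" by (rule pair[OF y])
  have n: "ddir (grad \<eta>) y v + \<Gamma> y v (grad \<eta> y) = n v" for v
    by (simp add: n_def dgrad_def[OF \<eta>])
  have In: "ddir (\<lambda>z. I z (grad \<eta> y)) y v + I y (ddir (grad \<eta>) y v) + \<Gamma> y v (I y (grad \<eta> y)) = I y (n v)" for v
    unfolding parallel_I[OF y] n[symmetric] by (simp add: lin_simps)
  define D where "D v = (N v (J y a) + A (h v (J y a)) - A (J y (h v a)) + A (J y (n v)))
    + \<i> * (N v (J y (I y a)) + A (h v (J y (I y a))) - A (J y (h v (I y a))) + A (J y (I y (n v))))" for v
  have "(bracket \<xi> \<eta> has_derivative D) (at y)"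
    unfolding bracket_def D_def
    using has_derivative_add[OF ddir_J_field[OF \<xi> y dgrad'] has_derivative_mult_right[OF ddir_J_field[OF \<xi> y dIgrad], of \<i>]]
    unfolding n In a_def A_def h_def N_def .
  then have D: "ddir (bracket \<xi> \<eta>) y v = D v" for v by (rule ddir_eqI)
  have Ndb: "N v w + \<i> * N (I y v) w = - A (h v w) - \<i> * A (h (I y v) w)" for w
    unfolding N_def A_def h_def by (rule hess_dbar[OF \<xi> y])
  have n1: "A (J y (n v)) - A (J y (I y (n (I y v)))) = A (J y (h v a)) - A (J y (h (I y v) (I y a)))"
    using arg_cong[OF dgrad_dbar(1)[OF \<eta> y, of v], of "\<lambda>u. A (J y u)"]
    by (simp add: n_def h_def a_def lin_simps linear_diff[OF linA])
  have n2: "A (J y (I y (n v))) + A (J y (n (I y v))) = A (J y (h v (I y a))) + A (J y (h (I y v) a))"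
    using arg_cong[OF dgrad_dbar(2)[OF \<eta> y, of v], of "\<lambda>u. A (J y u)"]
    by (simp add: n_def h_def a_def lin_simps linear_add[OF linA])
  have "D v + \<i> * D (I y v) =
      (N v (J y a) + \<i> * N (I y v) (J y a) + A (h v (J y a)) + \<i> * A (h (I y v) (J y a)))
      + \<i> * (N v (J y (I y a)) + \<i> * N (I y v) (J y (I y a)) + A (h v (J y (I y a))) + \<i> * A (h (I y v) (J y (I y a))))
      + ((A (J y (n v)) - A (J y (I y (n (I y v))))) - (A (J y (h v a)) - A (J y (h (I y v) (I y a)))))
      + \<i> * ((A (J y (I y (n v))) + A (J y (n (I y v)))) - (A (J y (h v (I y a))) + A (J y (h (I y v) a))))"
    by (simp add: D_def algebra_simps)
  also have "\<dots> = 0" unfolding Ndb n1 n2 by (simp add: algebra_simps)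
  finally have "\<i> * (D v + \<i> * D (I y v)) = 0" by simp
  then show "ddir (bracket \<xi> \<eta>) y (I y v) = \<i> * ddir (bracket \<xi> \<eta>) y v"
    unfolding D by (simp add: algebra_simps)
qed

lemma bracket_commutator:
  assumes \<xi>: "holomorphic_wrt I S \<xi>" and y: "y \<in> S"
  shows "Re (bracket \<xi> \<eta> y) = g y (grad \<xi> y) (complex_structure_pair.commutator (I y) (J y) (I y (grad \<eta> y)))"
    and "Im (bracket \<xi> \<eta> y) = - g y (grad \<xi> y) (complex_structure_pair.commutator (I y) (J y) (grad \<eta> y))"
proof -
  interpret complex_structure_pair "g y" "I y" "J y" by (rule pair[OF y])
  have 1: "Re (ddir \<xi> y u) = g y (grad \<xi> y) u" for u using grad[OF \<xi> y] by simp
  have 2: "Im (ddir \<xi> y u) = - g y (grad \<xi> y) (I y u)" for u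
    using holomorphic_wrt_ddir[OF \<xi> y, of u] 1[of "I y u"] by simp
  show "Re (bracket \<xi> \<eta> y) = g y (grad \<xi> y) (commutator (I y (grad \<eta> y)))"
    "Im (bracket \<xi> \<eta> y) = - g y (grad \<xi> y) (commutator (grad \<eta> y))"
    by (simp_all add: bracket_def 1 2 commutator_def lin_simps)
qed

end

context complex_structure_pair
begin

lemma commutator_pairing_zero_on_span:
  assumes "g a (commutator b) = 0" "g a (commutator (I b)) = 0"
    and "u = p1 *\<^sub>R a + p2 *\<^sub>R I a + q1 *\<^sub>R b + q2 *\<^sub>R I b"
    and "w = r1 *\<^sub>R a + r2 *\<^sub>R I a + s1 *\<^sub>R b + s2 *\<^sub>R I b"
  shows "g (commutator u) w = 0"
proof -
  have ab: "g (commutator a) b = 0" using commutator_skew[of a b] assms(1) by simp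
  have aIb: "g (commutator a) (I b) = 0" using commutator_skew[of a "I b"] assms(2) by simp
  have ba: "g (commutator b) a = 0" using sym[of "commutator b" a] assms(1) by simp
  have bIa: "g (commutator b) (I a) = 0"
    using I_skew[of "commutator b" a] sym[of "commutator (I b)" a] assms(2) by (simp add: commutator_I lin_simps)
  have I1: "g (I (commutator v)) x = - g (commutator v) (I x)" for v x by (rule I_skew)
  show ?thesis
    unfolding assms(3,4)
    by (simp add: lin_simps comm_simps commutator_I I1 ab aIb ba bIa commutator_self)
qed

end

section \<open>The commuting locus near a point of type (2,1)\<close>

lemma continuous_on_fst_compose:
  "continuous_on S f \<Longrightarrow> continuous_on (S \<times> UNIV) (\<lambda>q. f (fst q))"
  by (rule continuous_on_compose2[OF _ continuous_on_fst[OF continuous_on_id]]) auto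

context complex_structure_pair
begin

text \<open>
The anticommutator is \<open>2\<close> on the kernel of \<open>I + J\<close> and \<open>-2\<close> on the span of \<open>v0\<close> and \<open>I v0\<close>. So these two spaces are
orthogonal, and they fill the whole space by dimension.
\<close>

lemma orthogonal_complement_of_kernel_line:
  assumes dims: "dim {v. I v + J v = 0} = 4" "DIM('e) = 6"
    and v0: "v0 \<noteq> 0" "I v0 = J v0"
  shows "g v0 v = 0 \<Longrightarrow> g (I v0) v = 0 \<Longrightarrow> I v + J v = 0" and "commutator v = 0"
proof -
  define K where "K = {v. I v + J v = 0}"
  define D where "D = span {v0, I v0}"
  have IJv0: "I (J v0) = - v0" using II[of v0] unfolding v0(2) .
  have Iv0: "I v0 \<noteq> 0"
  proof
    assume "I v0 = 0"
    then have "I (I v0) = 0" by (simp only: lin_simps)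
    then show False using v0(1) by simp
  qed
  have not_multiple: "I v0 \<noteq> c *\<^sub>R v0" for c
  proof
    assume eq: "I v0 = c *\<^sub>R v0"
    then have "c * g v0 v0 = 0" using I_self[of v0] by (simp add: lin_simps)
    then have "c = 0" using pos[OF v0(1)] by simp
    then show False using eq Iv0 by simp
  qed
  have "v0 \<notin> span {I v0}"
  proof
    assume "v0 \<in> span {I v0}"
    then obtain c where c: "v0 = c *\<^sub>R I v0" by (auto simp: span_singleton)
    have "I v0 = c *\<^sub>R I (I v0)" by (subst c) (simp only: lin_simps)
    then have "I v0 = (- c) *\<^sub>R v0" by simp
    then show False using not_multiple by blast
  qed
  moreover have ne: "v0 \<noteq> I v0" using not_multiple[of 1] by auto
  ultimately have "independent {v0, I v0}" using Iv0 by (simp add: independent_insert)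
  then have "dim D = 2" using ne unfolding D_def by (simp add: dim_eq_card_independent)
  have subK: "subspace K"
    unfolding subspace_def K_def by (auto simp: lin_simps algebra_simps simp flip: scaleR_add_right)
  have D: "\<exists>s t. u = s *\<^sub>R v0 + t *\<^sub>R I v0" if "u \<in> D" for u
    using that unfolding D_def by (auto simp: span_insert span_singleton algebra_simps)
  have "K \<inter> D \<subseteq> {0}"
  proof
    fix u assume u: "u \<in> K \<inter> D"
    then obtain s t where "u = s *\<^sub>R v0 + t *\<^sub>R I v0" using D by blast
    then have "J u = I u" by (simp add: lin_simps v0(2) IJv0)
    then have "2 *\<^sub>R I u = 0" using u by (simp add: K_def scaleR_2)
    then have "I u = 0" by simp
    then have "I (I u) = 0" by (simp only: lin_simps)
    then show "u \<in> {0}" by simp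
  qed
  moreover have "0 \<in> K \<inter> D" by (simp add: K_def lin_simps D_def span_zero)
  ultimately have "K \<inter> D = {0}" by blast
  then have dim6: "dim {x + y |x y. x \<in> K \<and> y \<in> D} = 6"
    using dim_sums_Int[OF subK subspace_span[of "{v0, I v0}"]] dims(1) \<open>dim D = 2\<close>
    by (simp add: D_def K_def)
  have "subspace {x + y |x y. x \<in> K \<and> y \<in> D}"
    unfolding D_def by (rule subspace_sums[OF subK subspace_span])
  then have "span {x + y |x y. x \<in> K \<and> y \<in> D} = {x + y |x y. x \<in> K \<and> y \<in> D}"
    by (simp only: span_eq_iff)
  moreover have "span {x + y |x y. x \<in> K \<and> y \<in> D} = UNIV"
    unfolding dim_eq_full[symmetric] dim6 dims(2) ..
  ultimately have full: "{x + y |x y. x \<in> K \<and> y \<in> D} = UNIV" by (simp only:)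
  have decomp: "\<exists>k s t. v = k + s *\<^sub>R v0 + t *\<^sub>R I v0 \<and> k \<in> K" for v
  proof -
    have "v \<in> {x + y |x y. x \<in> K \<and> y \<in> D}" unfolding full by simp
    then obtain k d where "v = k + d" "k \<in> K" "d \<in> D" by blast
    then show ?thesis using D[of d] by (metis add.assoc)
  qed
  have JK: "J k = - I k" "J (I k) = k" if "k \<in> K" for k
  proof -
    show 1: "J k = - I k" using that by (simp add: K_def eq_neg_iff_add_eq_0 add.commute)
    then have "I k = - J k" by simp
    then show "J (I k) = k" by (simp add: lin_simps)
  qed
  have Cv0: "anticommutator v0 = (-2) *\<^sub>R v0"
    by (simp add: anticommutator_def v0(2) IJv0 scaleR_2)
  have perpK: "g v0 k = 0" "g (I v0) k = 0" if "k \<in> K" for k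
  proof -
    have Ck: "anticommutator k = 2 *\<^sub>R k"
      using JK[OF that] by (simp add: anticommutator_def lin_simps scaleR_2)
    show "g v0 k = 0" using anticommutator_sym[of v0 k] by (simp add: Cv0 Ck lin_simps)
    show "g (I v0) k = 0"
      using anticommutator_sym[of "I v0" k] by (simp add: anticommutator_I Cv0 Ck lin_simps)
  qed
  show "I v + J v = 0" if perp: "g v0 v = 0" "g (I v0) v = 0"
  proof -
    obtain k s t where v: "v = k + s *\<^sub>R v0 + t *\<^sub>R I v0" and k: "k \<in> K" using decomp by blast
    have "s * g v0 v0 = 0" using perp(1) perpK[OF k] by (simp add: v lin_simps)
    then have s: "s = 0" using pos[OF v0(1)] by simp
    have "t * g v0 v0 = 0" using perp(2) perpK[OF k] by (simp add: v lin_simps s)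
    then have "t = 0" using pos[OF v0(1)] by simp
    then show ?thesis using v s k by (simp add: K_def)
  qed
  obtain k s t where v: "v = k + s *\<^sub>R v0 + t *\<^sub>R I v0" and k: "k \<in> K" using decomp by blast
  have "commutator k = 0" using JK[OF k] by (simp add: commutator_def lin_simps)
  moreover have "commutator v0 = 0" by (simp add: commutator_def v0(2) IJv0)
  ultimately show "commutator v = 0" by (simp add: v comm_simps commutator_I lin_simps)
qed

end

context bihermitian_patch
begin

lemma continuous_form:
  assumes "continuous_on T p" "p ` T \<subseteq> S" "continuous_on T u" "continuous_on T w"
  shows "continuous_on T (\<lambda>q. g (p q) (u q) (w q))"
  by (rule continuous_on_apply_form[where g = g and p = p, OF _ _ assms(3,4)])
    (use assms(2) in \<open>auto intro!: form continuous_on_compose2[OF smooth_on_continuous[OF sm_g] assms(1,2)]\<close>)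

lemma continuous_I:
  assumes "continuous_on T p" "p ` T \<subseteq> S" "continuous_on T u"
  shows "continuous_on T (\<lambda>q. I (p q) (u q))"
  by (rule continuous_on_apply_field[where T = I and p = p, OF _ _ assms(3)])
    (use assms(2) in \<open>auto intro!: linI continuous_on_compose2[OF smooth_on_continuous[OF sm_I] assms(1,2)]\<close>)

lemma continuous_J:
  assumes "continuous_on T p" "p ` T \<subseteq> S" "continuous_on T u"
  shows "continuous_on T (\<lambda>q. J (p q) (u q))"
  by (rule continuous_on_apply_field[where T = J and p = p, OF _ _ assms(3)])
    (use assms(2) in \<open>auto intro!: linJ continuous_on_compose2[OF smooth_on_continuous[OF sm_J] assms(1,2)]\<close>)

text \<open>
At \<open>y0\<close> the anticommutator is \<open>-2\<close> on the span of \<open>x\<close> and \<open>I x\<close> and \<open>2\<close> on its orthogonal complement. The signs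
persist nearby by compactness of the unit sphere. The complement varies with \<open>y\<close>; the tube lemma
is therefore applied to the open set of all \<open>(y, v)\<close> such that the form is positive at \<open>v\<close> or \<open>v\<close> is not in
the complement.
\<close>

lemma definite_near_type_point:
  assumes y0: "y0 \<in> S" and x: "continuous_on S x"
    and dims: "dim {v. I y0 v + J y0 v = 0} = 4" "DIM('e) = 6"
    and x0: "x y0 \<noteq> 0" "I y0 (x y0) = J y0 (x y0)"
  obtains U where "open U" "y0 \<in> U" "U \<subseteq> S"
    "\<And>y. y \<in> U \<Longrightarrow> g y (complex_structure_pair.anticommutator (I y) (J y) (x y)) (x y) < 0"
    "\<And>y v. \<lbrakk>y \<in> U; g y (x y) v = 0; g y (I y (x y)) v = 0; v \<noteq> 0\<rbrakk> \<Longrightarrow>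
        g y (complex_structure_pair.anticommutator (I y) (J y) v) v > 0"
proof -
  define C where "C y v = I y (J y v) + J y (I y v)" for y v
  have C: "complex_structure_pair.anticommutator (I y) (J y) = C y" if "y \<in> S" for y
    using complex_structure_pair.anticommutator_def[OF pair[OF that]] by (auto simp: C_def)
  have contC: "continuous_on T (\<lambda>q. g (p q) (C (p q) (u q)) (u q))"
    if "continuous_on T p" "p ` T \<subseteq> S" "continuous_on T u" for T :: "'q::topological_space set" and p u
    unfolding C_def
    by (rule continuous_form[OF that(1,2) continuous_on_add[OF
            continuous_I[OF that(1,2) continuous_J[OF that]] continuous_J[OF that(1,2) continuous_I[OF that]]] that(3)])
  interpret p0: complex_structure_pair "g y0" "I y0" "J y0" by (rule pair[OF y0])
  have contneg: "continuous_on S (\<lambda>y. g y (C y (x y)) (x y))"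
    by (rule contC[OF continuous_on_id _ x]) simp
  define U1 where "U1 = S \<inter> (\<lambda>y. g y (C y (x y)) (x y)) -` {..<0}"
  have U1: "open U1" unfolding U1_def by (rule continuous_open_preimage[OF contneg S]) simp
  have "C y0 (x y0) = - x y0 - x y0"
    unfolding C_def using p0.JJ[of "x y0"] p0.II[of "x y0"] by (simp add: x0(2))
  then have "g y0 (C y0 (x y0)) (x y0) = - 2 * g y0 (x y0) (x y0)" by (simp add: p0.lin_simps)
  then have y0U1: "y0 \<in> U1" using p0.pos[OF x0(1)] y0 by (simp add: U1_def)
  let ?T = "S \<times> (UNIV :: 'e set)"
  have fst: "continuous_on ?T fst" "fst ` ?T \<subseteq> S" by (auto intro: continuous_on_fst continuous_on_id)
  have snd: "continuous_on ?T snd" by (intro continuous_on_snd continuous_on_id)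
  note xf = continuous_on_fst_compose[OF x]
  define W1 where "W1 = ?T \<inter> (\<lambda>q. g (fst q) (C (fst q) (snd q)) (snd q)) -` {0<..}"
  define W2 where "W2 = ?T \<inter> (\<lambda>q. g (fst q) (x (fst q)) (snd q)) -` (- {0})"
  define W3 where "W3 = ?T \<inter> (\<lambda>q. g (fst q) (I (fst q) (x (fst q))) (snd q)) -` (- {0})"
  have opT: "open ?T" by (intro open_Times S open_UNIV)
  have "open W1" unfolding W1_def
    by (rule continuous_open_preimage[OF contC[OF fst snd] opT]) simp
  moreover have "open W2" unfolding W2_def
    by (rule continuous_open_preimage[OF continuous_form[OF fst xf snd] opT]) (rule open_Compl[OF closed_singleton])
  moreover have "open W3" unfolding W3_def
    by (rule continuous_open_preimage[OF continuous_form[OF fst continuous_I[OF fst xf] snd] opT]) (rule open_Compl[OF closed_singleton])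
  ultimately have W: "open (W1 \<union> W2 \<union> W3)" by (intro open_Un)
  have "{y0} \<times> sphere 0 1 \<subseteq> W1 \<union> W2 \<union> W3"
  proof
    fix q assume "q \<in> {y0} \<times> sphere (0::'e) 1"
    then obtain v where v: "q = (y0, v)" "v \<in> sphere 0 1" by blast
    then have q: "q = (y0, v)" "v \<noteq> 0" by auto
    show "q \<in> W1 \<union> W2 \<union> W3"
    proof (cases "g y0 (x y0) v = 0 \<and> g y0 (I y0 (x y0)) v = 0")
      case True
      then have "I y0 v + J y0 v = 0"
        using p0.orthogonal_complement_of_kernel_line(1)[OF dims x0] by blast
      then have Jv: "J y0 v = - I y0 v" by (simp add: eq_neg_iff_add_eq_0 add.commute)
      then have "I y0 v = - J y0 v" by simp
      then have "J y0 (I y0 v) = v" by (simp add: p0.lin_simps)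
      then have "C y0 v = v + v" by (simp add: C_def Jv p0.lin_simps)
      then have "g y0 (C y0 v) v > 0" using p0.pos[OF q(2)] by (simp add: p0.lin_simps)
      then show ?thesis using y0 by (simp add: W1_def q(1))
    next
      case False
      then show ?thesis using y0 by (auto simp: W2_def W3_def q(1))
    qed
  qed
  from Elementary_Topology.tube_lemma[OF compact_sphere W this]
  obtain X where X: "y0 \<in> X" "open X" "X \<times> sphere 0 1 \<subseteq> W1 \<union> W2 \<union> W3" by blast
  show ?thesis
  proof (rule that[of "U1 \<inter> X"])
    show "open (U1 \<inter> X)" "y0 \<in> U1 \<inter> X" using U1 X y0U1 by auto
    show "U1 \<inter> X \<subseteq> S" by (auto simp: U1_def)
    show "g y (complex_structure_pair.anticommutator (I y) (J y) (x y)) (x y) < 0" if "y \<in> U1 \<inter> X" for y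
      using that C[of y] by (auto simp: U1_def)
    fix y v assume y: "y \<in> U1 \<inter> X" and perp: "g y (x y) v = 0" "g y (I y (x y)) v = 0" and v: "v \<noteq> 0"
    have yS: "y \<in> S" using y by (auto simp: U1_def)
    interpret py: complex_structure_pair "g y" "I y" "J y" by (rule pair[OF yS])
    define n where "n = (1 / norm v) *\<^sub>R v"
    have "n \<in> sphere 0 1" using v by (simp add: n_def)
    then have "(y, n) \<in> X \<times> sphere 0 1" using y by blast
    then have "(y, n) \<in> W1 \<union> W2 \<union> W3" using X(3) by blast
    moreover have "(y, n) \<notin> W2" "(y, n) \<notin> W3"
      using perp by (simp_all add: W2_def W3_def n_def py.lin_simps)
    ultimately have "g y (C y n) n > 0" by (simp add: W1_def)
    moreover have "g y (C y n) n = (1 / norm v) * ((1 / norm v) * g y (C y v) v)"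
      by (simp add: C_def n_def py.lin_simps algebra_simps add_divide_distrib)
    ultimately have "g y (C y v) v > 0" using v by (simp add: zero_less_mult_iff zero_less_divide_iff)
    then show "g y (complex_structure_pair.anticommutator (I y) (J y) v) v > 0" using C[OF yS] by simp
  qed
qed

text \<open>
The gradient of \<open>c * \<xi>\<close> is the conjugate of \<open>c\<close> times the gradient of \<open>\<xi>\<close>, with \<open>I\<close> as the imaginary unit.
\<close>

lemma grad_combination:
  assumes \<xi>: "holomorphic_wrt I S \<xi>" and y: "y \<in> S"
  shows "Re (c * ddir \<xi> y v) = g y (Re c *\<^sub>R grad \<xi> y - Im c *\<^sub>R I y (grad \<xi> y)) v"
proof -
  interpret complex_structure_pair "g y" "I y" "J y" by (rule pair[OF y])
  have "Im (ddir \<xi> y v) = - Re (ddir \<xi> y (I y v))" by (simp add: holomorphic_wrt_ddir[OF \<xi> y])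
  also have "\<dots> = g y (I y (grad \<xi> y)) v" by (simp add: grad[OF \<xi> y, symmetric] I_skew)
  finally have "Im (ddir \<xi> y v) = g y (I y (grad \<xi> y)) v" .
  then show ?thesis by (simp add: lin_simps grad[OF \<xi> y])
qed

text \<open>
The vector \<open>d\<close> is the image of \<open>v0\<close> in the holomorphic coordinates \<open>z\<close>, and \<open>\<xi> j\<close> and \<open>\<xi> k\<close> are two independent linear
functions of \<open>z\<close> that vanish on \<open>d\<close>. The vector field \<open>x\<close> with constant image \<open>d\<close> extends \<open>v0\<close>. In complex dimension
three the orthogonal complement of \<open>x\<close> and \<open>I x\<close> is spanned over \<open>I\<close> by the gradients of \<open>\<xi> j\<close> and \<open>\<xi> k\<close>. So the
vanishing of their bracket says that the commutator pairs this complement trivially with itself, and near a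
point of type (2,1) this forces the commutator to vanish.
\<close>

theorem commuting_locus_locally_zero_set:
  fixes z :: "'e \<Rightarrow> complex^'n" and Z' :: "'e \<Rightarrow> complex^'n \<Rightarrow> 'e"
  assumes n3: "CARD('n) = 3" "DIM('e) = 6" and y0: "y0 \<in> S"
    and z: "smooth_on S z" "\<And>y v. y \<in> S \<Longrightarrow> ddir z y (I y v) = \<i> *s ddir z y v"
    and Z': "\<And>y v. y \<in> S \<Longrightarrow> Z' y (ddir z y v) = v" "\<And>y w. y \<in> S \<Longrightarrow> ddir z y (Z' y w) = w"
      "\<And>w. continuous_on S (\<lambda>y. Z' y w)"
    and dims: "dim {v. I y0 v + J y0 v = 0} = 4"
    and v0: "v0 \<noteq> 0" "I y0 v0 = J y0 v0"
  obtains F U where "holomorphic_wrt I S F" "open U" "y0 \<in> U" "U \<subseteq> S" "F y0 = 0"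
    "\<And>y. y \<in> U \<Longrightarrow> F y = 0 \<longleftrightarrow> (\<forall>v. I y (J y v) = J y (I y v))"
proof -
  have diff_z: "z differentiable (at y)" if "y \<in> S" for y
    by (rule smooth_on_differentiable[OF z(1) that])
  have linZ: "linear (ddir z y)" if "y \<in> S" for y by (rule linear_ddir[OF diff_z[OF that]])
  define d where "d = ddir z y0 v0"
  have "d \<noteq> 0"
  proof
    assume "d = 0"
    then have "Z' y0 (ddir z y0 v0) = Z' y0 (ddir z y0 0)" by (simp add: d_def linear_0[OF linZ[OF y0]])
    then show False using v0(1) by (simp add: Z'(1)[OF y0])
  qed
  then obtain i where i: "d $ i \<noteq> 0" by (auto simp: vec_eq_iff)
  have "card (UNIV - {i}) = 2" using n3(1) by simp
  then obtain j k where jk: "UNIV - {i} = {j, k}" "j \<noteq> k" unfolding card_2_iff by blast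
  then have ijk: "i \<noteq> j" "i \<noteq> k" and all: "l = i \<or> l = j \<or> l = k" for l by auto
  \<comment> \<open>the linear functions \<open>lam l\<close> vanish on \<open>d\<close>, and \<open>lam j\<close>, \<open>lam k\<close> cut out the line spanned by \<open>d\<close>\<close>
  define lam where "lam l w = w $ l - d $ l / d $ i * w $ i" for l and w :: "complex^'n"
  have bl: "bounded_linear (lam l)" for l
    unfolding lam_def by (intro bounded_linear_sub bounded_linear_vec_nth
        bounded_linear_compose[OF bounded_linear_mult_right bounded_linear_vec_nth])
  have lam_smult: "lam l (c *s w) = c * lam l w" for l c w by (simp add: lam_def algebra_simps)
  define \<xi> where "\<xi> l y = lam l (z y)" for l y
  have d\<xi>: "ddir (\<xi> l) y v = lam l (ddir z y v)" if "y \<in> S" for l y v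
    unfolding \<xi>_def
    by (rule ddir_eqI[OF bounded_linear.has_derivative[OF bl ddir_has_derivative[OF diff_z[OF that]]]])
  have \<xi>: "holomorphic_wrt I S (\<xi> l)" for l
    unfolding holomorphic_wrt_def
  proof (intro conjI ballI allI)
    show "smooth_on S (\<xi> l)" unfolding \<xi>_def by (rule smooth_on_linear_compose[OF bl z(1) S])
    show "ddir (\<xi> l) y (I y v) = \<i> * ddir (\<xi> l) y v" if "y \<in> S" for y v
      by (simp add: d\<xi>[OF that] z(2)[OF that] lam_smult)
  qed
  define x where "x y = Z' y d" for y
  have contx: "continuous_on S x" unfolding x_def by (rule Z'(3))
  have x0: "x y0 = v0" by (simp add: x_def d_def Z'(1)[OF y0])
  obtain U where U: "open U" "y0 \<in> U" "U \<subseteq> S"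
    and neg: "\<And>y. y \<in> U \<Longrightarrow> g y (complex_structure_pair.anticommutator (I y) (J y) (x y)) (x y) < 0"
    and posv: "\<And>y v. \<lbrakk>y \<in> U; g y (x y) v = 0; g y (I y (x y)) v = 0; v \<noteq> 0\<rbrakk> \<Longrightarrow>
        g y (complex_structure_pair.anticommutator (I y) (J y) v) v > 0"
    by (rule definite_near_type_point[OF y0 contx dims n3(2)]) (use v0 in \<open>simp_all add: x0\<close>)
  have span: "\<exists>p1 p2 q1 q2. u = p1 *\<^sub>R grad (\<xi> j) y + p2 *\<^sub>R I y (grad (\<xi> j) y)
      + q1 *\<^sub>R grad (\<xi> k) y + q2 *\<^sub>R I y (grad (\<xi> k) y)"
    if y: "y \<in> S" and perp: "g y (x y) u = 0" "g y (I y (x y)) u = 0" for y u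
  proof -
    interpret complex_structure_pair "g y" "I y" "J y" by (rule pair[OF y])
    define E where "E l = Z' y (axis l 1)" for l
    have perp': "g y u (x y) = 0" "g y u (I y (x y)) = 0" using perp by (simp_all add: sym[of u])
    define c where "c l = Complex (g y u (E l)) (- g y u (I y (E l)))" for l
    define sm where "sm a v = Re a *\<^sub>R v + Im a *\<^sub>R I y v" for a v
    have Zsm: "ddir z y (sm a v) = a *s ddir z y v" for a v
      unfolding sm_def smult_eq_scaleR[of a]
      by (simp add: linear_add[OF linZ[OF y]] linear_scale[OF linZ[OF y]] z(2)[OF y])
    have "g y u v = Re (c j * ddir (\<xi> j) y v) + Re (c k * ddir (\<xi> k) y v)" for v
    proof -
      define w where "w = ddir z y v"
      have "ddir z y (sm (w $ i / d $ i) (x y) + sm (lam j w) (E j) + sm (lam k w) (E k))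
          = (w $ i / d $ i) *s d + lam j w *s axis j 1 + lam k w *s axis k 1"
        by (simp add: linear_add[OF linZ[OF y]] Zsm x_def E_def Z'(2)[OF y])
      also have "\<dots> = w"
      proof (rule vec_eq_iff[THEN iffD2, rule_format])
        fix l
        show "((w $ i / d $ i) *s d + lam j w *s axis j 1 + lam k w *s axis k 1) $ l = w $ l"
          using all[of l] ijk jk(2) i by (auto simp: axis_def lam_def)
      qed
      finally have "Z' y (ddir z y v) = sm (w $ i / d $ i) (x y) + sm (lam j w) (E j) + sm (lam k w) (E k)"
        using Z'(1)[OF y, of "sm (w $ i / d $ i) (x y) + sm (lam j w) (E j) + sm (lam k w) (E k)"]
        by (simp add: w_def)
      then have v: "v = sm (w $ i / d $ i) (x y) + sm (lam j w) (E j) + sm (lam k w) (E k)"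
        by (simp only: Z'(1)[OF y])
      have gx: "g y u (sm a (x y)) = 0" for a by (simp add: sm_def lin_simps perp')
      have gE: "g y u (sm a (E l)) = Re (c l * a)" for a l by (simp add: sm_def lin_simps c_def)
      show ?thesis unfolding d\<xi>[OF y] w_def[symmetric]
        by (subst v) (simp only: lin_simps gx gE add_0_left)
    qed
    then have "g y u v = g y ((Re (c j) *\<^sub>R grad (\<xi> j) y - Im (c j) *\<^sub>R I y (grad (\<xi> j) y))
        + (Re (c k) *\<^sub>R grad (\<xi> k) y - Im (c k) *\<^sub>R I y (grad (\<xi> k) y))) v" for v
      by (simp only: grad_combination[OF \<xi> y] lin_simps)
    then have "u = (Re (c j) *\<^sub>R grad (\<xi> j) y - Im (c j) *\<^sub>R I y (grad (\<xi> j) y))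
        + (Re (c k) *\<^sub>R grad (\<xi> k) y - Im (c k) *\<^sub>R I y (grad (\<xi> k) y))"
      by (rule inner_product_form_eqI[OF form])
    then show ?thesis
      by (intro exI[of _ "Re (c j)"] exI[of _ "- Im (c j)"] exI[of _ "Re (c k)"] exI[of _ "- Im (c k)"])
        (simp add: algebra_simps)
  qed
  define F where "F = bracket (\<xi> j) (\<xi> k)"
  have iff: "F y = 0 \<longleftrightarrow> (\<forall>v. I y (J y v) = J y (I y v))" if y: "y \<in> U" for y
  proof -
    have yS: "y \<in> S" using y U(3) by blast
    interpret complex_structure_pair "g y" "I y" "J y" by (rule pair[OF yS])
    note br = bracket_commutator[OF \<xi> yS, of j "\<xi> k"]
    have "F y = 0 \<longleftrightarrow> (\<forall>v. commutator v = 0)"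
    proof
      assume "\<forall>v. commutator v = 0"
      then show "F y = 0" using br by (simp add: F_def complex_eq_iff lin_simps)
    next
      assume "F y = 0"
      then have "Re (F y) = 0" "Im (F y) = 0" by simp_all
      then have F0: "g y (grad (\<xi> j) y) (commutator (grad (\<xi> k) y)) = 0"
        "g y (grad (\<xi> j) y) (commutator (I y (grad (\<xi> k) y))) = 0"
        unfolding F_def br by simp_all
      have "commutator v = 0" for v
      proof (rule commute_if_commutator_pairing_zero[OF neg[OF y]])
        show "g y (anticommutator v) v > 0" if "g y (x y) v = 0" "g y (I y (x y)) v = 0" "v \<noteq> 0" for v
          by (rule posv[OF y that])
        show "g y (commutator u) w = 0"
          if "g y (x y) u = 0" "g y (I y (x y)) u = 0" "g y (x y) w = 0" "g y (I y (x y)) w = 0" for u w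
          using span[OF yS that(1,2)] span[OF yS that(3,4)] commutator_pairing_zero_on_span[OF F0] by blast
      qed
      then show "\<forall>v. commutator v = 0" by blast
    qed
    then show ?thesis by (simp add: commutator_def)
  qed
  have "F y0 = 0"
  proof -
    interpret complex_structure_pair "g y0" "I y0" "J y0" by (rule pair[OF y0])
    have "commutator v = 0" for v
      by (rule orthogonal_complement_of_kernel_line(2)[OF dims n3(2) v0])
    then show ?thesis using iff[OF U(2)] by (simp add: commutator_def)
  qed
  then show ?thesis
    using that[of F U] bracket_holomorphic[OF \<xi> \<xi>] U iff by (simp add: F_def)
qed

end

section \<open>Charts\<close>

lemma chart_inj: "is_chart X c \<Longrightarrow> inj_on (coord c) (cdom c)"
  unfolding is_chart_def homeomorphic_map_def
  using openin_subset[of X "cdom c"] by (auto simp: Int_absorb1)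

lemma chart_open_image:
  assumes c: "is_chart X c" and T: "openin X T" "T \<subseteq> cdom c"
  shows "open (coord c ` T)"
proof -
  have "openin (subtopology X (cdom c)) T"
    using T by (auto simp: openin_subtopology)
  then have "openin (top_of_set (crange c)) (coord c ` T)"
    using c homeomorphic_imp_open_map unfolding is_chart_def open_map_def by blast
  then show ?thesis using c by (simp add: is_chart_def openin_open_eq)
qed

lemma chart_open_preimage:
  assumes c: "is_chart X c" and V: "open V" "V \<subseteq> crange c"
  shows "openin X (cdom c \<inter> coord c -` V)"
proof -
  have "continuous_map (subtopology X (cdom c)) (top_of_set (crange c)) (coord c)"
    using c homeomorphic_imp_continuous_map unfolding is_chart_def by blast
  then have "continuous_map (subtopology X (cdom c)) euclidean (coord c)"
    by (simp add: continuous_map_in_subtopology)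
  moreover have "openin euclidean V" using V(1) by (simp only: open_openin)
  ultimately have "openin (subtopology X (cdom c)) {x \<in> topspace (subtopology X (cdom c)). coord c x \<in> V}"
    by (rule openin_continuous_map_preimage)
  moreover have "{x \<in> topspace (subtopology X (cdom c)). coord c x \<in> V} = cdom c \<inter> coord c -` V"
    using c openin_subset[of X "cdom c"] by (auto simp: is_chart_def)
  ultimately show ?thesis
    using c by (auto simp: is_chart_def openin_open_subtopology)
qed

lemma overlap_open: "is_chart X c \<Longrightarrow> is_chart X d \<Longrightarrow> open (overlap c d)"
  unfolding overlap_def by (rule chart_open_image) (auto simp: is_chart_def)

lemma overlap_subset: "overlap c d \<subseteq> crange c"
  by (auto simp: overlap_def crange_def)

lemma transition_coord: "is_chart X c \<Longrightarrow> q \<in> cdom c \<Longrightarrow> transition c d (coord c q) = coord d q"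
  by (simp add: transition_def inv_into_f_f[OF chart_inj])

lemma overlapI: "q \<in> cdom c \<Longrightarrow> q \<in> cdom d \<Longrightarrow> coord c q \<in> overlap c d"
  by (auto simp: overlap_def)

lemma overlapE:
  assumes "y \<in> overlap c d" obtains q where "q \<in> cdom c" "q \<in> cdom d" "y = coord c q"
  using assms by (auto simp: overlap_def)

lemma transition_in_overlap: "is_chart X c \<Longrightarrow> y \<in> overlap c d \<Longrightarrow> transition c d y \<in> overlap d c"
  by (auto elim!: overlapE simp: transition_coord intro: overlapI)

lemma transition_inverse:
  assumes "is_chart X c" "is_chart X d" "y \<in> overlap c d"
  shows "transition d c (transition c d y) = y"
  using assms(3) by (rule overlapE) (simp add: transition_coord[OF assms(1)] transition_coord[OF assms(2)])

lemma transition_deriv_inverse: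
  assumes c: "is_chart X c" and d: "is_chart X d" and cd: "smooth_compatible c d" and y: "y \<in> overlap c d"
  shows "transition_deriv d c (transition c d y) (transition_deriv c d y v) = v"
proof -
  note y' = transition_in_overlap[OF c y]
  have "((\<lambda>y. transition d c (transition c d y)) has_derivative
      (\<lambda>v. ddir (transition d c) (transition c d y) (ddir (transition c d) y v))) (at y)"
    using cd y y' unfolding smooth_compatible_def
    by (intro has_derivative_compose[where g = "transition d c" and f = "transition c d"] ddir_has_derivative)
      (auto intro: smooth_on_differentiable)
  then have "ddir (\<lambda>y. transition d c (transition c d y)) y v
      = transition_deriv d c (transition c d y) (transition_deriv c d y v)"
    unfolding transition_deriv_def by (rule ddir_eqI)
  moreover have "ddir (\<lambda>y. transition d c (transition c d y)) y v = ddir (\<lambda>y. y) y v"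
    by (rule ddir_cong_open[OF overlap_open[OF c d] y transition_inverse[OF c d]])
  ultimately show ?thesis by simp
qed

text \<open>
A change of coordinates that flattens a given subset thereby produces a chart adapted to that subset, as
regular points require.
\<close>

lemma holomorphic_chart_postcompose:
  fixes \<Phi> :: "complex^'n \<Rightarrow> complex^'n"
  assumes A: "\<And>c. c \<in> A \<Longrightarrow> is_chart X c" and h: "holomorphic_chart X A J h"
    and V: "open V" "V \<subseteq> crange h" and W: "open W" and hom: "homeomorphism V W \<Phi> \<Psi>"
    and sm: "smooth_on V \<Phi>" "smooth_on W \<Psi>"
    and cl: "\<And>z v. z \<in> V \<Longrightarrow> ddir \<Phi> z (\<i> *s v) = \<i> *s ddir \<Phi> z v"
  defines "h' \<equiv> (cdom h \<inter> coord h -` V, \<Phi> \<circ> coord h)"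
  shows "holomorphic_chart X A J h'" and "crange h' = W"
proof -
  have ch: "is_chart X h" using h by (simp add: holomorphic_chart_def)
  have dom: "cdom h' = cdom h \<inter> coord h -` V" and co: "coord h' = \<Phi> \<circ> coord h" by (simp_all add: h'_def)
  have imV: "coord h ` cdom h' = V" using V(2) by (auto simp: dom crange_def)
  have VW: "\<Phi> ` V = W" "\<Psi> ` W = V" "\<And>x. x \<in> V \<Longrightarrow> \<Psi> (\<Phi> x) = x" "\<And>y. y \<in> W \<Longrightarrow> \<Phi> (\<Psi> y) = y"
    using hom by (auto simp: homeomorphism_def)
  show range: "crange h' = W" unfolding crange_def co image_comp[symmetric] imV by (rule VW)
  have hX: "topspace X \<inter> cdom h = cdom h" using ch openin_subset by (auto simp: is_chart_def)
  have op: "openin X (cdom h')" unfolding dom by (rule chart_open_preimage[OF ch V])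
  have "homeomorphic_map (subtopology X (cdom h)) (top_of_set (crange h)) (coord h)"
    using ch by (simp add: is_chart_def)
  then have "homeomorphic_map (subtopology (subtopology X (cdom h)) (cdom h')) (subtopology (top_of_set (crange h)) V) (coord h)"
  proof (rule homeomorphic_map_subtopologies)
    have "topspace (subtopology X (cdom h)) \<inter> cdom h' = cdom h'" using hX by (auto simp: dom)
    moreover have "topspace (top_of_set (crange h)) \<inter> V = V" using V(2) by auto
    ultimately show "coord h ` (topspace (subtopology X (cdom h)) \<inter> cdom h') = topspace (top_of_set (crange h)) \<inter> V"
      using imV by simp
  qed
  moreover have "cdom h \<inter> cdom h' = cdom h'" "crange h \<inter> V = V" using V(2) by (auto simp: dom)
  ultimately have h1: "homeomorphic_map (subtopology X (cdom h')) (top_of_set V) (coord h)"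
    by (simp add: subtopology_subtopology)
  have "homeomorphic_maps (top_of_set V) (top_of_set W) \<Phi> \<Psi>"
    using hom by (auto simp: homeomorphic_maps_def homeomorphism_def)
  then have "homeomorphic_map (top_of_set V) (top_of_set W) \<Phi>" by (rule homeomorphic_maps_imp_map)
  from homeomorphic_map_compose[OF h1 this]
  have ch': "is_chart X h'" unfolding is_chart_def range using op W by (simp add: co)
  have tr: "transition c h' y = \<Phi> (transition c h y)" for c y by (simp add: transition_def co)
  show "holomorphic_chart X A J h'"
    unfolding holomorphic_chart_def
  proof (intro conjI ballI allI)
    show "is_chart X h'" by (rule ch')
  next
    fix c assume cA: "c \<in> A"
    note c = A[OF cA]
    have comp: "smooth_compatible c h" using h cA by (simp add: holomorphic_chart_def)
    have sub: "overlap c h' \<subseteq> overlap c h" by (auto simp: overlap_def dom)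
    have into: "transition c h y \<in> V" if "y \<in> overlap c h'" for y
      using that by (rule overlapE) (simp add: transition_coord[OF c] dom)
    show "smooth_compatible c h'"
      unfolding smooth_compatible_def
    proof
      have "smooth_on (overlap c h') (transition c h)"
        using comp smooth_on_subset[OF _ sub, of "transition c h"] by (simp add: smooth_compatible_def)
      then have "smooth_on (overlap c h') (\<lambda>y. \<Phi> (transition c h y))"
        by (rule smooth_on_compose[OF sm(1)]) (use into overlap_open[OF c ch'] V(1) in auto)
      then show "smooth_on (overlap c h') (transition c h')" unfolding tr[abs_def] .
    next
      have pull: "\<Psi> w \<in> overlap h c \<and> transition h c (\<Psi> w) = transition h' c w" if "w \<in> overlap h' c" for w
        using that
      proof (rule overlapE)
        fix q assume q: "q \<in> cdom h'" "q \<in> cdom c" "w = coord h' q"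
        have "\<Psi> w = coord h q" using q VW(3) by (simp add: co dom)
        then show ?thesis
          using q transition_coord[OF ch, of q c] transition_coord[OF ch' q(1), of c] by (auto simp: dom intro: overlapI)
      qed
      have "overlap h' c \<subseteq> W" using overlap_subset[of h' c] range by simp
      then have "smooth_on (overlap h' c) \<Psi>" by (rule smooth_on_subset[OF sm(2)])
      then have "smooth_on (overlap h' c) (\<lambda>w. transition h c (\<Psi> w))"
        by (rule smooth_on_compose[where f = "transition h c" and T = "overlap h c", rotated])
          (use comp pull overlap_open[OF ch' c] overlap_open[OF ch c] in \<open>auto simp: smooth_compatible_def\<close>)
      then show "smooth_on (overlap h' c) (transition h' c)"
        by (rule smooth_on_cong[OF overlap_open[OF ch' c], rotated]) (use pull in blast)
    qed
    fix y v assume y: "y \<in> overlap c h'"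
    have yh: "y \<in> overlap c h" using y sub by blast
    have "((\<lambda>y. \<Phi> (transition c h y)) has_derivative
        (\<lambda>v. ddir \<Phi> (transition c h y) (ddir (transition c h) y v))) (at y)"
      using comp yh into[OF y] sm(1) unfolding smooth_compatible_def
      by (intro has_derivative_compose[where g = \<Phi> and f = "transition c h"] ddir_has_derivative)
        (auto intro: smooth_on_differentiable)
    then have D: "transition_deriv c h' y v = ddir \<Phi> (transition c h y) (transition_deriv c h y v)" for v
      unfolding transition_deriv_def tr[abs_def] by (rule ddir_eqI)
    have "transition_deriv c h y (J c y v) = \<i> *s transition_deriv c h y v"
      using h cA yh by (simp add: holomorphic_chart_def)
    then show "transition_deriv c h' y (J c y v) = \<i> *s transition_deriv c h' y v"
      unfolding D by (simp add: cl[OF into[OF y]])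
  qed
qed

text \<open>
By the transformation law it is enough to test commutation in a single chart.
\<close>

lemma commuting_locus_iff:
  assumes M: "smooth_manifold X A" and J: "endomorphism_field A Jp" "endomorphism_field A Jm"
    and c: "c \<in> A" and q: "q \<in> cdom c"
  shows "q \<in> commuting_locus X A Jp Jm \<longleftrightarrow>
    (\<forall>v. Jp c (coord c q) (Jm c (coord c q) v) = Jm c (coord c q) (Jp c (coord c q) v))"
proof
  assume "q \<in> commuting_locus X A Jp Jm"
  then show "\<forall>v. Jp c (coord c q) (Jm c (coord c q) v) = Jm c (coord c q) (Jp c (coord c q) v)"
    using c q by (simp add: commuting_locus_def)
next
  assume comm: "\<forall>v. Jp c (coord c q) (Jm c (coord c q) v) = Jm c (coord c q) (Jp c (coord c q) v)"
  have chart: "is_chart X d" if "d \<in> A" for d using M that by (simp add: smooth_manifold_def)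
  have "q \<in> topspace X" using M c q by (auto simp: smooth_manifold_def)
  moreover have "Jp d (coord d q) (Jm d (coord d q) v) = Jm d (coord d q) (Jp d (coord d q) v)"
    if d: "d \<in> A" "q \<in> cdom d" for d v
  proof -
    let ?y = "coord c q"
    have y: "?y \<in> overlap c d" by (rule overlapI[OF q d(2)])
    have t: "transition c d ?y = coord d q" by (rule transition_coord[OF chart[OF c] q])
    have "smooth_compatible d c" using M c d(1) by (simp add: smooth_manifold_def)
    from transition_deriv_inverse[OF chart[OF d(1)] chart[OF c] this transition_in_overlap[OF chart[OF c] y], of v]
    obtain u where u: "v = transition_deriv c d ?y u"
      by (simp add: transition_inverse[OF chart[OF c] chart[OF d(1)] y]) metis
    have Jp: "Jp d (coord d q) (transition_deriv c d ?y w) = transition_deriv c d ?y (Jp c ?y w)" for w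
      using J(1) c d(1) y t unfolding endomorphism_field_def by metis
    have Jm: "Jm d (coord d q) (transition_deriv c d ?y w) = transition_deriv c d ?y (Jm c ?y w)" for w
      using J(2) c d(1) y t unfolding endomorphism_field_def by metis
    show ?thesis unfolding u Jp Jm using comm by simp
  qed
  ultimately show "q \<in> commuting_locus X A Jp Jm" by (simp add: commuting_locus_def)
qed

section \<open>Emptiness of the strata\<close>

text \<open>
The connections satisfy \<open>\<nabla>\<^sup>-\<^sub>v w = \<nabla>\<^sup>+\<^sub>w v\<close> on constant coordinate fields, because \<open>H\<close> is alternating and the
Levi-Civita connection is symmetric. Both connections preserve \<open>g\<close> since \<open>g\<^sup>-\<^sup>1H(v, \<cdot>)\<close> is skew.
\<close>

lemma chart_patch:
  assumes g: "riemannian_metric A g" and Jp: "endomorphism_field A Jp" and Jm: "endomorphism_field A Jm"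
    and sq: "\<forall>c\<in>A. \<forall>y\<in>crange c. \<forall>v. Jp c y (Jp c y v) = - v" "\<forall>c\<in>A. \<forall>y\<in>crange c. \<forall>v. Jm c y (Jm c y v) = - v"
    and orth: "orthogonal_field A g Jp" "orthogonal_field A g Jm"
    and lc: "levi_civita A g \<Gamma>" and H: "three_form A H"
    and par: "parallel A (add_torsion g \<Gamma> (1/2) H) Jp" "parallel A (add_torsion g \<Gamma> (-1/2) H) Jm"
    and c: "c \<in> A" and S: "open S" "S \<subseteq> crange c"
  shows "bihermitian_patch S (g c) (Jp c) (Jm c) (add_torsion g \<Gamma> (1/2) H c)"
proof -
  define R where "R y v w = raise_index (g c y) (H c y v w)" for y v w
  have form: "inner_product_form (g c y)" if "y \<in> crange c" for y
    using g c that unfolding riemannian_metric_def inner_product_form_def by blast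
  have Hlin: "linear (H c y v w)" if "y \<in> crange c" for y v w
    using H c that unfolding three_form_def by blast
  have Halt: "H c y v u w = - H c y u v w" "H c y u w v = - H c y u v w" if "y \<in> crange c" for y u v w
    using H c that unfolding three_form_def by blast+
  have gR: "g c y (R y v w) u = H c y v w u" if "y \<in> crange c" for y u v w
    unfolding R_def by (rule raise_index_eq[OF form[OF that] Hlin[OF that]])
  have R_anti: "R y w v = - R y v w" if y: "y \<in> crange c" for y v w
  proof (rule inner_product_form_eqI[OF form[OF y]])
    fix u
    show "g c y (R y w v) u = g c y (- R y v w) u"
      using linear_neg[OF inner_product_form_linear(2)[OF form[OF y]], of "R y v w" u]
      by (simp add: gR[OF y] Halt(1)[OF y, of w v])
  qed
  have \<Gamma>: "\<Gamma> c y v w = \<Gamma> c y w v"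
    "ddir (\<lambda>z. g c z v w) y u = g c y (\<Gamma> c y u v) w + g c y v (\<Gamma> c y u w)" if "y \<in> crange c" for y u v w
    using lc c that unfolding levi_civita_def by blast+
  have plus: "add_torsion g \<Gamma> (1/2) H c y v w = \<Gamma> c y v w + (1/2) *\<^sub>R R y v w"
    and minus: "add_torsion g \<Gamma> (-1/2) H c y v w = \<Gamma> c y v w + (-1/2) *\<^sub>R R y v w" for y v w
    by (simp_all only: add_torsion_def R_def)
  have flip: "add_torsion g \<Gamma> (-1/2) H c y v w = add_torsion g \<Gamma> (1/2) H c y w v" if "y \<in> crange c" for y v w
    unfolding plus minus R_anti[OF that, of w v] \<Gamma>(1)[OF that, of w v] by simp
  show ?thesis
  proof (rule bihermitian_patch.intro)
    show "open S" by (rule S)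
    show "smooth_on S (\<lambda>y. g c y v w)" for v w
      by (rule smooth_on_subset[OF _ S(2)]) (use g c in \<open>simp add: riemannian_metric_def\<close>)
    show "smooth_on S (\<lambda>y. Jp c y v)" for v
      by (rule smooth_on_subset[OF _ S(2)]) (use Jp c in \<open>simp add: endomorphism_field_def\<close>)
    show "smooth_on S (\<lambda>y. Jm c y v)" for v
      by (rule smooth_on_subset[OF _ S(2)]) (use Jm c in \<open>simp add: endomorphism_field_def\<close>)
  next
    fix y assume "y \<in> S"
    then have y: "y \<in> crange c" using S(2) by blast
    note lin = inner_product_form_linear[OF form[OF y]]
    show "inner_product_form (g c y)" by (rule form[OF y])
    show "linear (Jp c y)" "linear (Jm c y)" using Jp Jm c y unfolding endomorphism_field_def by blast+
    show "Jp c y (Jp c y v) = - v" "Jm c y (Jm c y v) = - v" for v using sq c y by blast+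
    show "g c y (Jp c y v) (Jp c y w) = g c y v w" "g c y (Jm c y v) (Jm c y w) = g c y v w" for v w
      using orth c y unfolding orthogonal_field_def by blast+
    show "ddir (\<lambda>z. g c z v w) y u = g c y (add_torsion g \<Gamma> (1 / 2) H c y u v) w + g c y v (add_torsion g \<Gamma> (1 / 2) H c y u w)" for u v w
    proof -
      have "g c y v (R y u w) = - g c y (R y u v) w"
        using inner_product_form_sym[OF form[OF y], of v "R y u w"] by (simp add: gR[OF y] Halt(2)[OF y, of u w v])
      then show ?thesis
        unfolding plus \<Gamma>(2)[OF y]
        by (simp only: linear_add[OF lin(1)] linear_scale[OF lin(1)] linear_add[OF lin(2)] linear_scale[OF lin(2)]) simp
    qed
    show "ddir (\<lambda>z. Jp c z w) y v = Jp c y (add_torsion g \<Gamma> (1 / 2) H c y v w) - add_torsion g \<Gamma> (1 / 2) H c y v (Jp c y w)" for v w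
    proof -
      have "ddir (\<lambda>z. Jp c z w) y v + add_torsion g \<Gamma> (1 / 2) H c y v (Jp c y w)
          - Jp c y (add_torsion g \<Gamma> (1 / 2) H c y v w) = 0"
        using par(1) c y unfolding parallel_def by blast
      then show ?thesis by (simp add: algebra_simps)
    qed
    show "ddir (\<lambda>z. Jm c z w) y v = Jm c y (add_torsion g \<Gamma> (1 / 2) H c y w v) - add_torsion g \<Gamma> (1 / 2) H c y (Jm c y w) v" for v w
    proof -
      have "ddir (\<lambda>z. Jm c z w) y v + add_torsion g \<Gamma> (-1 / 2) H c y v (Jm c y w)
          - Jm c y (add_torsion g \<Gamma> (-1 / 2) H c y v w) = 0"
        using par(2) c y unfolding parallel_def by blast
      then show ?thesis unfolding flip[OF y] by (simp add: algebra_simps)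
    qed
    show "g c y (add_torsion g \<Gamma> (1 / 2) H c y v w - add_torsion g \<Gamma> (1 / 2) H c y w v) u =
      - g c y w (add_torsion g \<Gamma> (1 / 2) H c y v u - add_torsion g \<Gamma> (1 / 2) H c y u v)" for u v w
    proof -
      have tors: "add_torsion g \<Gamma> (1 / 2) H c y v w - add_torsion g \<Gamma> (1 / 2) H c y w v = R y v w" for v w
        unfolding plus R_anti[OF y, of w v] \<Gamma>(1)[OF y, of w v]
        using scaleR_add_left[of "1/2" "1/2" "R y v w"] by simp
      show ?thesis unfolding tors inner_product_form_sym[OF form[OF y], of w] gR[OF y]
        by (rule Halt(2)[OF y])
    qed
  qed
qed

text \<open>
At a point of type (2,1) the structures commute, so the holomorphic function that describes the commuting locus
vanishes there. Its zero set contains a point near which it is a complex hypersurface or open, and the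
corresponding chart exhibits a regular point of dimension at least two. Here \<open>Jm\<close> is an almost complex
structure, so that both \<open>J\<^sub>-\<close> and \<open>- J\<^sub>-\<close> can be taken for it.
\<close>

theorem type_21_stratum_empty:
  fixes X :: "'a topology" and A :: "('a, complex^'n) chart set"
  assumes M: "smooth_manifold X A" and g: "riemannian_metric A g"
    and cp: "complex_structure X A Jp" and Jm: "endomorphism_field A Jm"
    and sqm: "\<forall>c\<in>A. \<forall>y\<in>crange c. \<forall>v. Jm c y (Jm c y v) = - v"
    and orth: "orthogonal_field A g Jp" "orthogonal_field A g Jm"
    and lc: "levi_civita A g \<Gamma>" and H: "three_form A H"
    and par: "parallel A (add_torsion g \<Gamma> (1/2) H) Jp" "parallel A (add_torsion g \<Gamma> (-1/2) H) Jm"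
    and n3: "CARD('n) = 3"
    and small: "complex_dim X A Jp (commuting_locus X A Jp Jm) \<le> 1"
  shows "type_stratum X A Jp Jm 2 1 = {}"
proof (rule ccontr)
  assume "type_stratum X A Jp Jm 2 1 \<noteq> {}"
  then obtain p where p: "p \<in> type_stratum X A Jp Jm 2 1" by blast
  have Jp: "endomorphism_field A Jp" and sqp: "\<forall>c\<in>A. \<forall>y\<in>crange c. \<forall>v. Jp c y (Jp c y v) = - v"
    using cp by (simp_all add: complex_structure_def)
  have pX: "p \<in> topspace X" using p by (simp add: type_stratum_def)
  then obtain c where c: "c \<in> A" "p \<in> cdom c" using M unfolding smooth_manifold_def by blast
  obtain h where h: "holomorphic_chart X A Jp h" "p \<in> cdom h"
    using cp pX unfolding complex_structure_def by blast
  have chart: "is_chart X d" if "d \<in> A" for d using M that by (simp add: smooth_manifold_def)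
  have ch: "is_chart X h" and comp: "smooth_compatible c h" using h c by (simp_all add: holomorphic_chart_def)
  then have comp': "smooth_compatible h c" by (simp add: smooth_compatible_def)
  note cc = chart[OF c(1)]
  define S where "S = overlap c h"
  define z where "z = transition c h"
  define \<tau> where "\<tau> = transition h c"
  define y0 where "y0 = coord c p"
  have y0: "y0 \<in> S" unfolding y0_def S_def by (rule overlapI[OF c(2) h(2)])
  have S: "open S" "S \<subseteq> crange c" unfolding S_def by (rule overlap_open[OF cc ch], rule overlap_subset)
  interpret bihermitian_patch S "g c" "Jp c" "Jm c" "add_torsion g \<Gamma> (1/2) H c"
    by (rule chart_patch[OF g Jp Jm sqp sqm orth lc H par c(1) S])
  have smz: "smooth_on S z" and sm\<tau>: "smooth_on (overlap h c) \<tau>"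
    using comp by (simp_all add: smooth_compatible_def S_def z_def \<tau>_def)
  have opO: "open (overlap h c)" by (rule overlap_open[OF ch cc])
  have dz: "ddir z y (Jp c y v) = \<i> *s ddir z y v" if "y \<in> S" for y v
    using h(1) c(1) that by (simp add: holomorphic_chart_def S_def z_def transition_deriv_def)
  have zO: "z y \<in> overlap h c" if "y \<in> S" for y
    unfolding z_def by (rule transition_in_overlap[OF cc]) (use that in \<open>simp add: S_def\<close>)
  have \<tau>S: "\<tau> w \<in> S" if "w \<in> overlap h c" for w
    unfolding \<tau>_def S_def by (rule transition_in_overlap[OF ch that])
  have \<tau>z: "\<tau> (z y) = y" if "y \<in> S" for y
    unfolding \<tau>_def z_def by (rule transition_inverse[OF cc ch]) (use that in \<open>simp add: S_def\<close>)
  have z\<tau>: "z (\<tau> w) = w" if "w \<in> overlap h c" for w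
    unfolding \<tau>_def z_def by (rule transition_inverse[OF ch cc that])
  define Z' where "Z' y w = ddir \<tau> (z y) w" for y w
  have Z'1: "Z' y (ddir z y v) = v" if "y \<in> S" for y v
    using transition_deriv_inverse[OF cc ch comp, of y v] that
    by (simp add: Z'_def S_def z_def \<tau>_def transition_deriv_def)
  have Z'2: "ddir z y (Z' y w) = w" if y: "y \<in> S" for y w
    using transition_deriv_inverse[OF ch cc comp' zO[OF y], of w] \<tau>z[OF y]
    by (simp add: Z'_def z_def \<tau>_def transition_deriv_def)
  have Z'3: "continuous_on S (\<lambda>y. Z' y w)" for w unfolding Z'_def
    by (rule continuous_on_compose2[OF smooth_on_continuous[OF smooth_on_ddir[OF sm\<tau>]] smooth_on_continuous[OF smz]])
      (use zO in auto)
  have dims: "dim {v. Jp c y0 v + Jm c y0 v = 0} = 4" "dim {v. Jp c y0 v - Jm c y0 v = 0} = 2"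
    using p c by (simp_all add: type_stratum_def y0_def)
  have "\<not> {v. Jp c y0 v - Jm c y0 v = 0} \<subseteq> {0}"
  proof
    assume "{v. Jp c y0 v - Jm c y0 v = 0} \<subseteq> {0}"
    then have "dim {v. Jp c y0 v - Jm c y0 v = 0} = 0" by (simp only: dim_eq_0)
    then show False using dims(2) by linarith
  qed
  then obtain v0 where v0: "v0 \<noteq> 0" "Jp c y0 v0 = Jm c y0 v0" by auto
  have D6: "DIM(complex^'n) = 6" using n3 by simp
  obtain F U where F: "holomorphic_wrt (Jp c) S F" and U: "open U" "y0 \<in> U" "U \<subseteq> S" and F0: "F y0 = 0"
    and Fzero: "\<And>y. y \<in> U \<Longrightarrow> F y = 0 \<longleftrightarrow> (\<forall>v. Jp c y (Jm c y v) = Jm c y (Jp c y v))"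
    by (rule commuting_locus_locally_zero_set[OF n3 D6 y0 smz dz Z'1 Z'2 Z'3 dims(1) v0]) blast+
  define Ob where "Ob = overlap h c \<inter> \<tau> -` U"
  define f where "f w = F (\<tau> w)" for w
  have Ob: "open Ob" unfolding Ob_def
    by (rule continuous_open_preimage[OF smooth_on_continuous[OF sm\<tau>] opO U(1)])
  have pOb: "coord h p \<in> Ob" and fp: "f (coord h p) = 0"
    using U(2) F0 overlapI[OF h(2) c(2)] transition_coord[OF ch h(2), of c]
    by (simp_all add: Ob_def f_def \<tau>_def y0_def)
  have f: "holomorphic_std Ob f"
    unfolding holomorphic_wrt_def
  proof (intro conjI ballI allI)
    have "smooth_on Ob \<tau>" by (rule smooth_on_subset[OF sm\<tau>]) (auto simp: Ob_def)
    then show "smooth_on Ob f" unfolding f_def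
      by (rule smooth_on_compose[OF holomorphic_wrt_smooth[OF F]]) (use \<tau>S Ob S(1) in \<open>auto simp: Ob_def\<close>)
    fix w v assume "w \<in> Ob"
    then have w: "w \<in> overlap h c" by (simp add: Ob_def)
    have "(f has_derivative (\<lambda>v. ddir F (\<tau> w) (ddir \<tau> w v))) (at w)"
      unfolding f_def
      by (rule has_derivative_compose[OF ddir_has_derivative[OF smooth_on_differentiable[OF sm\<tau> w]]
            ddir_has_derivative[OF smooth_on_differentiable[OF holomorphic_wrt_smooth[OF F] \<tau>S[OF w]]]])
    then have D: "ddir f w v = ddir F (\<tau> w) (ddir \<tau> w v)" for v by (rule ddir_eqI)
    have Z'\<tau>: "Z' (\<tau> w) v = ddir \<tau> w v" for v by (simp add: Z'_def z\<tau>[OF w])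
    have "ddir z (\<tau> w) (Jp c (\<tau> w) (ddir \<tau> w v)) = \<i> *s v"
      using dz[OF \<tau>S[OF w], of "ddir \<tau> w v"] Z'2[OF \<tau>S[OF w], of v] by (simp add: Z'\<tau>)
    then have "ddir \<tau> w (\<i> *s v) = Jp c (\<tau> w) (ddir \<tau> w v)"
      using Z'1[OF \<tau>S[OF w], of "Jp c (\<tau> w) (ddir \<tau> w v)"] by (simp add: Z'\<tau>)
    then show "ddir f w (\<i> *s v) = \<i> * ddir f w v"
      unfolding D by (simp add: holomorphic_wrt_ddir[OF F \<tau>S[OF w]])
  qed
  obtain V W L and \<Phi> \<Psi> :: "complex^'n \<Rightarrow> complex^'n" and q'
    where V: "open V" "V \<subseteq> Ob" and q': "q' \<in> V" "f q' = 0" and W: "open W" "homeomorphism V W \<Phi> \<Psi>"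
      "smooth_on V \<Phi>" "smooth_on W \<Psi>" and cl: "\<And>z v. z \<in> V \<Longrightarrow> ddir \<Phi> z (\<i> *s v) = \<i> *s ddir \<Phi> z v"
      and L: "vec.subspace L" "CARD('n) \<le> vec.dim L + 1" "\<Phi> ` {z \<in> V. f z = 0} = W \<inter> L"
    by (rule zero_set_has_hypersurface_point[OF f Ob pOb fp]) blast
  have Vh: "V \<subseteq> overlap h c" using V(2) by (auto simp: Ob_def)
  then have Vr: "V \<subseteq> crange h" using overlap_subset[of h c] by blast
  define h' where "h' = (cdom h \<inter> coord h -` V, \<Phi> \<circ> coord h)"
  have h': "holomorphic_chart X A Jp h'" "crange h' = W"
    unfolding h'_def by (rule holomorphic_chart_postcompose[OF chart h(1) V(1) Vr W cl]; assumption)+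
  have dom: "cdom h' = cdom h \<inter> coord h -` V" by (simp add: h'_def)
  let ?M0 = "commuting_locus X A Jp Jm"
  have M0: "x \<in> ?M0 \<longleftrightarrow> f (coord h x) = 0" if x: "x \<in> cdom h'" for x
  proof -
    have xh: "x \<in> cdom h" and "coord h x \<in> overlap h c" and xU: "\<tau> (coord h x) \<in> U"
      using x V(2) by (auto simp: dom Ob_def)
    then obtain x' where "x' \<in> cdom h" "x' \<in> cdom c" "coord h x = coord h x'" by (auto elim: overlapE)
    then have xc: "x \<in> cdom c" using chart_inj[OF ch] xh by (auto dest: inj_onD)
    have \<tau>x: "\<tau> (coord h x) = coord c x" unfolding \<tau>_def by (rule transition_coord[OF ch xh])
    show ?thesis
      unfolding commuting_locus_iff[OF M Jp Jm c(1) xc] f_def \<tau>x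
      using Fzero[of "coord c x"] xU unfolding \<tau>x by simp
  qed
  have "q' \<in> crange h" using q'(1) Vr by blast
  then obtain q where q: "q \<in> cdom h" "q' = coord h q" by (auto simp: crange_def)
  then have qh': "q \<in> cdom h'" using q'(1) by (simp add: dom)
  have "coord h ` (?M0 \<inter> cdom h') = {z \<in> V. f z = 0}"
    using M0 Vr by (auto simp: dom crange_def)
  moreover have "coord h' ` T = \<Phi> ` coord h ` T" for T by (simp add: h'_def image_comp)
  ultimately have im: "coord h' ` (?M0 \<inter> cdom h') = crange h' \<inter> L"
    using L(3) h'(2) by (simp only:)
  have "q \<in> ?M0" using M0[OF qh'] q'(2) q(2) by simp
  then have "complex_regular_point X A Jp ?M0 (vec.dim L) q"
    unfolding complex_regular_point_def
    by (intro conjI exI[of _ h'] exI[of _ L] h'(1) qh' L(1) im refl)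
  then have "ereal (real (vec.dim L)) \<le> complex_dim X A Jp ?M0"
    unfolding complex_dim_def by (intro Sup_upper) blast
  also have "\<dots> \<le> 1" by (rule small)
  finally have "vec.dim L \<le> 1" by simp
  then show False using L(2) n3 by simp
qed

theorem theorem8p13:
  fixes X :: "'a topology"
    and A :: "('a, complex^'n) chart set"
    and g :: "('a, complex^'n) bilinear_form_field"
    and Jp Jm :: "('a, complex^'n) endomorphism_field"
  assumes "bihermitian_manifold X A g Jp Jm"
    and "CARD('n) = 3"
    and "complex_dim X A Jp (commuting_locus X A Jp Jm) \<le> 1"
  shows "type_stratum X A Jp Jm 2 1 = {} \<and> type_stratum X A Jp Jm 1 2 = {}"
proof
  have M: "smooth_manifold X A" and g: "riemannian_metric A g"
    and Jp: "complex_structure X A Jp" and "complex_structure X A Jm"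
    and orth: "orthogonal_field A g Jp" "orthogonal_field A g Jm"
    using assms(1) by (simp_all add: bihermitian_manifold_def)
  then have Jm: "endomorphism_field A Jm" and sq: "\<forall>c\<in>A. \<forall>y\<in>crange c. \<forall>v. Jm c y (Jm c y v) = - v"
    by (simp_all add: complex_structure_def)
  obtain \<Gamma> H where lc: "levi_civita A g \<Gamma>" and H: "three_form A H"
    and par: "parallel A (add_torsion g \<Gamma> (1/2) H) Jp" "parallel A (add_torsion g \<Gamma> (-1/2) H) Jm"
    using assms(1) unfolding bihermitian_manifold_def closed_three_form_def by blast
  show "type_stratum X A Jp Jm 2 1 = {}"
    by (rule type_21_stratum_empty[OF M g Jp Jm sq orth lc H par assms(2,3)])
  \<comment> \<open>changing the sign of \<open>J\<^sub>-\<close> exchanges the two kernels, hence the two strata\<close>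
  define Jn where "Jn c y v = - Jm c y v" for c y v
  have linJ: "linear (Jm c y)" if "c \<in> A" "y \<in> crange c" for c y
    using Jm that unfolding endomorphism_field_def by blast
  have smJ: "smooth_on (crange c) (\<lambda>y. Jm c y v)" if "c \<in> A" for c v
    using Jm that unfolding endomorphism_field_def by blast
  have chart: "is_chart X c" if "c \<in> A" for c using M that unfolding smooth_manifold_def by blast
  then have op: "open (crange c)" if "c \<in> A" for c using that unfolding is_chart_def by blast
  have linT: "linear (transition_deriv c d y)" if "c \<in> A" "d \<in> A" "y \<in> overlap c d" for c d y
    unfolding transition_deriv_def
  proof (rule linear_ddir[OF smooth_on_differentiable[OF _ that(3)]])
    show "smooth_on (overlap c d) (transition c d)"
      using M that unfolding smooth_manifold_def smooth_compatible_def by blast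
  qed
  have "endomorphism_field A Jn"
    unfolding endomorphism_field_def
  proof (intro conjI ballI allI)
    show "linear (Jn c y)" if "c \<in> A" "y \<in> crange c" for c y
      unfolding Jn_def by (rule linear_compose_neg[OF linJ[OF that]])
    show "smooth_on (crange c) (\<lambda>y. Jn c y v)" if "c \<in> A" for c v
      unfolding Jn_def
      by (rule smooth_on_linear_compose[OF bounded_linear_minus[OF bounded_linear_ident] smJ[OF that] op[OF that]])
    show "Jn d (transition c d y) (transition_deriv c d y v) = transition_deriv c d y (Jn c y v)"
      if "c \<in> A" "d \<in> A" "y \<in> overlap c d" for c d y v
    proof -
      have "Jm d (transition c d y) (transition_deriv c d y v) = transition_deriv c d y (Jm c y v)"
        using Jm that unfolding endomorphism_field_def by blast
      then show ?thesis unfolding Jn_def by (simp only: linear_neg[OF linT[OF that]])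
    qed
  qed
  moreover have "\<forall>c\<in>A. \<forall>y\<in>crange c. \<forall>v. Jn c y (Jn c y v) = - v"
    using sq by (simp add: Jn_def linear_neg[OF linJ])
  moreover have "orthogonal_field A g Jn"
    unfolding orthogonal_field_def
  proof (intro ballI allI)
    fix c y v w assume cy: "c \<in> A" "y \<in> crange c"
    then have form: "inner_product_form (g c y)"
      using g unfolding riemannian_metric_def inner_product_form_def by blast
    have "g c y (Jm c y v) (Jm c y w) = g c y v w"
      using orth(2) cy unfolding orthogonal_field_def by blast
    then show "g c y (Jn c y v) (Jn c y w) = g c y v w"
      by (simp add: Jn_def linear_neg[OF inner_product_form_linear(1)[OF form]]
          linear_neg[OF inner_product_form_linear(2)[OF form]])
  qed
  moreover have "parallel A (add_torsion g \<Gamma> (-1/2) H) Jn"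
    unfolding parallel_def
  proof (intro ballI allI)
    fix c y v w assume cy: "c \<in> A" "y \<in> crange c"
    let ?\<Gamma> = "add_torsion g \<Gamma> (-1/2) H c y v"
    have "ddir (\<lambda>z. Jn c z w) y v = - ddir (\<lambda>z. Jm c z w) y v"
      unfolding Jn_def
      by (rule ddir_eqI[OF has_derivative_minus[OF ddir_has_derivative[OF smooth_on_differentiable[OF smJ[OF cy(1)] cy(2)]]]])
    moreover have "ddir (\<lambda>z. Jm c z w) y v + ?\<Gamma> (Jm c y w) - Jm c y (?\<Gamma> w) = 0"
      using par(2) cy unfolding parallel_def by blast
    moreover have "?\<Gamma> (Jn c y w) = - ?\<Gamma> (Jm c y w)"
    proof -
      have form: "inner_product_form (g c y)"
        using g cy unfolding riemannian_metric_def inner_product_form_def by blast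
      have "bilinear (\<Gamma> c y)" using lc cy unfolding levi_civita_def affine_connection_def by blast
      then have "\<Gamma> c y v (- Jm c y w) = - \<Gamma> c y v (Jm c y w)" by (rule bilinear_rneg)
      moreover have "raise_index (g c y) (H c y v (- Jm c y w)) = - raise_index (g c y) (H c y v (Jm c y w))"
      proof (rule raise_index_unique[OF form])
        fix u
        have lin: "linear (H c y a b)" for a b using H cy unfolding three_form_def by blast
        have alt: "H c y a b d = - H c y a d b" for a b d using H cy unfolding three_form_def by blast
        have "g c y (- raise_index (g c y) (H c y v (Jm c y w))) u = - H c y v (Jm c y w) u"
          by (simp add: linear_neg[OF inner_product_form_linear(2)[OF form], of _ u] raise_index_eq[OF form lin])
        also have "\<dots> = - H c y v u (- Jm c y w)"
          by (simp add: linear_neg[OF lin] alt[of v u "Jm c y w"])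
        also have "\<dots> = H c y v (- Jm c y w) u" by (rule alt[symmetric])
        finally show "g c y (- raise_index (g c y) (H c y v (Jm c y w))) u = H c y v (- Jm c y w) u" .
      qed
      ultimately show ?thesis by (simp add: add_torsion_def Jn_def)
    qed
    ultimately show "ddir (\<lambda>z. Jn c z w) y v + ?\<Gamma> (Jn c y w) - Jn c y (?\<Gamma> w) = 0"
      unfolding Jn_def by (simp add: algebra_simps)
  qed
  moreover have "commuting_locus X A Jp Jn = commuting_locus X A Jp Jm"
  proof -
    have "Jp c (coord c p) (Jn c (coord c p) v) = Jn c (coord c p) (Jp c (coord c p) v) \<longleftrightarrow>
        Jp c (coord c p) (Jm c (coord c p) v) = Jm c (coord c p) (Jp c (coord c p) v)"
      if "c \<in> A" "p \<in> cdom c" for c p v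
    proof -
      have "coord c p \<in> crange c" using that(2) by (simp add: crange_def)
      then have "linear (Jp c (coord c p))"
        using Jp that(1) unfolding complex_structure_def endomorphism_field_def by blast
      from linear_neg[OF this] show ?thesis by (simp add: Jn_def)
    qed
    then show ?thesis unfolding commuting_locus_def by blast
  qed
  ultimately have "type_stratum X A Jp Jn 2 1 = {}"
    using assms(3) by (intro type_21_stratum_empty[OF M g Jp _ _ orth(1) _ lc H par(1) _ assms(2)]) simp_all
  moreover have "type_stratum X A Jp Jm 1 2 = type_stratum X A Jp Jn 2 1"
    unfolding type_stratum_def Jn_def by (auto simp: conj_commute)
  ultimately show "type_stratum X A Jp Jm 1 2 = {}" by simp
qed

end
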